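(* Let $n\ge1$ and let $r$ be an even integer with $0\le r\le n-1$. For $T>0$ let $$N_{n,r}(T)=\#\{A\in\mathrm{M}_n(\mathbb{Z})_{\mathrm{alt}}:\ \operatorname{rank}A=r\text{ and }|A|<T\},$$ where $|A|=(\sum_{i,j}a_{ij}^2)^{1/2}$. Then $N_{n,r}(T)\asymp_n T^{nr/2}$ for all sufficiently large real $T$.
   Context: $\mathrm{M}_n(\mathbb{Z})_{\mathrm{alt}}$ is the set of $n\times n$ integer matrices $A$ with $A^T=-A$ and zero diagonal. $f\asymp_n g$ means $f$ and $g$ are each bounded by a positive constant depending only on $n$ times the other. *)

theory Defs
  imports "HOL-Analysis.Analysis"
begin

definition alt_int_matrices :: "(int ^ 'n ^ 'n) set" where
  "alt_int_matrices = {A. transpose A = - A \<and> (\<forall>i. A $ i $ i = 0)}"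

text \<open>The library's \<^const>\<open>rank\<close> needs entries in a field, so the rank of an integer matrix is
  taken after extending scalars to the reals.\<close>

definition int_matrix_rank :: "int ^ 'n ^ 'm \<Rightarrow> nat" where
  "int_matrix_rank A = rank (\<chi> i j. real_of_int (A $ i $ j))"

definition int_matrix_norm :: "int ^ 'n ^ 'm \<Rightarrow> real" where
  "int_matrix_norm A = sqrt (\<Sum>i\<in>UNIV. \<Sum>j\<in>UNIV. (real_of_int (A $ i $ j))\<^sup>2)"

text \<open>The size \<open>n\<close> is \<open>CARD('n)\<close>; the \<open>itself\<close> argument only passes the index type.\<close>

definition alt_rank_count :: "'n::finite itself \<Rightarrow> nat \<Rightarrow> real \<Rightarrow> nat" where
  "alt_rank_count _ r T =
     card {A :: int ^ 'n ^ 'n. A \<in> alt_int_matrices \<and> int_matrix_rank A = r \<and> int_matrix_norm A < T}"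

end

theory Submission
  imports Defs
begin

text \<open>
  An alternating integer matrix \<open>A\<close> of rank \<open>r\<close> is an alternating form in \<open>\<Lambda>\<^sup>2 L\<close>, where \<open>L\<close> is the
  lattice of integer points of its column space.  Let \<open>v\<^sub>0, \<dots>, v\<^bsub>r-1\<^esub>\<close> be a Korkine--Zolotarev reduced
  basis of \<open>L\<close> with Gram--Schmidt norms \<open>a\<^sub>i\<close>, and write \<open>A = \<Sum> c\<^sub>i\<^sub>j v\<^sub>i \<otimes> v\<^sub>j\<close>, so that
  \<open>|c\<^sub>i\<^sub>j| \<lless> T / (a\<^sub>i a\<^sub>j)\<close>.  At most \<open>\<Prod>\<^sub>j a\<^sub>0 \<cdots> a\<^bsub>j-1\<^esub> a\<^sub>j\<^bsup>n-j\<^esup>\<close> (up to a constant) bases have Gram--Schmidt norms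
  of given sizes, and \<open>c\<close> can only be nonsingular if \<open>a\<^sub>i a\<^bsub>r-1-i\<^esub> \<lless> T\<close> for all \<open>i\<close>.  In terms of
  \<open>\<beta>\<^sub>i = a\<^sub>i / \<surd>T\<close> the number of pairs \<open>(v, c)\<close> is at most
  \<open>T\<^bsup>nr/2\<^esup> \<Prod>\<^bsub>p<r/2\<^esub> \<beta>\<^sub>p\<^sup>3 \<beta>\<^bsub>r-1-p\<^esub>\<close>, and this is summable over dyadic \<open>\<beta>\<close>.

  For the lower bound take \<open>A = \<Sum>\<^bsub>p<r/2\<^esub> b\<^sub>p \<and> b\<^bsub>r/2+p\<^esub>\<close> for independent integer vectors \<open>b\<^sub>i\<close> of length at
  most \<open>H\<close>, a small multiple of \<open>\<surd>T\<close>.  The same counting shows that for all but a small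
  proportion of the tuples \<open>b\<close> every \<open>a\<^sub>i\<close> of the lattice of integer points in the span of \<open>b\<close> is
  at least \<open>\<delta> H\<close>.  Then each \<open>b\<^sub>i\<close> has bounded coordinates in the reduced basis, which depends
  only on \<open>A\<close>, and so each \<open>A\<close> arises from boundedly many \<open>b\<close>.
\<close>

subsection \<open>Gram--Schmidt orthogonalisation\<close>

text \<open>Unnormalised Gram--Schmidt. A zero \<open>gso v i\<close> contributes nothing because
  division by 0 gives 0, so the recursion makes sense for arbitrary sequences.\<close>

fun gso :: "(nat \<Rightarrow> 'a::real_inner) \<Rightarrow> nat \<Rightarrow> 'a" where
  "gso v j = v j - (\<Sum>i<j. ((v j \<bullet> gso v i) / (gso v i \<bullet> gso v i)) *\<^sub>R gso v i)"

declare gso.simps [simp del]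

text \<open>Projection away from the first \<open>j\<close> Gram--Schmidt vectors, for an arbitrary
  \<open>x\<close> and not only for \<open>v j\<close>: reducedness compares \<open>gso v j\<close>
  with the projections of all lattice points.\<close>

definition gproj :: "(nat \<Rightarrow> 'a::real_inner) \<Rightarrow> nat \<Rightarrow> 'a \<Rightarrow> 'a" where
  "gproj v j x = x - (\<Sum>i<j. ((x \<bullet> gso v i) / (gso v i \<bullet> gso v i)) *\<^sub>R gso v i)"

lemma gso_eq_gproj: "gso v j = gproj v j (v j)"
  by (simp add: gproj_def gso.simps[of v j])

lemma gproj_0 [simp]: "gproj v 0 x = x"
  by (simp add: gproj_def)

lemma gproj_Suc:
  "gproj v (Suc i) x = gproj v i x - ((x \<bullet> gso v i) / (gso v i \<bullet> gso v i)) *\<^sub>R gso v i"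
  by (simp add: gproj_def)

text \<open>Lets a basis be extended by \<open>v(j := y)\<close> or cut down by
  \<open>restrict\<close> without disturbing the vectors already built.\<close>

lemma gso_cong: "(\<And>i. i \<le> j \<Longrightarrow> v i = w i) \<Longrightarrow> gso v j = gso w j"
proof (induction j rule: less_induct)
  case (less j)
  have "gso v i = gso w i" if "i < j" for i
    using less.IH[OF that] less.prems that by auto
  then show ?case
    using less.prems[of j] by (simp add: gso.simps[of v j] gso.simps[of w j])
qed

lemma gproj_cong: "(\<And>i. i < j \<Longrightarrow> v i = w i) \<Longrightarrow> gproj v j x = gproj w j x"
proof -
  assume a: "\<And>i. i < j \<Longrightarrow> v i = w i"
  have "gso v i = gso w i" if "i < j" for i
    using gso_cong[of i v w] a that by auto
  then show ?thesis by (simp add: gproj_def)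
qed

lemma gso_orthogonal_less: "l < i \<Longrightarrow> gso v i \<bullet> gso v l = 0"
proof (induction i arbitrary: l rule: less_induct)
  case (less i)
  have *: "gso v k \<bullet> gso v l = 0" if "k < i" "k \<noteq> l" for k
  proof (cases "l < k")
    case True
    then show ?thesis using less.IH[OF that(1)] by simp
  next
    case False
    then show ?thesis using less.IH[of l k] less.prems that by (simp add: inner_commute)
  qed
  have "(\<Sum>k<i. ((v i \<bullet> gso v k) / (gso v k \<bullet> gso v k)) * (gso v k \<bullet> gso v l))
     = (\<Sum>k<i. if k = l then v i \<bullet> gso v l else 0)"
    by (rule sum.cong) (auto simp: *)
  then show ?case
    using less.prems by (simp add: gso.simps[of v i] inner_diff_left inner_sum_left)
qed

lemma gso_orthogonal: "l \<noteq> i \<Longrightarrow> gso v i \<bullet> gso v l = 0"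
  by (metis gso_orthogonal_less inner_commute nat_neq_iff)

lemma gproj_orthogonal:
  assumes "l < j" shows "gproj v j x \<bullet> gso v l = 0"
proof -
  have "(\<Sum>k<j. ((x \<bullet> gso v k) / (gso v k \<bullet> gso v k)) * (gso v k \<bullet> gso v l))
     = (\<Sum>k<j. if k = l then x \<bullet> gso v l else 0)"
    by (rule sum.cong) (auto simp: gso_orthogonal)
  then show ?thesis
    using assms by (simp add: gproj_def inner_diff_left inner_sum_left)
qed

lemma gproj_inner_gso:
  assumes "j \<le> l" shows "gproj v j x \<bullet> gso v l = x \<bullet> gso v l"
proof -
  have "(\<Sum>k<j. ((x \<bullet> gso v k) / (gso v k \<bullet> gso v k)) * (gso v k \<bullet> gso v l)) = 0"
    using assms by (intro sum.neutral) (auto simp: gso_orthogonal)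
  then show ?thesis by (simp add: gproj_def inner_diff_left inner_sum_left)
qed

lemma inner_gso_self: "v i \<bullet> gso v i = gso v i \<bullet> gso v i"
  by (metis gproj_inner_gso gso_eq_gproj order_refl)

lemma gso_expansion:
  "v i = gso v i + (\<Sum>l<i. ((v i \<bullet> gso v l) / (gso v l \<bullet> gso v l)) *\<^sub>R gso v l)"
  by (simp add: gso.simps[of v i])

lemma inner_gso_later:
  assumes "i < l" shows "v i \<bullet> gso v l = 0"
proof -
  have "v i \<bullet> gso v l = (gso v i + (\<Sum>k<i. ((v i \<bullet> gso v k) / (gso v k \<bullet> gso v k)) *\<^sub>R gso v k)) \<bullet> gso v l"
    using gso_expansion[of v i] by simp
  also have "\<dots> = 0"
    using assms by (simp add: inner_add_left inner_sum_left gso_orthogonal)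
  finally show ?thesis .
qed

lemma gproj_diff: "gproj v j (x - y) = gproj v j x - gproj v j y"
  by (simp add: gproj_def inner_diff_left diff_divide_distrib scaleR_diff_left sum_subtractf)

lemma gproj_scale: "gproj v j (c *\<^sub>R x) = c *\<^sub>R gproj v j x"
  by (simp add: gproj_def scaleR_diff_right scaleR_sum_right)

lemma gproj_sum: "gproj v j (sum f S) = (\<Sum>i\<in>S. gproj v j (f i))"
proof (induction S rule: infinite_finite_induct)
  case (insert x F)
  have "gproj v j (a + b) = gproj v j a + gproj v j b" for a b
    using gproj_diff[of v j "a + b" b] by (simp add: algebra_simps)
  with insert show ?case by simp
qed (auto simp: gproj_def)

text \<open>Inner products with later Gram--Schmidt vectors vanish, so the projection subtracts
  exactly the Gram--Schmidt expansion of \<open>v i\<close>.\<close>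

lemma gproj_earlier:
  assumes "i < j" shows "gproj v j (v i) = 0"
proof -
  have "(\<Sum>l<j. ((v i \<bullet> gso v l) / (gso v l \<bullet> gso v l)) *\<^sub>R gso v l)
      = (\<Sum>l<Suc i. ((v i \<bullet> gso v l) / (gso v l \<bullet> gso v l)) *\<^sub>R gso v l)"
    using assms by (intro sum.mono_neutral_right) (auto simp: inner_gso_later)
  also have "\<dots> = v i"
  proof -
    have e: "(\<Sum>l<i. ((v i \<bullet> gso v l) / (gso v l \<bullet> gso v l)) *\<^sub>R gso v l) = v i - gso v i"
      using gso_expansion[of v i] by (simp add: algebra_simps)
    \<comment> \<open>If \<open>gso v i\<close> is zero, its term drops out and \<open>v i\<close>
      already equals the sum over \<open>l < i\<close>.\<close>
    show ?thesis by (cases "gso v i = 0") (simp_all add: e inner_gso_self)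
  qed
  finally show ?thesis by (simp add: gproj_def)
qed

lemma gso_in_span: "gso v i \<in> span (v ` {..i})"
proof (induction i rule: less_induct)
  case (less i)
  have "gso v l \<in> span (v ` {..i})" if "l < i" for l
    using less.IH[OF that] span_mono[of "v ` {..l}" "v ` {..i}"] that by fastforce
  then show ?case
    by (subst gso.simps) (intro span_diff span_sum span_scale, auto intro: span_base)
qed

text \<open>Babai's nearest plane procedure: the multiple of the last vector is rounded off first.
  Later subtractions use earlier vectors, which are orthogonal to \<open>gso v j\<close>, and so
  keep what was achieved.\<close>

lemma size_reduce:
  fixes v :: "nat \<Rightarrow> 'a::real_inner"
  assumes "\<And>i. i < j \<Longrightarrow> gso v i \<noteq> 0"
  shows "\<exists>m :: nat \<Rightarrow> int. \<forall>l<j. \<bar>(x - (\<Sum>i<j. of_int (m i) *\<^sub>R v i)) \<bullet> gso v l\<bar> \<le> (gso v l \<bullet> gso v l) / 2"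
  using assms
proof (induction j arbitrary: x)
  case (Suc j)
  define k where "k = round ((x \<bullet> gso v j) / (gso v j \<bullet> gso v j))"
  let ?y = "x - of_int k *\<^sub>R v j"
  obtain m where m: "\<forall>l<j. \<bar>(?y - (\<Sum>i<j. of_int (m i) *\<^sub>R v i)) \<bullet> gso v l\<bar> \<le> (gso v l \<bullet> gso v l) / 2"
    using Suc.IH[of ?y] Suc.prems by (meson less_SucI)
  let ?m = "m(j := k)"
  have eq: "x - (\<Sum>i<Suc j. of_int (?m i) *\<^sub>R v i) = ?y - (\<Sum>i<j. of_int (m i) *\<^sub>R v i)"
    by simp
  have pos: "gso v j \<bullet> gso v j > 0" using Suc.prems[of j] by simp
  have "(?y - (\<Sum>i<j. of_int (m i) *\<^sub>R v i)) \<bullet> gso v j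
      = x \<bullet> gso v j - of_int k * (gso v j \<bullet> gso v j)"
    by (simp add: inner_diff_left inner_sum_left inner_gso_later inner_gso_self)
  also have "\<dots> = ((x \<bullet> gso v j) / (gso v j \<bullet> gso v j) - of_int k) * (gso v j \<bullet> gso v j)"
    using pos by (simp add: field_simps)
  finally have "\<bar>(?y - (\<Sum>i<j. of_int (m i) *\<^sub>R v i)) \<bullet> gso v j\<bar>
     = \<bar>(x \<bullet> gso v j) / (gso v j \<bullet> gso v j) - of_int k\<bar> * (gso v j \<bullet> gso v j)"
    using pos by (simp only: abs_mult)
  also have "\<dots> \<le> (1/2) * (gso v j \<bullet> gso v j)"
    using of_int_round_abs_le[of "(x \<bullet> gso v j) / (gso v j \<bullet> gso v j)"] pos
    by (intro mult_right_mono) (auto simp: k_def abs_minus_commute)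
  finally have "\<forall>l<Suc j. \<bar>(x - (\<Sum>i<Suc j. of_int (?m i) *\<^sub>R v i)) \<bullet> gso v l\<bar> \<le> (gso v l \<bullet> gso v l) / 2"
    unfolding eq using m by (auto simp: less_Suc_eq)
  then show ?case by blast
qed auto

section \<open>Integer vectors\<close>

definition int_vec :: "(real ^ 'n) set" where
  "int_vec = {x. \<forall>i. x $ i \<in> \<int>}"

lemma int_vec_diff: "x \<in> int_vec \<Longrightarrow> y \<in> int_vec \<Longrightarrow> x - y \<in> int_vec"
  by (auto simp: int_vec_def)

lemma int_vec_scale: "x \<in> int_vec \<Longrightarrow> of_int k *\<^sub>R x \<in> int_vec"
  by (auto simp: int_vec_def)

lemma int_vec_sum: "(\<And>i. i \<in> S \<Longrightarrow> f i \<in> int_vec) \<Longrightarrow> sum f S \<in> int_vec"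
  by (auto simp: int_vec_def intro!: Ints_sum)

lemma int_vec_norm_ge_1:
  fixes x :: "real ^ 'n"
  assumes "x \<in> int_vec" "x \<noteq> 0" shows "1 \<le> norm x"
proof -
  obtain i where i: "x $ i \<noteq> 0" using assms(2) by (auto simp: vec_eq_iff)
  obtain k where k: "x $ i = of_int k" using assms(1) by (auto simp: int_vec_def elim: Ints_cases)
  have "1 \<le> \<bar>x $ i\<bar>" using i by (simp add: k)
  also have "\<dots> \<le> norm x" by (rule component_le_norm_cart)
  finally show ?thesis .
qed

lemma finite_vec_components:
  assumes "finite F" shows "finite {x :: 'a ^ 'n. \<forall>i. x $ i \<in> F}"
proof (rule finite_subset)
  show "{x :: 'a ^ 'n. \<forall>i. x $ i \<in> F} \<subseteq> vec_lambda ` PiE UNIV (\<lambda>_. F)"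
  proof
    fix x :: "'a ^ 'n" assume "x \<in> {x. \<forall>i. x $ i \<in> F}"
    then have "vec_nth x \<in> PiE UNIV (\<lambda>_. F)" by auto
    moreover have "x = vec_lambda (vec_nth x)" by simp
    ultimately show "x \<in> vec_lambda ` PiE UNIV (\<lambda>_. F)" by blast
  qed
  show "finite (vec_lambda ` PiE (UNIV :: 'n set) (\<lambda>_. F))"
    using assms by (intro finite_imageI finite_PiE) auto
qed

lemma finite_int_vec_norm_le: "finite {x \<in> (int_vec :: (real ^ 'n) set). norm x \<le> B}"
proof -
  let ?F = "{y :: real. y \<in> \<int> \<and> \<bar>y\<bar> \<le> B}"
  have "?F \<subseteq> real_of_int ` {- \<lceil>B\<rceil>..\<lceil>B\<rceil>}"
  proof
    fix y assume "y \<in> ?F"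
    then obtain k where k: "y = of_int k" "\<bar>real_of_int k\<bar> \<le> B" by (auto elim: Ints_cases)
    then have "k \<in> {- \<lceil>B\<rceil>..\<lceil>B\<rceil>}" by (auto simp: le_ceiling_iff) linarith+
    then show "y \<in> real_of_int ` {- \<lceil>B\<rceil>..\<lceil>B\<rceil>}" using k by blast
  qed
  then have fin: "finite ?F" by (rule finite_subset) simp
  have "finite {x :: real ^ 'n. \<forall>i. x $ i \<in> ?F}" by (rule finite_vec_components[OF fin])
  moreover have "{x \<in> (int_vec :: (real ^ 'n) set). norm x \<le> B} \<subseteq> {x. \<forall>i. x $ i \<in> ?F}"
    by (auto simp: int_vec_def intro: order_trans[OF component_le_norm_cart])
  ultimately show ?thesis by (rule rev_finite_subset)
qed

subsection \<open>Korkine--Zolotarev reduced bases\<close>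

text \<open>The last condition says that \<open>gso v i\<close> is a shortest nonzero vector of the
  projection of \<open>L\<close> away from the earlier vectors; with size reduction this is
  Korkine--Zolotarev reducedness. That such vectors generate the lattice is not built in but proved
  in \<open>hkz_basis\<close>.\<close>

definition hkz :: "(real ^ 'n) set \<Rightarrow> nat \<Rightarrow> (nat \<Rightarrow> real ^ 'n) \<Rightarrow> bool" where
  "hkz L r v \<longleftrightarrow> (\<forall>i<r. v i \<in> L \<and> gso v i \<noteq> 0 \<and>
     (\<forall>l<i. \<bar>v i \<bullet> gso v l\<bar> \<le> (gso v l \<bullet> gso v l) / 2) \<and>
     (\<forall>x\<in>L. gproj v i x \<noteq> 0 \<longrightarrow> norm (gso v i) \<le> norm (gproj v i x)))"

text \<open>The component along each \<open>gso v l\<close> has at most half the length of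
  \<open>gso v l\<close>. This makes the size-reduced integer points with bounded projection finite
  in number.\<close>

lemma norm_le_of_size_reduced:
  assumes "\<And>l. l < j \<Longrightarrow> \<bar>x \<bullet> gso v l\<bar> \<le> (gso v l \<bullet> gso v l) / 2"
  shows "norm x \<le> norm (gproj v j x) + (\<Sum>l<j. norm (gso v l)) / 2"
proof -
  have "norm (((x \<bullet> gso v l) / (gso v l \<bullet> gso v l)) *\<^sub>R gso v l) \<le> norm (gso v l) / 2" if "l < j" for l
  proof (cases "gso v l = 0")
    case False
    then have "\<bar>(x \<bullet> gso v l) / (gso v l \<bullet> gso v l)\<bar> \<le> 1/2"
      using assms[OF that] by (simp add: field_simps)
    then have "\<bar>(x \<bullet> gso v l) / (gso v l \<bullet> gso v l)\<bar> * norm (gso v l) \<le> 1/2 * norm (gso v l)"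
      by (rule mult_right_mono) simp
    then show ?thesis by simp
  qed simp
  then have "norm (\<Sum>l<j. ((x \<bullet> gso v l) / (gso v l \<bullet> gso v l)) *\<^sub>R gso v l) \<le> (\<Sum>l<j. norm (gso v l) / 2)"
    by (intro sum_norm_le) auto
  also have "\<dots> = (\<Sum>l<j. norm (gso v l)) / 2" by (simp add: sum_divide_distrib)
  finally have s: "norm (\<Sum>l<j. ((x \<bullet> gso v l) / (gso v l \<bullet> gso v l)) *\<^sub>R gso v l) \<le> \<dots>" .
  have "x = gproj v j x + (\<Sum>l<j. ((x \<bullet> gso v l) / (gso v l \<bullet> gso v l)) *\<^sub>R gso v l)"
    by (simp add: gproj_def)
  then show ?thesis using s norm_triangle_ineq by (smt (verit))
qed

lemma size_reduce_lattice:
  assumes V: "subspace V" and v: "hkz (V \<inter> int_vec) j v" and x: "x \<in> V \<inter> int_vec"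
  obtains m :: "nat \<Rightarrow> int" where
    "x - (\<Sum>i<j. of_int (m i) *\<^sub>R v i) \<in> V \<inter> int_vec"
    "\<And>l. l < j \<Longrightarrow> \<bar>(x - (\<Sum>i<j. of_int (m i) *\<^sub>R v i)) \<bullet> gso v l\<bar> \<le> (gso v l \<bullet> gso v l) / 2"
    "gproj v j (x - (\<Sum>i<j. of_int (m i) *\<^sub>R v i)) = gproj v j x"
proof -
  obtain m :: "nat \<Rightarrow> int" where m: "\<forall>l<j. \<bar>(x - (\<Sum>i<j. of_int (m i) *\<^sub>R v i)) \<bullet> gso v l\<bar> \<le> (gso v l \<bullet> gso v l) / 2"
    using size_reduce[of j v x] v unfolding hkz_def by blast
  have vi: "v i \<in> V" "v i \<in> int_vec" if "i < j" for i using v that unfolding hkz_def by auto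
  have "x - (\<Sum>i<j. of_int (m i) *\<^sub>R v i) \<in> V"
    using x vi by (intro subspace_diff[OF V] subspace_sum[OF V] subspace_scale[OF V]) auto
  moreover have "x - (\<Sum>i<j. of_int (m i) *\<^sub>R v i) \<in> int_vec"
    using x vi by (intro int_vec_diff int_vec_sum int_vec_scale) auto
  moreover have "gproj v j (x - (\<Sum>i<j. of_int (m i) *\<^sub>R v i)) = gproj v j x"
    by (simp add: gproj_diff gproj_sum gproj_scale gproj_earlier)
  ultimately show ?thesis using that[of m] m by blast
qed

text \<open>Take a lattice point whose nonzero projection is shortest. The minimum is attained: size
  reduction replaces any candidate by one with the same projection and bounded norm, so only
  finitely many have to be compared.\<close>

lemma hkz_extend:
  fixes v :: "nat \<Rightarrow> real ^ 'n"
  assumes V: "subspace V" and v: "hkz (V \<inter> int_vec) j v"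
    and x0: "x0 \<in> V \<inter> int_vec" "gproj v j x0 \<noteq> 0"
  shows "\<exists>y. hkz (V \<inter> int_vec) (Suc j) (v(j := y))"
proof -
  let ?L = "V \<inter> int_vec"
  let ?red = "\<lambda>x. \<forall>l<j. \<bar>x \<bullet> gso v l\<bar> \<le> (gso v l \<bullet> gso v l) / 2"
  define F where "F = {x \<in> ?L. gproj v j x \<noteq> 0 \<and> norm (gproj v j x) \<le> norm (gproj v j x0) \<and> ?red x}"
  have "F \<subseteq> {x \<in> int_vec. norm x \<le> norm (gproj v j x0) + (\<Sum>l<j. norm (gso v l)) / 2}"
    unfolding F_def using norm_le_of_size_reduced[of j _ v] by fastforce
  then have finF: "finite F" using finite_int_vec_norm_le finite_subset by blast
  have redF: "\<exists>y\<in>F. norm (gproj v j y) = norm (gproj v j x)"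
    if "x \<in> ?L" "gproj v j x \<noteq> 0" "norm (gproj v j x) \<le> norm (gproj v j x0)" for x
  proof -
    from size_reduce_lattice[OF V v that(1)] obtain m :: "nat \<Rightarrow> int" where m:
      "x - (\<Sum>i<j. of_int (m i) *\<^sub>R v i) \<in> V \<inter> int_vec"
      "\<And>l. l < j \<Longrightarrow> \<bar>(x - (\<Sum>i<j. of_int (m i) *\<^sub>R v i)) \<bullet> gso v l\<bar> \<le> (gso v l \<bullet> gso v l) / 2"
      "gproj v j (x - (\<Sum>i<j. of_int (m i) *\<^sub>R v i)) = gproj v j x" by blast
    then have "x - (\<Sum>i<j. of_int (m i) *\<^sub>R v i) \<in> F" using that unfolding F_def by simp
    then show ?thesis using m(3) by metis
  qed
  have "F \<noteq> {}" using redF[OF x0] by auto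
  then obtain y where y: "y \<in> F" "\<And>z. z \<in> F \<Longrightarrow> norm (gproj v j y) \<le> norm (gproj v j z)"
    using finF ex_min_if_finite[of "(\<lambda>z. norm (gproj v j z)) ` F"] by (auto simp: not_less)
  let ?w = "v(j := y)"
  have pe: "gproj ?w i x = gproj v i x" if "i \<le> j" for i x using that by (intro gproj_cong) auto
  have ge: "gso ?w i = gso v i" if "i < j" for i using that by (intro gso_cong) auto
  have gj: "gso ?w j = gproj v j y" by (simp add: gso_eq_gproj pe)
  have min: "norm (gproj v j y) \<le> norm (gproj v j x)" if "x \<in> ?L" "gproj v j x \<noteq> 0" for x
  proof (cases "norm (gproj v j x) \<le> norm (gproj v j x0)")
    case True
    then show ?thesis using redF[OF that] y(2) by metis
  next
    case False
    then show ?thesis using y(1) unfolding F_def by simp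
  qed
  have "hkz ?L (Suc j) ?w"
    unfolding hkz_def
  proof (intro allI impI)
    fix i assume "i < Suc j"
    then consider "i < j" | "i = j" by linarith
    then show "?w i \<in> ?L \<and> gso ?w i \<noteq> 0 \<and>
      (\<forall>l<i. \<bar>?w i \<bullet> gso ?w l\<bar> \<le> (gso ?w l \<bullet> gso ?w l) / 2) \<and>
      (\<forall>x\<in>?L. gproj ?w i x \<noteq> 0 \<longrightarrow> norm (gso ?w i) \<le> norm (gproj ?w i x))"
    proof cases
      case 1
      then show ?thesis using v unfolding hkz_def by (simp add: pe ge)
    next
      case 2
      then show ?thesis using y(1) min unfolding F_def by (simp add: pe ge gj)
    qed
  qed
  then show ?thesis by blast
qed

lemma gso_independent:
  fixes v :: "nat \<Rightarrow> 'a::euclidean_space"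
  assumes "\<And>i. i < r \<Longrightarrow> gso v i \<noteq> 0"
  shows "independent (gso v ` {..<r})" "card (gso v ` {..<r}) = r" "inj_on (gso v) {..<r}"
proof -
  show "independent (gso v ` {..<r})"
    using assms by (intro pairwise_orthogonal_independent)
      (auto simp: pairwise_def orthogonal_def, metis gso_orthogonal)
  show inj: "inj_on (gso v) {..<r}"
  proof (rule inj_onI)
    fix i k assume "i \<in> {..<r}" "k \<in> {..<r}" "gso v i = gso v k"
    then show "i = k" using gso_orthogonal[of k i v] assms[of k] by auto
  qed
  show "card (gso v ` {..<r}) = r" using card_image[OF inj] by simp
qed

text \<open>Extension from \<open>j < r\<close> to \<open>j + 1\<close> vectors can fail only if all
  integer points of \<open>V\<close> lie in the span of \<open>j\<close> Gram--Schmidt vectors,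
  which is impossible as they span \<open>V\<close>, of dimension \<open>r\<close>.\<close>

lemma hkz_exists:
  fixes V :: "(real ^ 'n) set"
  assumes V: "subspace V" and sp: "V \<subseteq> span (V \<inter> int_vec)" and r: "dim V = r"
  shows "\<exists>v. hkz (V \<inter> int_vec) r v"
proof -
  have "\<exists>v. hkz (V \<inter> int_vec) j v" if "j \<le> r" for j
    using that
  proof (induction j)
    case 0
    then show ?case by (simp add: hkz_def)
  next
    case (Suc j)
    then obtain v where v: "hkz (V \<inter> int_vec) j v" by auto
    have "\<exists>x0 \<in> V \<inter> int_vec. gproj v j x0 \<noteq> 0"
    proof (rule ccontr)
      assume neg: "\<not> (\<exists>x0 \<in> V \<inter> int_vec. gproj v j x0 \<noteq> 0)"
      have "x \<in> span (gso v ` {..<j})" if "x \<in> V \<inter> int_vec" for x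
      proof -
        have "x = (\<Sum>l<j. ((x \<bullet> gso v l) / (gso v l \<bullet> gso v l)) *\<^sub>R gso v l)"
          using neg that by (simp add: gproj_def)
        also have "\<dots> \<in> span (gso v ` {..<j})"
          by (intro span_sum span_scale) (auto intro: span_base)
        finally show ?thesis .
      qed
      then have "V \<inter> int_vec \<subseteq> span (gso v ` {..<j})" by blast
      then have "V \<subseteq> span (gso v ` {..<j})" using sp by (meson order_trans span_minimal subspace_span)
      then have "dim V \<le> card (gso v ` {..<j})" by (intro dim_le_card) auto
      also have "\<dots> \<le> j" using card_image_le[of "{..<j}" "gso v"] by simp
      finally show False using r Suc.prems by simp
    qed
    then show ?case using hkz_extend[OF V v] by blast
  qed
  then show ?thesis by simp
qed

text \<open>The \<open>r\<close> nonzero orthogonal vectors \<open>gso v i\<close> lie in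
  \<open>V\<close> and hence span it, so the projection, itself in \<open>V\<close>, is orthogonal
  to itself.\<close>

lemma hkz_gproj_eq_0:
  fixes V :: "(real ^ 'n) set"
  assumes V: "subspace V" and r: "dim V = r" and v: "hkz (V \<inter> int_vec) r v" and x: "x \<in> V"
  shows "gproj v r x = 0"
proof -
  have nz: "\<And>i. i < r \<Longrightarrow> gso v i \<noteq> 0" and vV: "\<And>i. i < r \<Longrightarrow> v i \<in> V"
    using v unfolding hkz_def by auto
  have gV: "gso v i \<in> V" if "i < r" for i
  proof -
    have "span (v ` {..i}) \<subseteq> V" using vV that by (intro span_minimal V) auto
    then show ?thesis using gso_in_span by blast
  qed
  have "V \<subseteq> span (gso v ` {..<r})"
    using gso_independent(1,2)[of r v] nz gV r by (intro card_ge_dim_independent) auto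
  moreover have "gproj v r x \<in> V"
    unfolding gproj_def using x gV by (intro subspace_diff[OF V] subspace_sum[OF V] subspace_scale[OF V]) auto
  ultimately have s: "gproj v r x \<in> span (gso v ` {..<r})" by blast
  have "orthogonal (gproj v r x) (gproj v r x)"
    by (rule orthogonal_to_span[OF s]) (auto simp: orthogonal_def gproj_orthogonal)
  then show ?thesis by (simp add: orthogonal_def)
qed

text \<open>Size reduce \<open>x\<close> to a remainder \<open>y\<close>. Descending from
  \<open>r\<close>, each projection of \<open>y\<close> is at most half as long as
  \<open>gso v j\<close>, shorter than any nonzero projection of a lattice point, so it vanishes; at
  \<open>j = 0\<close> this is \<open>y\<close> itself.\<close>

lemma hkz_basis:
  fixes V :: "(real ^ 'n) set"
  assumes V: "subspace V" and r: "dim V = r" and v: "hkz (V \<inter> int_vec) r v"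
    and x: "x \<in> V \<inter> int_vec"
  shows "\<exists>m :: nat \<Rightarrow> int. x = (\<Sum>i<r. of_int (m i) *\<^sub>R v i)"
proof -
  from size_reduce_lattice[OF V v x] obtain m :: "nat \<Rightarrow> int" where m:
      "x - (\<Sum>i<r. of_int (m i) *\<^sub>R v i) \<in> V \<inter> int_vec"
      "\<And>l. l < r \<Longrightarrow> \<bar>(x - (\<Sum>i<r. of_int (m i) *\<^sub>R v i)) \<bullet> gso v l\<bar> \<le> (gso v l \<bullet> gso v l) / 2" by blast
  define y where "y = x - (\<Sum>i<r. of_int (m i) *\<^sub>R v i)"
  have "gproj v j y = 0" if "j \<le> r" for j
    using that
  proof (induction "r - j" arbitrary: j)
    case 0
    then show ?case using hkz_gproj_eq_0[OF V r v, of y] m(1) by (simp add: y_def)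
  next
    case (Suc k)
    then have j: "j < r" "k = r - Suc j" by auto
    then have "gproj v (Suc j) y = 0" using Suc.hyps(1)[of "Suc j"] by simp
    then have e: "gproj v j y = ((y \<bullet> gso v j) / (gso v j \<bullet> gso v j)) *\<^sub>R gso v j"
      by (simp add: gproj_Suc)
    have pos: "gso v j \<noteq> 0" using v j unfolding hkz_def by auto
    then have "\<bar>(y \<bullet> gso v j) / (gso v j \<bullet> gso v j)\<bar> \<le> 1/2"
      using m(2)[OF j(1)] by (simp add: field_simps y_def)
    then have "\<bar>(y \<bullet> gso v j) / (gso v j \<bullet> gso v j)\<bar> * norm (gso v j) \<le> 1/2 * norm (gso v j)"
      by (rule mult_right_mono) simp
    then have "norm (gproj v j y) \<le> 1/2 * norm (gso v j)" unfolding e norm_scaleR .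
    moreover have "norm (gso v j) > 0" using pos by simp
    ultimately have "norm (gproj v j y) < norm (gso v j)" by linarith
    moreover have "gproj v j y \<noteq> 0 \<Longrightarrow> norm (gso v j) \<le> norm (gproj v j y)"
      using v j m(1) unfolding hkz_def y_def by blast
    ultimately show ?case by linarith
  qed
  from this[of 0] have "y = 0" by simp
  then show ?thesis unfolding y_def by (intro exI[of _ m]) simp
qed

text \<open>The projection of \<open>v (Suc i)\<close> away from the first \<open>i\<close> vectors
  competes with \<open>gso v i\<close> for being shortest, and by size reduction its length exceeds
  that of \<open>gso v (Suc i)\<close> by at most half of that of \<open>gso v i\<close>.\<close>

lemma hkz_gso_Suc:
  assumes v: "hkz L r v" and i: "Suc i < r"
  shows "norm (gso v i) \<le> 2 * norm (gso v (Suc i))"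
proof -
  let ?g = "gso v i" and ?h = "gso v (Suc i)"
  define t where "t = (v (Suc i) \<bullet> ?g) / (?g \<bullet> ?g)"
  have nz: "?g \<noteq> 0" "?h \<noteq> 0" and "\<bar>v (Suc i) \<bullet> ?g\<bar> \<le> (?g \<bullet> ?g) / 2" and vL: "v (Suc i) \<in> L"
    using v i unfolding hkz_def by auto
  then have t: "\<bar>t\<bar> \<le> 1/2" unfolding t_def by (simp add: field_simps)
  have e: "gproj v i (v (Suc i)) = ?h + t *\<^sub>R ?g"
    using gproj_Suc[of v i "v (Suc i)"] by (simp add: gso_eq_gproj[of v "Suc i"] t_def)
  have "gproj v i (v (Suc i)) \<noteq> 0"
  proof
    assume "gproj v i (v (Suc i)) = 0"
    then have "(?h + t *\<^sub>R ?g) \<bullet> ?h = 0" using e by simp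
    then show False using nz by (simp add: inner_add_left gso_orthogonal)
  qed
  then have "norm ?g \<le> norm (gproj v i (v (Suc i)))" using v i vL unfolding hkz_def by auto
  also have "\<dots> \<le> norm ?h + \<bar>t\<bar> * norm ?g" unfolding e using norm_triangle_ineq[of ?h "t *\<^sub>R ?g"] by simp
  also have "\<dots> \<le> norm ?h + 1/2 * norm ?g" using t by (intro add_mono mult_right_mono) auto
  finally show ?thesis by simp
qed

lemma hkz_gso_mono:
  assumes v: "hkz L r v" and "i \<le> j" "j < r"
  shows "norm (gso v i) \<le> 2 ^ (j - i) * norm (gso v j)"
  using assms(2,3)
proof (induction j rule: dec_induct)
  case (step j)
  have "norm (gso v i) \<le> 2 ^ (j - i) * norm (gso v j)" using step by simp
  also have "\<dots> \<le> 2 ^ (j - i) * (2 * norm (gso v (Suc j)))"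
    using hkz_gso_Suc[OF v step.prems] by (intro mult_left_mono) auto
  also have "\<dots> = 2 ^ (Suc j - i) * norm (gso v (Suc j))" using step by (simp add: Suc_diff_le)
  finally show ?case .
qed simp

text \<open>The first Gram--Schmidt vector is a nonzero integer vector, of norm at least 1; from one
  vector to the next the norm shrinks by at most a factor 2.\<close>

lemma hkz_gso_lower:
  assumes v: "hkz (V \<inter> int_vec) r v" and "j < r"
  shows "1 \<le> 2 ^ j * norm (gso v j)"
proof -
  have "gso v 0 = v 0" by (simp add: gso_eq_gproj)
  moreover have "v 0 \<in> int_vec" "gso v 0 \<noteq> 0" using v assms(2) unfolding hkz_def by fastforce+
  ultimately have "1 \<le> norm (gso v 0)" using int_vec_norm_ge_1 by metis
  also have "\<dots> \<le> 2 ^ j * norm (gso v j)" using hkz_gso_mono[OF v, of 0 j] assms(2) by simp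
  finally show ?thesis .
qed

lemma hkz_norm_le:
  assumes v: "hkz L r v" and j: "j < r"
  shows "norm (v j) \<le> 2 ^ j * norm (gso v j)"
proof -
  have "norm (v j) \<le> norm (gproj v j (v j)) + (\<Sum>l<j. norm (gso v l)) / 2"
    using v j unfolding hkz_def by (intro norm_le_of_size_reduced) auto
  also have "(\<Sum>l<j. norm (gso v l)) \<le> (\<Sum>l<j. 2 ^ (j - l) * norm (gso v j))"
    using hkz_gso_mono[OF v] j by (intro sum_mono) auto
  also have "\<dots> = (\<Sum>l<j. 2 ^ (j - l)) * norm (gso v j)" by (simp add: sum_distrib_right)
  also have "(\<Sum>l<j. 2 ^ (j - l)) = (2 ^ (j + 1) - 2 :: real)"
  proof (induction j)
    case (Suc j)
    have "(\<Sum>l<j. 2 ^ (Suc j - l)) = 2 * (\<Sum>l<j. 2 ^ (j - l) :: real)"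
      unfolding sum_distrib_left by (intro sum.cong) (auto simp: Suc_diff_le)
    then show ?case using Suc by simp
  qed simp
  finally have "norm (v j) \<le> norm (gso v j) + (2 ^ (j + 1) - 2) * norm (gso v j) / 2"
    by (simp add: gso_eq_gproj[symmetric])
  then show ?thesis by (simp add: field_simps)
qed

text \<open>The dual basis is built one vector at a time. The new \<open>u\<close>, a multiple of
  \<open>gso v k\<close>, kills the earlier \<open>v j\<close>, and subtracting multiples of
  \<open>u\<close> makes the earlier dual vectors kill \<open>v k\<close>. Since
  \<open>norm (v k) * norm u\<close> is at most \<open>2 ^ r\<close>, each round costs a factor
  \<open>2 ^ r + 1\<close>.\<close>

lemma hkz_dual:
  fixes v :: "nat \<Rightarrow> real ^ 'n"
  assumes v: "hkz L r v"
  shows "\<exists>w. (\<forall>i<r. \<forall>j<r. w i \<bullet> v j = (if i = j then 1 else 0)) \<and>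
     (\<forall>i<r. norm (w i) * norm (gso v i) \<le> (2 ^ r + 1) ^ r)"
proof -
  have "\<exists>w. (\<forall>i<k. \<forall>j<k. w i \<bullet> v j = (if i = j then 1 else 0)) \<and>
     (\<forall>i<k. norm (w i) * norm (gso v i) \<le> (2 ^ r + 1) ^ k)" if "k \<le> r" for k
    using that
  proof (induction k)
    case (Suc k)
    then obtain w where w: "\<And>i j. i < k \<Longrightarrow> j < k \<Longrightarrow> w i \<bullet> v j = (if i = j then 1 else 0)"
      "\<And>i. i < k \<Longrightarrow> norm (w i) * norm (gso v i) \<le> (2 ^ r + 1) ^ k" by auto
    let ?g = "gso v k"
    have nz: "?g \<noteq> 0" using v Suc.prems unfolding hkz_def by auto
    define u where "u = (1 / (?g \<bullet> ?g)) *\<^sub>R ?g"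
    define w' where "w' i = (if i = k then u else w i - (w i \<bullet> v k) *\<^sub>R u)" for i
    have uk: "u \<bullet> v k = 1" using nz inner_gso_self[of v k] by (simp add: u_def inner_commute)
    have uj: "u \<bullet> v j = 0" if "j < k" for j
      using inner_gso_later[OF that, of v] by (simp add: u_def inner_commute)
    have "norm u = 1 / norm ?g" by (simp add: u_def dot_square_norm power2_eq_square)
    then have nu: "norm u * norm ?g = 1" using nz by simp
    have "w' i \<bullet> v j = (if i = j then 1 else 0)" if "i < Suc k" "j < Suc k" for i j
      using that w(1) uk uj by (auto simp: w'_def inner_diff_left less_Suc_eq)
    moreover have "norm (w' i) * norm (gso v i) \<le> (2 ^ r + 1) ^ Suc k" if "i < Suc k" for i
    proof (cases "i = k")
      case True
      have "(1::real) \<le> (2 ^ r + 1) ^ Suc k" by (intro one_le_power) simp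
      then show ?thesis using True nu by (simp add: w'_def)
    next
      case False
      then have i: "i < k" using that by simp
      have "norm (v k) * norm u \<le> (2 ^ k * norm ?g) * norm u"
        using hkz_norm_le[OF v, of k] Suc.prems by (intro mult_right_mono) auto
      also have "\<dots> = 2 ^ k" using nu by (simp add: algebra_simps)
      also have "\<dots> \<le> 2 ^ r" using Suc.prems by (intro power_increasing) auto
      finally have vu: "norm (v k) * norm u \<le> 2 ^ r" .
      have "norm (w' i) \<le> norm (w i) + \<bar>w i \<bullet> v k\<bar> * norm u"
        using False norm_triangle_ineq4[of "w i" "(w i \<bullet> v k) *\<^sub>R u"] by (simp add: w'_def)
      also have "\<dots> \<le> norm (w i) + (norm (w i) * norm (v k)) * norm u"
        by (intro add_left_mono mult_right_mono Cauchy_Schwarz_ineq2) auto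
      also have "\<dots> \<le> norm (w i) + norm (w i) * 2 ^ r"
        using mult_left_mono[OF vu, of "norm (w i)"] by (simp add: algebra_simps)
      finally have "norm (w' i) \<le> norm (w i) * (2 ^ r + 1)" by (simp add: algebra_simps)
      then have "norm (w' i) * norm (gso v i) \<le> norm (w i) * (2 ^ r + 1) * norm (gso v i)"
        by (rule mult_right_mono) simp
      also have "\<dots> = (norm (w i) * norm (gso v i)) * (2 ^ r + 1)" by simp
      also have "\<dots> \<le> (2 ^ r + 1) ^ k * (2 ^ r + 1)" using w(2)[OF i] by (intro mult_right_mono) auto
      finally show ?thesis by (simp add: algebra_simps)
    qed
    ultimately show ?case by blast
  qed simp
  then show ?thesis by simp
qed

subsection \<open>Counting reduced bases\<close>

text \<open>Parseval's identity; the cardinality makes \<open>B\<close> a basis.\<close>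

lemma orthonormal_norm_sq:
  fixes B :: "'a::euclidean_space set"
  assumes orth: "pairwise orthogonal B" and n1: "\<And>b. b \<in> B \<Longrightarrow> norm b = 1" and c: "card B = DIM('a)"
  shows "(norm x)\<^sup>2 = (\<Sum>b\<in>B. (x \<bullet> b)\<^sup>2)"
proof -
  have fin: "finite B" using c by (metis DIM_positive card.infinite less_numeral_extra(3))
  have "0 \<notin> B" using n1 by force
  then have "independent B" using orth pairwise_orthogonal_independent by blast
  then have "UNIV \<subseteq> span B" using c by (intro card_ge_dim_independent) auto
  then have "x \<in> span B" by auto
  then have e: "x = (\<Sum>b\<in>B. (x \<bullet> b) *\<^sub>R b)"
    by (intro orthonormal_basis_expand[OF orth n1 _ fin, symmetric])
  have "(norm x)\<^sup>2 = (\<Sum>b\<in>B. (x \<bullet> b) *\<^sub>R b) \<bullet> x"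
    using e by (metis power2_norm_eq_inner)
  also have "\<dots> = (\<Sum>b\<in>B. (x \<bullet> b)\<^sup>2)"
    unfolding inner_sum_left by (intro sum.cong refl) (simp add: power2_eq_square inner_commute)
  finally show ?thesis .
qed

text \<open>Cut the box into cells of side \<open>1 / n\<close> along \<open>B\<close>, where
  \<open>n = CARD('n)\<close>. Two integer points in one cell are at distance less than 1, hence
  equal. The lower bound on the sides absorbs the boundary cells into the constant.\<close>

lemma card_int_vec_box:
  fixes B :: "(real ^ 'n) set" and \<beta> :: "real ^ 'n \<Rightarrow> real"
  assumes orth: "pairwise orthogonal B" and n1: "\<And>b. b \<in> B \<Longrightarrow> norm b = 1" and c: "card B = CARD('n)"
    and eps: "\<epsilon> > 0" and \<beta>: "\<And>b. b \<in> B \<Longrightarrow> \<epsilon> \<le> \<beta> b"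
  shows "finite {x \<in> int_vec. \<forall>b\<in>B. \<bar>x \<bullet> b\<bar> \<le> \<beta> b}" (is "finite ?S")
    and "real (card {x \<in> int_vec. \<forall>b\<in>B. \<bar>x \<bullet> b\<bar> \<le> \<beta> b}) \<le> (\<Prod>b\<in>B. (2 * real CARD('n) + 2 / \<epsilon>) * \<beta> b)"
proof -
  let ?N = "real CARD('n)"
  have N1: "?N \<ge> 1" by (simp add: Suc_leI)
  have fin: "finite B" using c by (metis card.infinite zero_less_card_finite less_numeral_extra(3))
  let ?F = "\<lambda>x. \<lambda>b\<in>B. \<lfloor>?N * (x \<bullet> b)\<rfloor>"
  let ?I = "\<lambda>b. {\<lfloor>- (?N * \<beta> b)\<rfloor>..\<lfloor>?N * \<beta> b\<rfloor>}"
  have inj: "inj_on ?F ?S"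
  proof (rule inj_onI)
    fix x y assume x: "x \<in> ?S" and y: "y \<in> ?S" and eq: "?F x = ?F y"
    have "((x - y) \<bullet> b)\<^sup>2 < (1 / ?N)\<^sup>2" if "b \<in> B" for b
    proof -
      have "\<lfloor>?N * (x \<bullet> b)\<rfloor> = \<lfloor>?N * (y \<bullet> b)\<rfloor>" using fun_cong[OF eq, of b] that by simp
      then have "\<bar>?N * (x \<bullet> b) - ?N * (y \<bullet> b)\<bar> < 1" by linarith
      moreover have "?N * (x \<bullet> b) - ?N * (y \<bullet> b) = ?N * ((x - y) \<bullet> b)"
        by (simp add: inner_diff_left algebra_simps)
      ultimately have "?N * \<bar>(x - y) \<bullet> b\<bar> < 1" by (simp add: abs_mult)
      then have "\<bar>(x - y) \<bullet> b\<bar> < 1 / ?N" using N1 by (simp add: field_simps)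
      then have "\<bar>(x - y) \<bullet> b\<bar>\<^sup>2 < (1 / ?N)\<^sup>2" by (intro power_strict_mono) auto
      then show ?thesis by simp
    qed
    moreover have "B \<noteq> {}" using c by auto
    ultimately have "(\<Sum>b\<in>B. ((x - y) \<bullet> b)\<^sup>2) < (\<Sum>b\<in>B. (1 / ?N)\<^sup>2)"
      using fin by (intro sum_strict_mono) auto
    also have "\<dots> = 1 / ?N" using c N1 by (simp add: power2_eq_square)
    also have "\<dots> \<le> 1" using N1 by simp
    finally have "(norm (x - y))\<^sup>2 < 1" using orthonormal_norm_sq[OF orth n1] c by simp
    then have "norm (x - y) < 1" by (simp add: power2_less_1_iff abs_square_less_1)
    then have "x - y = 0" using int_vec_norm_ge_1[of "x - y"] x y int_vec_diff by force
    then show "x = y" by simp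
  qed
  have sub: "?F ` ?S \<subseteq> PiE B ?I"
  proof
    fix f assume "f \<in> ?F ` ?S"
    then obtain x where x: "x \<in> ?S" "f = ?F x" by blast
    have "\<lfloor>?N * (x \<bullet> b)\<rfloor> \<in> ?I b" if "b \<in> B" for b
    proof -
      have "\<bar>x \<bullet> b\<bar> \<le> \<beta> b" using x that by auto
      then have "\<bar>?N * (x \<bullet> b)\<bar> \<le> ?N * \<beta> b" using N1 by (simp add: abs_mult)
      then have "- (?N * \<beta> b) \<le> ?N * (x \<bullet> b)" "?N * (x \<bullet> b) \<le> ?N * \<beta> b" by linarith+
      then show ?thesis unfolding atLeastAtMost_iff by (intro conjI floor_mono)
    qed
    then show "f \<in> PiE B ?I" using x by auto
  qed
  have finP: "finite (PiE B ?I)" using fin by (intro finite_PiE) auto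
  then show "finite ?S" using sub inj by (meson finite_imageD finite_subset)
  have "card ?S = card (?F ` ?S)" using card_image[OF inj] by simp
  also have "\<dots> \<le> card (PiE B ?I)" by (rule card_mono[OF finP sub])
  also have "\<dots> = (\<Prod>b\<in>B. card (?I b))" using fin by (simp add: card_PiE)
  finally have "real (card ?S) \<le> (\<Prod>b\<in>B. real (card (?I b)))"
    unfolding of_nat_prod[symmetric] of_nat_le_iff .
  also have "\<dots> \<le> (\<Prod>b\<in>B. (2 * ?N + 2 / \<epsilon>) * \<beta> b)"
  proof (intro prod_mono conjI)
    fix b assume b: "b \<in> B"
    have pos: "0 < \<beta> b" using \<beta>[OF b] eps by linarith
    have "real (card (?I b)) \<le> 2 * ?N * \<beta> b + 2"
    proof -
      define t where "t = ?N * \<beta> b"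
      have "0 \<le> t" using pos by (simp add: t_def)
      then have "0 \<le> \<lfloor>t\<rfloor> - \<lfloor>- t\<rfloor> + 1" by linarith
      then have "real (card {\<lfloor>- t\<rfloor>..\<lfloor>t\<rfloor>}) = of_int (\<lfloor>t\<rfloor> - \<lfloor>- t\<rfloor> + 1)" by simp
      also have "\<dots> \<le> 2 * t + 2" by simp linarith
      finally show ?thesis by (simp add: t_def)
    qed
    moreover have "2 \<le> 2 / \<epsilon> * \<beta> b" using \<beta>[OF b] eps by (simp add: field_simps)
    ultimately show "real (card (?I b)) \<le> (2 * ?N + 2 / \<epsilon>) * \<beta> b"
      unfolding distrib_right by linarith
  qed auto
  finally show "real (card ?S) \<le> (\<Prod>b\<in>B. (2 * ?N + 2 / \<epsilon>) * \<beta> b)" .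
qed

text \<open>The candidates for the next vector \<open>v j\<close> once its Gram--Schmidt norm is
  known to be less than \<open>2 * a\<close>.\<close>

definition size_reduced_near :: "(nat \<Rightarrow> real ^ 'n) \<Rightarrow> nat \<Rightarrow> real \<Rightarrow> (real ^ 'n) set" where
  "size_reduced_near v j a = {x \<in> int_vec.
     (\<forall>l<j. \<bar>x \<bullet> gso v l\<bar> \<le> (gso v l \<bullet> gso v l) / 2) \<and> norm (gproj v j x) < 2 * a}"

text \<open>Normalise the Gram--Schmidt vectors and complete them to an orthonormal basis. By size
  reduction a candidate has component less than \<open>\<alpha> l\<close> along
  \<open>gso v l\<close>, and it has component less than \<open>2 * \<alpha> j\<close> along the
  \<open>n - j\<close> remaining directions, so \<open>card_int_vec_box\<close> applies.\<close>

lemma card_size_reduced_near: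
  fixes v :: "nat \<Rightarrow> real ^ 'n"
  assumes j: "j \<le> CARD('n)" and eps: "\<epsilon> > 0" and \<alpha>: "\<And>i. i \<le> j \<Longrightarrow> \<epsilon> \<le> \<alpha> i"
    and nz: "\<And>l. l < j \<Longrightarrow> gso v l \<noteq> 0" and up: "\<And>l. l < j \<Longrightarrow> norm (gso v l) < 2 * \<alpha> l"
  shows "finite (size_reduced_near v j (\<alpha> j))"
    and "real (card (size_reduced_near v j (\<alpha> j)))
       \<le> (2 * (2 * real CARD('n) + 2 / \<epsilon>)) ^ CARD('n) * (\<Prod>l<j. \<alpha> l) * \<alpha> j ^ (CARD('n) - j)"
proof -
  let ?K = "2 * real CARD('n) + 2 / \<epsilon>"
  define u where "u l = (1 / norm (gso v l)) *\<^sub>R gso v l" for l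
  have nu: "norm (u l) = 1" if "l < j" for l using nz[OF that] by (simp add: u_def)
  have ou: "u l \<bullet> u k = 0" if "l \<noteq> k" for l k using gso_orthogonal[of k l v] that by (simp add: u_def)
  have inju: "inj_on u {..<j}"
  proof (rule inj_onI)
    fix i k assume i: "i \<in> {..<j}" "k \<in> {..<j}" "u i = u k"
    then have "u i \<bullet> u i = 1" using nu[of i] by (simp add: dot_square_norm)
    then show "i = k" using ou[of i k] i by auto
  qed
  define G where "G = u ` {..<j}"
  have cG: "card G = j" unfolding G_def using card_image[OF inju] by simp
  have oG: "pairwise orthogonal G" unfolding G_def pairwise_def orthogonal_def using ou by auto metis
  have "0 \<notin> G" unfolding G_def using nu by force
  then have iG: "independent G" using oG pairwise_orthogonal_independent by blast
  let ?W = "{y. \<forall>x \<in> span G. orthogonal x y}"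
  have sW: "subspace ?W" by (auto simp: subspace_def orthogonal_def inner_add_right)
  have "dim ?W + dim (span G) = dim (UNIV :: (real ^ 'n) set)"
    using dim_subspace_orthogonal_to_vectors[of "span G" UNIV] by simp
  moreover have "dim (span G) = j" using iG cG by (simp add: dim_eq_card_independent)
  ultimately have dW: "dim ?W = CARD('n) - j" by simp
  obtain C where C: "C \<subseteq> ?W" "pairwise orthogonal C" "\<And>x. x \<in> C \<Longrightarrow> norm x = 1"
    "independent C" "card C = dim ?W" "span C = ?W"
    by (rule orthonormal_basis_subspace[OF sW]) blast
  have CG: "x \<bullet> y = 0" if "x \<in> G" "y \<in> C" for x y
    using C(1) that span_base[of x G] by (auto simp: orthogonal_def)
  have disj: "G \<inter> C = {}"
  proof (rule ccontr)
    assume "G \<inter> C \<noteq> {}"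
    then obtain x where "x \<in> G" "x \<in> C" by blast
    then have "x \<bullet> x = 0" "norm x = 1" using CG C(3) by auto
    then show False by simp
  qed
  have finC: "finite C" using C(4) independent_imp_finite by blast
  have finG: "finite G" by (simp add: G_def)
  let ?B = "G \<union> C"
  have cB: "card ?B = CARD('n)" using card_Un_disjoint[OF finG finC disj] cG C(5) dW j by simp
  have oB: "pairwise orthogonal ?B"
    unfolding pairwise_def
  proof (intro ballI impI)
    fix x y assume "x \<in> ?B" "y \<in> ?B" "x \<noteq> y"
    then show "orthogonal x y"
      using oG C(2) CG[of x y] CG[of y x] unfolding pairwise_def orthogonal_def
      by (auto simp: inner_commute)
  qed
  have nB: "\<And>b. b \<in> ?B \<Longrightarrow> norm b = 1" using C(3) nu by (auto simp: G_def)
  define \<beta> where "\<beta> b = (if b \<in> G then \<alpha> (the_inv_into {..<j} u b) else 2 * \<alpha> j)" for b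
  have \<beta>u: "\<beta> (u l) = \<alpha> l" if "l < j" for l
    using that the_inv_into_f_f[OF inju, of l] by (auto simp: \<beta>_def G_def)
  have \<beta>C: "\<beta> b = 2 * \<alpha> j" if "b \<in> C" for b using that disj by (auto simp: \<beta>_def)
  have \<beta>eps: "\<epsilon> \<le> \<beta> b" if "b \<in> ?B" for b
  proof (cases "b \<in> G")
    case True
    then obtain l where "l < j" "b = u l" by (auto simp: G_def)
    then show ?thesis using \<beta>u \<alpha>[of l] by simp
  next
    case False
    then have "\<beta> b = 2 * \<alpha> j" using that \<beta>C by blast
    then show ?thesis using \<alpha>[of j] eps by simp
  qed
  have sub: "size_reduced_near v j (\<alpha> j) \<subseteq> {x \<in> int_vec. \<forall>b\<in>?B. \<bar>x \<bullet> b\<bar> \<le> \<beta> b}"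
  proof
    fix x assume x: "x \<in> size_reduced_near v j (\<alpha> j)"
    have "\<bar>x \<bullet> b\<bar> \<le> \<beta> b" if "b \<in> ?B" for b
      using that
    proof
      assume "b \<in> G"
      then obtain l where l: "l < j" "b = u l" by (auto simp: G_def)
      have n0: "norm (gso v l) > 0" using nz[OF l(1)] by simp
      have "\<bar>x \<bullet> gso v l\<bar> \<le> norm (gso v l) * norm (gso v l) / 2"
        using x l by (auto simp: size_reduced_near_def dot_square_norm power2_eq_square)
      then have "\<bar>x \<bullet> b\<bar> \<le> norm (gso v l) / 2" using n0 by (simp add: l u_def field_simps)
      then show ?thesis using up[OF l(1)] \<beta>u[OF l(1)] l by simp
    next
      assume b: "b \<in> C"
      have "gso v l \<bullet> b = 0" if "l < j" for l
        using CG[of "u l" b] b that nz[OF that] by (simp add: G_def u_def)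
      then have "x \<bullet> b = gproj v j x \<bullet> b" by (simp add: gproj_def inner_diff_left inner_sum_left)
      then have "\<bar>x \<bullet> b\<bar> \<le> norm (gproj v j x) * norm b" using Cauchy_Schwarz_ineq2 by metis
      also have "\<dots> \<le> 2 * \<alpha> j" using x C(3)[OF b] by (simp add: size_reduced_near_def)
      finally show ?thesis using \<beta>C[OF b] by simp
    qed
    then show "x \<in> {x \<in> int_vec. \<forall>b\<in>?B. \<bar>x \<bullet> b\<bar> \<le> \<beta> b}" using x by (auto simp: size_reduced_near_def)
  qed
  note box = card_int_vec_box[OF oB nB cB eps, of \<beta>, OF _ \<beta>eps]
  show "finite (size_reduced_near v j (\<alpha> j))" using sub box(1) finite_subset by blast
  have a0: "0 \<le> \<alpha> i" if "i \<le> j" for i using \<alpha>[OF that] eps by linarith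
  have K0: "?K \<ge> 1"
  proof -
    have "1 \<le> real CARD('n)" by (simp add: Suc_leI)
    moreover have "2 / \<epsilon> > 0" using eps by simp
    ultimately show ?thesis by linarith
  qed
  have "real (card (size_reduced_near v j (\<alpha> j))) \<le> real (card {x \<in> int_vec. \<forall>b\<in>?B. \<bar>x \<bullet> b\<bar> \<le> \<beta> b})"
    using card_mono[OF box(1) sub] by simp
  also have "\<dots> \<le> (\<Prod>b\<in>?B. ?K * \<beta> b)" using box(2) .
  also have "\<dots> = (\<Prod>b\<in>G. ?K * \<beta> b) * (\<Prod>b\<in>C. ?K * \<beta> b)"
    using prod.union_disjoint[OF finG finC disj] .
  also have "(\<Prod>b\<in>C. ?K * \<beta> b) = (\<Prod>b\<in>C. ?K * (2 * \<alpha> j))" using \<beta>C by (intro prod.cong) auto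
  also have "\<dots> = (2 * ?K) ^ (CARD('n) - j) * \<alpha> j ^ (CARD('n) - j)"
    unfolding prod_constant C(5) dW power_mult_distrib[symmetric] by (simp only: mult_ac)
  also have "(\<Prod>b\<in>G. ?K * \<beta> b) = (\<Prod>l<j. ?K * \<alpha> l)"
    unfolding G_def using \<beta>u by (subst prod.reindex[OF inju]) (auto intro!: prod.cong)
  also have "\<dots> = ?K ^ j * (\<Prod>l<j. \<alpha> l)" by (simp add: prod.distrib)
  also have "?K ^ j * (\<Prod>l<j. \<alpha> l) * ((2 * ?K) ^ (CARD('n) - j) * \<alpha> j ^ (CARD('n) - j))
      \<le> (2 * ?K) ^ j * (\<Prod>l<j. \<alpha> l) * ((2 * ?K) ^ (CARD('n) - j) * \<alpha> j ^ (CARD('n) - j))"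
    using K0 a0 by (intro mult_right_mono power_mono prod_nonneg mult_nonneg_nonneg zero_le_power) auto
  also have "\<dots> = (2 * ?K) ^ (j + (CARD('n) - j)) * (\<Prod>l<j. \<alpha> l) * \<alpha> j ^ (CARD('n) - j)"
    unfolding power_add by (simp add: algebra_simps)
  also have "j + (CARD('n) - j) = CARD('n)" using j by simp
  finally show "real (card (size_reduced_near v j (\<alpha> j)))
       \<le> (2 * ?K) ^ CARD('n) * (\<Prod>l<j. \<alpha> l) * \<alpha> j ^ (CARD('n) - j)" .
qed

text \<open>The Gram--Schmidt norms are confined to dyadic windows from \<open>\<alpha> i\<close> to
  \<open>2 * \<alpha> i\<close>. Membership in \<open>extensional\<close> fixes the values beyond
  \<open>j\<close>, which is what makes the set finite.\<close>

definition red_seqs :: "(nat \<Rightarrow> real) \<Rightarrow> nat \<Rightarrow> (nat \<Rightarrow> real ^ 'n) set" where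
  "red_seqs \<alpha> j = {v \<in> extensional {..<j}. \<forall>i<j. v i \<in> int_vec \<and> gso v i \<noteq> 0 \<and>
     (\<forall>l<i. \<bar>v i \<bullet> gso v l\<bar> \<le> (gso v l \<bullet> gso v l) / 2) \<and> \<alpha> i \<le> norm (gso v i) \<and> norm (gso v i) < 2 * \<alpha> i}"

text \<open>Choose the vectors in order: given the first \<open>j\<close>, the next lies in a
  \<open>size_reduced_near\<close> set, whose size is bounded in terms of \<open>\<alpha>\<close>
  only and not of the earlier choices.\<close>

lemma card_red_seqs:
  assumes eps: "\<epsilon> > 0" and "j \<le> CARD('n)" and "\<And>i. i < j \<Longrightarrow> \<epsilon> \<le> \<alpha> i"
  shows "finite (red_seqs \<alpha> j :: (nat \<Rightarrow> real ^ 'n) set) \<and> real (card (red_seqs \<alpha> j :: (nat \<Rightarrow> real ^ 'n) set))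
     \<le> (\<Prod>i<j. (2 * (2 * real CARD('n) + 2 / \<epsilon>)) ^ CARD('n) * (\<Prod>l<i. \<alpha> l) * \<alpha> i ^ (CARD('n) - i))"
  using assms(2,3)
proof (induction j)
  case 0
  have "red_seqs \<alpha> 0 = {\<lambda>i. undefined :: real ^ 'n}" by (auto simp: red_seqs_def)
  then show ?case by simp
next
  case (Suc j)
  let ?R = "red_seqs \<alpha> :: nat \<Rightarrow> (nat \<Rightarrow> real ^ 'n) set"
  let ?b = "\<lambda>i. (2 * (2 * real CARD('n) + 2 / \<epsilon>)) ^ CARD('n) * (\<Prod>l<i. \<alpha> l) * \<alpha> i ^ (CARD('n) - i)"
  have IH: "finite (?R j)" "real (card (?R j)) \<le> (\<Prod>i<j. ?b i)" using Suc by auto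
  have a0: "0 \<le> \<alpha> i" if "i \<le> j" for i using Suc.prems(2)[of i] eps that by simp
  have ext: "finite (size_reduced_near v j (\<alpha> j))" "real (card (size_reduced_near v j (\<alpha> j))) \<le> ?b j"
    if v: "v \<in> ?R j" for v
  proof -
    have nz: "\<And>l. l < j \<Longrightarrow> gso v l \<noteq> 0" and up: "\<And>l. l < j \<Longrightarrow> norm (gso v l) < 2 * \<alpha> l"
      using v by (auto simp: red_seqs_def)
    have j: "j \<le> CARD('n)" "\<And>i. i \<le> j \<Longrightarrow> \<epsilon> \<le> \<alpha> i" using Suc.prems by auto
    show "finite (size_reduced_near v j (\<alpha> j))" "real (card (size_reduced_near v j (\<alpha> j))) \<le> ?b j"
      using card_size_reduced_near[OF j(1) eps j(2) nz up] by auto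
  qed
  let ?S = "SIGMA v:?R j. size_reduced_near v j (\<alpha> j)"
  have finS: "finite ?S" using IH(1) ext(1) by (rule finite_SigmaI)
  have sub: "?R (Suc j) \<subseteq> (\<lambda>(v, x). v(j := x)) ` ?S"
  proof
    fix v :: "nat \<Rightarrow> real ^ 'n" assume v: "v \<in> ?R (Suc j)"
    let ?w = "restrict v {..<j}"
    have g: "gso ?w i = gso v i" if "i < j" for i using that by (intro gso_cong) auto
    have p: "gproj ?w j x = gproj v j x" for x by (intro gproj_cong) auto
    have "?w \<in> ?R j" using v by (auto simp: red_seqs_def g)
    moreover have "v j \<in> size_reduced_near ?w j (\<alpha> j)"
      using v by (auto simp: red_seqs_def size_reduced_near_def g p gso_eq_gproj[symmetric])
    moreover have "v = ?w(j := v j)"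
      using v by (auto simp: red_seqs_def extensional_def restrict_def fun_eq_iff)
    ultimately show "v \<in> (\<lambda>(v, x). v(j := x)) ` ?S" by (intro image_eqI[of _ _ "(?w, v j)"]) auto
  qed
  have fin: "finite (?R (Suc j))" using sub finS by (meson finite_imageI finite_subset)
  have "card (?R (Suc j)) \<le> card ?S"
    using card_mono[OF finite_imageI[OF finS] sub] card_image_le[OF finS] by (rule order_trans)
  also have "card ?S = (\<Sum>v\<in>?R j. card (size_reduced_near v j (\<alpha> j)))"
    using IH(1) ext(1) by (intro card_SigmaI) auto
  finally have "real (card (?R (Suc j))) \<le> (\<Sum>v\<in>?R j. real (card (size_reduced_near v j (\<alpha> j))))"
    unfolding of_nat_sum[symmetric] of_nat_le_iff .
  also have "\<dots> \<le> (\<Sum>v\<in>?R j. ?b j)" using ext(2) by (intro sum_mono) auto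
  also have "\<dots> = real (card (?R j)) * ?b j" by simp
  also have "\<dots> \<le> (\<Prod>i<j. ?b i) * ?b j"
    using IH(2) a0 eps by (intro mult_right_mono mult_nonneg_nonneg prod_nonneg zero_le_power) auto
  finally show ?case using fin by simp
qed

subsection \<open>Summation over dyadic scales\<close>

text \<open>A summable weight on dyadic exponents. The rate 1/2 leaves half of a geometric decay for
  the factor \<open>sqrt \<delta>\<close> in \<open>dyadic_weight_le_small\<close>.\<close>

definition dyad_wt :: "int \<Rightarrow> real" where
  "dyad_wt k = 2 powr (- \<bar>real_of_int k\<bar> / 2)"

lemma dyad_wt_pos: "dyad_wt k > 0"
  by (simp add: dyad_wt_def)

text \<open>On each of the halves \<open>k \<ge> 0\<close> and \<open>k < 0\<close> the sum is part
  of a geometric series of ratio \<open>2 powr (-1/2)\<close>.\<close>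

lemma sum_dyad_wt_bounded: "\<exists>Z>0. \<forall>S :: int set. finite S \<longrightarrow> sum dyad_wt S \<le> Z"
proof -
  define q :: real where "q = 2 powr (-1/2)"
  have q: "0 < q" "q < 1" by (auto simp: q_def powr_less_one)
  have wt: "dyad_wt k = q ^ nat \<bar>k\<bar>" for k
  proof -
    have "q ^ nat \<bar>k\<bar> = q powr real (nat \<bar>k\<bar>)" using q by (intro powr_realpow[symmetric])
    also have "\<dots> = 2 powr (- \<bar>real_of_int k\<bar> / 2)" by (simp add: q_def powr_powr)
    finally show ?thesis by (simp add: dyad_wt_def)
  qed
  have half: "(\<Sum>k\<in>S. q ^ nat \<bar>k\<bar>) \<le> 1 / (1 - q)" if "finite S" "inj_on (\<lambda>k. nat \<bar>k\<bar>) S" for S :: "int set"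
  proof -
    have "(\<Sum>k\<in>S. q ^ nat \<bar>k\<bar>) = (\<Sum>m\<in>(\<lambda>k. nat \<bar>k\<bar>) ` S. q ^ m)"
      using sum.reindex[OF that(2), of "\<lambda>m. q ^ m"] by simp
    also have "\<dots> \<le> (\<Sum>m. q ^ m)"
      using that(1) q by (intro sum_le_suminf summable_geometric) auto
    also have "\<dots> = 1 / (1 - q)" using q by (intro suminf_geometric) auto
    finally show ?thesis .
  qed
  have "sum dyad_wt S \<le> 2 / (1 - q)" if "finite S" for S :: "int set"
  proof -
    have "sum dyad_wt S = (\<Sum>k\<in>{k\<in>S. 0 \<le> k} \<union> {k\<in>S. k < 0}. q ^ nat \<bar>k\<bar>)"
      unfolding wt by (intro sum.cong) auto
    also have "\<dots> = (\<Sum>k\<in>{k\<in>S. 0 \<le> k}. q ^ nat \<bar>k\<bar>) + (\<Sum>k\<in>{k\<in>S. k < 0}. q ^ nat \<bar>k\<bar>)"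
      using that by (intro sum.union_disjoint) auto
    also have "\<dots> \<le> 1 / (1 - q) + 1 / (1 - q)"
      using that by (intro add_mono half) (auto simp: inj_on_def)
    finally show ?thesis by simp
  qed
  moreover have "2 / (1 - q) > 0" using q by simp
  ultimately show ?thesis by blast
qed

text \<open>Sort the elements by their exponent vectors. A class is bounded by \<open>B\<close>
  times a product of weights, and the sum of these products over all vectors factorises into
  \<open>r\<close> bounded sums. The constant \<open>Z\<close> does not depend on \<open>S\<close>,
  \<open>k\<close> or \<open>B\<close>.\<close>

lemma card_le_dyadic:
  "\<exists>Z>0. \<forall>(S :: 'a set) (k :: 'a \<Rightarrow> nat \<Rightarrow> int) B. finite S \<longrightarrow> 0 \<le> B \<longrightarrow>
     (\<forall>A0\<in>S. real (card {A\<in>S. \<forall>j<r. k A j = k A0 j}) \<le> B * (\<Prod>j<r. dyad_wt (k A0 j))) \<longrightarrow>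
     real (card S) \<le> B * Z"
proof -
  obtain Z where Z: "Z > 0" "\<And>S :: int set. finite S \<Longrightarrow> sum dyad_wt S \<le> Z"
    using sum_dyad_wt_bounded by blast
  have "real (card S) \<le> B * Z ^ r"
    if fin: "finite S" and B: "0 \<le> B"
      and le: "\<And>A0. A0 \<in> S \<Longrightarrow> real (card {A\<in>S. \<forall>j<r. k A j = k A0 j}) \<le> B * (\<Prod>j<r. dyad_wt (k A0 j))"
    for S :: "'a set" and k :: "'a \<Rightarrow> nat \<Rightarrow> int" and B
  proof -
    \<comment> \<open>Only finitely many exponents occur, so the sum over exponent vectors is finite
      and can be factorised.\<close>
    define Q where "Q = (\<lambda>(A, j). k A j) ` (S \<times> {..<r})"
    have finQ: "finite Q" using fin by (simp add: Q_def)
    define f where "f A = restrict (k A) {..<r}" for A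
    let ?P = "PiE {..<r} (\<lambda>_. Q)"
    have finP: "finite ?P" using finQ by (intro finite_PiE) auto
    have "k A j \<in> Q" if "A \<in> S" "j < r" for A j
      unfolding Q_def using that by (intro image_eqI[of _ _ "(A, j)"]) auto
    then have fP: "f ` S \<subseteq> ?P" unfolding f_def image_subset_iff restrict_PiE_iff by blast
    have "card S = (\<Sum>\<kappa>\<in>?P. card {A\<in>S. f A = \<kappa>})"
      using sum.group[OF fin finP fP, of "\<lambda>_. 1::nat"] by simp
    then have "real (card S) = (\<Sum>\<kappa>\<in>?P. real (card {A\<in>S. f A = \<kappa>}))" by simp
    also have "\<dots> \<le> (\<Sum>\<kappa>\<in>?P. B * (\<Prod>j<r. dyad_wt (\<kappa> j)))"
    proof (rule sum_mono)
      fix \<kappa> assume "\<kappa> \<in> ?P"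
      show "real (card {A\<in>S. f A = \<kappa>}) \<le> B * (\<Prod>j<r. dyad_wt (\<kappa> j))"
      proof (cases "\<exists>A0\<in>S. f A0 = \<kappa>")
        case True
        then obtain A0 where A0: "A0 \<in> S" "f A0 = \<kappa>" by blast
        have eq: "\<kappa> j = k A0 j" if "j < r" for j using A0(2) that by (auto simp: f_def)
        have "{A\<in>S. f A = \<kappa>} \<subseteq> {A\<in>S. \<forall>j<r. k A j = k A0 j}"
          using eq by (auto simp: f_def)
        then have "real (card {A\<in>S. f A = \<kappa>}) \<le> real (card {A\<in>S. \<forall>j<r. k A j = k A0 j})"
          using fin by (intro of_nat_mono card_mono) auto
        also have "\<dots> \<le> B * (\<Prod>j<r. dyad_wt (k A0 j))" using le[OF A0(1)] .
        also have "(\<Prod>j<r. dyad_wt (k A0 j)) = (\<Prod>j<r. dyad_wt (\<kappa> j))" using eq by simp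
        finally show ?thesis .
      next
        case False
        then have e: "{A\<in>S. f A = \<kappa>} = {}" by blast
        have "0 \<le> (\<Prod>j<r. dyad_wt (\<kappa> j))" by (intro prod_nonneg) (simp add: less_imp_le dyad_wt_pos)
        then show ?thesis using B unfolding e by simp
      qed
    qed
    also have "\<dots> = B * (\<Sum>\<kappa>\<in>?P. \<Prod>j<r. dyad_wt (\<kappa> j))" by (simp add: sum_distrib_left)
    also have "(\<Sum>\<kappa>\<in>?P. \<Prod>j<r. dyad_wt (\<kappa> j)) = (\<Prod>j<r. sum dyad_wt Q)"
      using finQ by (subst prod_sum_PiE[symmetric]) auto
    also have "B * \<dots> \<le> B * Z ^ r"
      unfolding prod_constant card_lessThan using Z(2)[OF finQ] B
      by (intro mult_left_mono power_mono sum_nonneg) (auto simp: less_imp_le dyad_wt_pos)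
    finally show ?thesis .
  qed
  then show ?thesis using Z(1) by (intro exI[of _ "Z ^ r"]) auto
qed

text \<open>Pairs each index with its mirror index, because the Gram--Schmidt norms of an
  alternating matrix are bounded in such pairs.\<close>

lemma prod_pair_ends:
  fixes f :: "nat \<Rightarrow> 'a::comm_monoid_mult"
  shows "(\<Prod>j<2 * s. f j) = (\<Prod>p<s. f p * f (2 * s - 1 - p))"
proof -
  have "(\<Prod>j<2 * s. f j) = (\<Prod>j\<in>{..<s} \<union> {s..<2 * s}. f j)" by (intro prod.cong) auto
  also have "\<dots> = (\<Prod>j<s. f j) * (\<Prod>j\<in>{s..<2 * s}. f j)" by (intro prod.union_disjoint) auto
  also have "(\<Prod>j\<in>{s..<2 * s}. f j) = (\<Prod>p<s. f (2 * s - 1 - p))"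
    by (rule prod.reindex_bij_witness[of _ "\<lambda>p. 2 * s - 1 - p" "\<lambda>j. 2 * s - 1 - j"]) auto
  finally show ?thesis by (simp add: prod.distrib)
qed

text \<open>The exponent \<open>3 x + y = 2 x + (x + y)\<close> is a positive combination of two
  forms bounded by \<open>c\<close>; on that region it is at most \<open>4 c\<close> minus half of
  \<open>\<bar>x\<bar> + \<bar>y\<bar>\<close>.\<close>

lemma powr_pair_le_dyad_wt:
  assumes "real_of_int x \<le> c" "real_of_int x + real_of_int y \<le> c" "0 \<le> c"
  shows "(2 powr real_of_int x) ^ 3 * 2 powr real_of_int y \<le> 2 powr (4 * c) * (dyad_wt x * dyad_wt y)"
proof -
  have "(2 powr real_of_int x) ^ 3 * 2 powr real_of_int y = 2 powr (3 * real_of_int x + real_of_int y)"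
    by (simp add: powr_add powr_power algebra_simps)
  also have "\<dots> \<le> 2 powr (4 * c + - \<bar>real_of_int x\<bar> / 2 + - \<bar>real_of_int y\<bar> / 2)"
  proof (rule powr_mono)
    show "3 * real_of_int x + real_of_int y \<le> 4 * c + - \<bar>real_of_int x\<bar> / 2 + - \<bar>real_of_int y\<bar> / 2"
      using assms by (auto simp: abs_if field_simps)
  qed simp
  also have "\<dots> = 2 powr (4 * c) * (dyad_wt x * dyad_wt y)"
    unfolding powr_add by (simp add: dyad_wt_def)
  finally show ?thesis .
qed

text \<open>In \<open>weight_prod_le\<close> below, the factor of \<open>j\<close> counts the choices of the basis vector \<open>v\<^sub>j\<close> together
  with the coefficients \<open>c\<^sub>i\<^sub>j\<close>, \<open>i < j\<close>; the bound comes from pairing \<open>j = p\<close> with \<open>j = r - 1 - p\<close>.\<close>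

context
  fixes n s r :: nat and K C :: real and \<beta> :: "nat \<Rightarrow> real"
  assumes r: "r = 2 * s" and n: "r < n" and K: "0 \<le> K" and C: "1 \<le> C"
    and pos: "\<And>i. i < r \<Longrightarrow> 0 < \<beta> i"
    and mono: "\<And>i j. i \<le> j \<Longrightarrow> j < r \<Longrightarrow> \<beta> i \<le> C * \<beta> j"
    and ends: "\<And>p. p < s \<Longrightarrow> \<beta> p * \<beta> (r - 1 - p) \<le> C"
begin

lemma weight_factor_eq:
  assumes "j < r"
  shows "(\<Prod>l<j. \<beta> l) * \<beta> j ^ (n - j) * (\<Prod>i<j. 1 + K / (\<beta> i * \<beta> j))
       = (\<Prod>i<j. \<beta> i + K / \<beta> j) * \<beta> j ^ (n - j)"
proof -
  have "(\<Prod>l<j. \<beta> l) * (\<Prod>i<j. 1 + K / (\<beta> i * \<beta> j)) = (\<Prod>i<j. \<beta> i * (1 + K / (\<beta> i * \<beta> j)))"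
    by (simp add: prod.distrib)
  also have "\<dots> = (\<Prod>i<j. \<beta> i + K / \<beta> j)"
  proof (rule prod.cong)
    fix i assume "i \<in> {..<j}"
    then have "0 < \<beta> i" using pos assms by auto
    then show "\<beta> i * (1 + K / (\<beta> i * \<beta> j)) = \<beta> i + K / \<beta> j" by (simp add: distrib_left)
  qed simp
  finally show ?thesis by (simp add: mult_ac)
qed

text \<open>The index \<open>j\<close> does not exceed the mirror index \<open>r - 1 - i\<close>, so
  almost-monotonicity and \<open>ends\<close> bound \<open>\<beta> i * \<beta> j\<close>; both
  summands are then of order at most \<open>1 / \<beta> j\<close>.\<close>

lemma weight_summand_le_own:
  assumes ij: "i < j" "j < r" "i + j < r"
  shows "\<beta> i + K / \<beta> j \<le> (C * C + K * C) / \<beta> j"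
proof -
  have i: "i < s" using ij r by simp
  have "\<beta> i * \<beta> j \<le> \<beta> i * (C * \<beta> (r - 1 - i))"
    using mono[of j "r - 1 - i"] ij pos[of i] by (intro mult_left_mono) auto
  also have "\<dots> = C * (\<beta> i * \<beta> (r - 1 - i))" by simp
  also have "\<dots> \<le> C * C" using ends[OF i] C by (intro mult_left_mono) auto
  finally have "\<beta> i * \<beta> j + K \<le> C * C + K * C" using K C mult_left_mono[of 1 C K] by simp
  then have "(\<beta> i * \<beta> j + K) / \<beta> j \<le> (C * C + K * C) / \<beta> j"
    using pos[of j] ij by (intro divide_right_mono) auto
  moreover have "(\<beta> i * \<beta> j + K) / \<beta> j = \<beta> i + K / \<beta> j"
    using pos[of j] ij by (simp add: add_divide_distrib)
  ultimately show ?thesis by simp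
qed

text \<open>Past the antidiagonal the mirror index \<open>r - 1 - j\<close> serves. Up to constants
  \<open>\<beta> i\<close> is at most \<open>\<beta> j\<close>, which \<open>ends\<close> bounds by
  \<open>1 / \<beta> (r - 1 - j)\<close>; almost-monotonicity handles
  \<open>K / \<beta> j\<close>.\<close>

lemma weight_summand_le_opposite:
  assumes ij: "i < j" "j < r" "r \<le> i + j"
  shows "\<beta> i + K / \<beta> j \<le> (C * C + K * C) / \<beta> (r - 1 - j)"
proof -
  let ?p = "r - 1 - j"
  have p: "?p < s" "r - 1 - ?p = j" using ij r by auto
  have b: "0 < \<beta> ?p" "0 < \<beta> j" using pos ij by auto
  have "\<beta> i * \<beta> ?p \<le> C * \<beta> j * \<beta> ?p" using mono[of i j] ij b by (intro mult_right_mono) auto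
  also have "\<dots> = C * (\<beta> ?p * \<beta> j)" by simp
  also have "\<dots> \<le> C * C" using ends[OF p(1)] p(2) C by (intro mult_left_mono) auto
  finally have 1: "\<beta> i \<le> C * C / \<beta> ?p" using b by (simp add: field_simps)
  have "\<beta> ?p \<le> C * \<beta> j" using mono[of ?p j] ij p r by auto
  then have "K * \<beta> ?p \<le> K * (C * \<beta> j)" using K by (rule mult_left_mono)
  then have "K / \<beta> j \<le> K * C / \<beta> ?p" using b by (simp add: field_simps)
  with 1 show ?thesis by (simp add: add_divide_distrib)
qed

text \<open>In the product for \<open>p\<close> every \<open>i\<close> lies before the antidiagonal;
  in that for \<open>p'\<close> this holds for \<open>i \<le> p\<close> only. Counting powers leaves
  \<open>\<beta> p ^ (3 + e) * \<beta> p' ^ (1 + e)\<close> with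
  \<open>e = n - r - 1\<close>.\<close>

lemma weight_pair_le:
  assumes p: "p < s" and p': "p' = r - 1 - p"
  shows "(\<Prod>i<p. \<beta> i + K / \<beta> p) * \<beta> p ^ (n - p) * ((\<Prod>i<p'. \<beta> i + K / \<beta> p') * \<beta> p' ^ (n - p'))
    \<le> (C * C + K * C) ^ (r - 1) * C ^ n * (\<beta> p ^ 3 * \<beta> p')"
proof -
  let ?M = "C * C + K * C"
  have M: "0 < ?M" using K C by (simp add: add_pos_nonneg)
  have lt: "p < r" "p' < r" "p < p'" using p p' r by auto
  have b: "0 < \<beta> p" "0 < \<beta> p'" using pos lt by auto
  have nn: "0 \<le> \<beta> i + K / \<beta> j" if "i < r" "j < r" for i j using pos that K by (simp add: less_imp_le)
  have "(\<Prod>i<p. \<beta> i + K / \<beta> p) \<le> (\<Prod>i<p. ?M / \<beta> p)"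
    using weight_summand_le_own[of _ p] nn lt p r by (intro prod_mono) auto
  also have "\<dots> = ?M ^ p / \<beta> p ^ p" by (simp add: power_divide)
  finally have 1: "(\<Prod>i<p. \<beta> i + K / \<beta> p) \<le> ?M ^ p / \<beta> p ^ p" .
  have set_eq: "{..<p'} = {..<Suc p} \<union> {Suc p..<p'}" using lt by auto
  have "(\<Prod>i<p'. \<beta> i + K / \<beta> p') = (\<Prod>i<Suc p. \<beta> i + K / \<beta> p') * (\<Prod>i\<in>{Suc p..<p'}. \<beta> i + K / \<beta> p')"
    unfolding set_eq by (rule prod.union_disjoint) auto
  also have "\<dots> \<le> (\<Prod>i<Suc p. ?M / \<beta> p') * (\<Prod>i\<in>{Suc p..<p'}. ?M / \<beta> p)"
  proof (intro mult_mono prod_mono conjI prod_nonneg)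
    fix i assume "i \<in> {..<Suc p}"
    then show "\<beta> i + K / \<beta> p' \<le> ?M / \<beta> p'" using weight_summand_le_own[of i p'] lt p p' by auto
  next
    fix i assume i: "i \<in> {Suc p..<p'}"
    have "r - 1 - p' = p" using p' lt by auto
    then show "\<beta> i + K / \<beta> p' \<le> ?M / \<beta> p" using weight_summand_le_opposite[of i p'] lt p p' i by auto
  qed (use nn lt M b in \<open>auto intro!: nn\<close>)
  also have "\<dots> = ?M ^ p' / (\<beta> p' ^ Suc p * \<beta> p ^ (p' - Suc p))"
  proof -
    have "p' = Suc p + (p' - Suc p)" using lt by simp
    then have "?M ^ p' = ?M ^ Suc p * ?M ^ (p' - Suc p)" by (metis power_add)
    then show ?thesis by (simp add: power_divide)
  qed
  finally have 2: "(\<Prod>i<p'. \<beta> i + K / \<beta> p') \<le> ?M ^ p' / (\<beta> p' ^ Suc p * \<beta> p ^ (p' - Suc p))" .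
  \<comment> \<open>No truncation occurs because \<open>r < n\<close>. The surplus
    \<open>(\<beta> p * \<beta> p') ^ e\<close> is bounded through \<open>ends\<close>.\<close>
  define e where "e = n - r - 1"
  have e: "n = r + 1 + e" using n by (simp add: e_def)
  have x1: "n - p = p + (p' - Suc p) + (3 + e)" using e lt p' p r by simp
  have x2: "n - p' = Suc p + (1 + e)" using e lt p' p r by simp
  have "(\<Prod>i<p. \<beta> i + K / \<beta> p) * \<beta> p ^ (n - p) * ((\<Prod>i<p'. \<beta> i + K / \<beta> p') * \<beta> p' ^ (n - p'))
     \<le> (?M ^ p / \<beta> p ^ p) * \<beta> p ^ (n - p) * (?M ^ p' / (\<beta> p' ^ Suc p * \<beta> p ^ (p' - Suc p)) * \<beta> p' ^ (n - p'))"
    using 1 2 b M nn lt by (intro mult_mono mult_right_mono prod_nonneg mult_nonneg_nonneg) (auto intro!: nn)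
  also have "\<dots> = ?M ^ (p + p') * (\<beta> p ^ (3 + e) * \<beta> p' ^ (1 + e))"
    unfolding x1 x2 power_add using b by (simp add: field_simps)
  also have "\<dots> = ?M ^ (p + p') * (\<beta> p * \<beta> p') ^ e * (\<beta> p ^ 3 * \<beta> p')"
    by (simp add: power_add power_mult_distrib)
  also have "\<dots> \<le> ?M ^ (p + p') * C ^ n * (\<beta> p ^ 3 * \<beta> p')"
  proof -
    have "(\<beta> p * \<beta> p') ^ e \<le> C ^ e" using ends[OF p] p' b by (intro power_mono) auto
    also have "\<dots> \<le> C ^ n" using C e by (intro power_increasing) auto
    finally show ?thesis using M b by (intro mult_right_mono mult_left_mono) auto
  qed
  also have "p + p' = r - 1" using p' lt by simp
  finally show ?thesis .
qed

lemma weight_prod_le: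
  "(\<Prod>j<r. (\<Prod>l<j. \<beta> l) * \<beta> j ^ (n - j) * (\<Prod>i<j. 1 + K / (\<beta> i * \<beta> j)))
    \<le> ((C * C + K * C) ^ (r - 1) * C ^ n) ^ s * (\<Prod>p<s. \<beta> p ^ 3 * \<beta> (r - 1 - p))"
proof -
  let ?f = "\<lambda>j. (\<Prod>i<j. \<beta> i + K / \<beta> j) * \<beta> j ^ (n - j)"
  have nn: "0 \<le> ?f j" if "j < r" for j
    using that pos K by (intro mult_nonneg_nonneg prod_nonneg zero_le_power) (auto simp: less_imp_le)
  have "(\<Prod>j<r. (\<Prod>l<j. \<beta> l) * \<beta> j ^ (n - j) * (\<Prod>i<j. 1 + K / (\<beta> i * \<beta> j))) = (\<Prod>j<r. ?f j)"
    using weight_factor_eq by (intro prod.cong) auto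
  also have "\<dots> = (\<Prod>p<s. ?f p * ?f (r - 1 - p))" unfolding r using prod_pair_ends[of ?f s] .
  also have "\<dots> \<le> (\<Prod>p<s. (C * C + K * C) ^ (r - 1) * C ^ n * (\<beta> p ^ 3 * \<beta> (r - 1 - p)))"
  proof (intro prod_mono conjI)
    fix p assume p: "p \<in> {..<s}"
    then have "p < r" "r - 1 - p < r" using r by auto
    then show "0 \<le> ?f p * ?f (r - 1 - p)" using nn mult_nonneg_nonneg by blast
    show "?f p * ?f (r - 1 - p) \<le> (C * C + K * C) ^ (r - 1) * C ^ n * (\<beta> p ^ 3 * \<beta> (r - 1 - p))"
      using weight_pair_le[of p "r - 1 - p"] p by blast
  qed
  also have "\<dots> = ((C * C + K * C) ^ (r - 1) * C ^ n) ^ s * (\<Prod>p<s. \<beta> p ^ 3 * \<beta> (r - 1 - p))"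
    by (simp add: prod.distrib)
  finally show ?thesis .
qed

end

text \<open>With \<open>c = log 2 C\<close>, \<open>ends\<close> gives
  \<open>k p + k q \<le> c\<close> for the mirror index \<open>q\<close> of \<open>p\<close>, and
  \<open>mono\<close> then gives \<open>k p \<le> c\<close>. So \<open>powr_pair_le_dyad_wt\<close>
  turns each pair in \<open>weight_prod_le\<close> into two weights.\<close>

lemma dyadic_weight_le:
  assumes r: "r = 2 * s" and n: "r < n" and K: "0 \<le> K" and C: "1 \<le> C"
    and \<beta>: "\<And>i. \<beta> i = 2 powr real_of_int (k i)"
    and mono: "\<And>i j. i \<le> j \<Longrightarrow> j < r \<Longrightarrow> \<beta> i \<le> C * \<beta> j"
    and ends: "\<And>p. p < s \<Longrightarrow> \<beta> p * \<beta> (r - 1 - p) \<le> C"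
  shows "(\<Prod>j<r. (\<Prod>l<j. \<beta> l) * \<beta> j ^ (n - j) * (\<Prod>i<j. 1 + K / (\<beta> i * \<beta> j)))
    \<le> ((C * C + K * C) ^ (r - 1) * C ^ n * C ^ 4) ^ s * (\<Prod>j<r. dyad_wt (k j))"
proof -
  let ?D = "(C * C + K * C) ^ (r - 1) * C ^ n"
  have pos: "0 < \<beta> i" for i by (simp add: \<beta>)
  define c where "c = log 2 C"
  have c: "C = 2 powr c" "0 \<le> c" using C by (auto simp: c_def)
  have pair: "\<beta> p ^ 3 * \<beta> (r - 1 - p) \<le> C ^ 4 * (dyad_wt (k p) * dyad_wt (k (r - 1 - p)))" if p: "p < s" for p
  proof -
    let ?q = "r - 1 - p"
    have "2 powr (real_of_int (k p) + real_of_int (k ?q)) \<le> 2 powr c"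
      using ends[OF p] by (simp add: \<beta> powr_add c(1)[symmetric])
    then have xy: "real_of_int (k p) + real_of_int (k ?q) \<le> c" by simp
    have "\<beta> p \<le> C * \<beta> ?q" using mono[of p ?q] p r by auto
    then have "2 powr real_of_int (k p) \<le> 2 powr (c + real_of_int (k ?q))" by (simp add: \<beta> c(1) powr_add)
    then have "real_of_int (k p) \<le> c + real_of_int (k ?q)" by simp
    then have "real_of_int (k p) \<le> c" using xy by linarith
    then have "\<beta> p ^ 3 * \<beta> ?q \<le> 2 powr (4 * c) * (dyad_wt (k p) * dyad_wt (k ?q))"
      unfolding \<beta> using powr_pair_le_dyad_wt xy c(2) by blast
    also have "2 powr (4 * c) = C ^ 4" by (simp add: c(1) powr_power mult.commute)
    finally show ?thesis .
  qed
  have D: "0 \<le> ?D" using K C by simp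
  have "(\<Prod>j<r. (\<Prod>l<j. \<beta> l) * \<beta> j ^ (n - j) * (\<Prod>i<j. 1 + K / (\<beta> i * \<beta> j)))
    \<le> ?D ^ s * (\<Prod>p<s. \<beta> p ^ 3 * \<beta> (r - 1 - p))"
    by (rule weight_prod_le[OF r n K C]) (use pos mono ends in auto)
  also have "\<dots> \<le> ?D ^ s * (\<Prod>p<s. C ^ 4 * (dyad_wt (k p) * dyad_wt (k (r - 1 - p))))"
    using D pair pos by (intro mult_left_mono prod_mono conjI) (auto simp: less_imp_le)
  also have "\<dots> = (?D * C ^ 4) ^ s * (\<Prod>p<s. dyad_wt (k p) * dyad_wt (k (2 * s - 1 - p)))"
    by (simp add: prod.distrib power_mult_distrib r)
  also have "(\<Prod>p<s. dyad_wt (k p) * dyad_wt (k (2 * s - 1 - p))) = (\<Prod>j<r. dyad_wt (k j))"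
    unfolding r using prod_pair_ends[of "\<lambda>j. dyad_wt (k j)" s] by simp
  finally show ?thesis .
qed

text \<open>Here the factor of \<open>j\<close> stands for one basis vector together with the
  \<open>r\<close> coefficients of one frame vector. Up to constants all powers cancel except
  \<open>\<beta> j ^ (n - r)\<close>, at least one power since \<open>r < n\<close>, and this decays
  as \<open>k j\<close> decreases. At \<open>i0\<close> half of the decay is given up for
  \<open>sqrt \<delta>\<close>.\<close>

lemma dyadic_weight_le_small:
  assumes n: "r < n" and C: "1 \<le> C"
    and \<beta>: "\<And>i. \<beta> i = 2 powr real_of_int (k i)"
    and mono: "\<And>i j. i \<le> j \<Longrightarrow> j < r \<Longrightarrow> \<beta> i \<le> C * \<beta> j"
    and top: "\<And>j. j < r \<Longrightarrow> \<beta> j \<le> C"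
    and \<delta>: "0 < \<delta>" "\<delta> \<le> 1" and i0: "i0 < r" "\<beta> i0 \<le> \<delta>"
  shows "(\<Prod>j<r. (\<Prod>l<j. \<beta> l) * \<beta> j ^ (n - j) * (\<Prod>i<r. C / \<beta> i))
    \<le> (C ^ (2 * r + n) * C ^ 2) ^ r * sqrt \<delta> * (\<Prod>j<r. dyad_wt (k j))"
proof -
  have pos: "0 < \<beta> i" for i by (simp add: \<beta>)
  have step: "(\<Prod>l<j. \<beta> l) * \<beta> j ^ (n - j) * (\<Prod>i<r. C / \<beta> i) \<le> C ^ (2 * r + n) * \<beta> j" if j: "j < r" for j
  proof -
    have pw: "\<beta> j ^ (n - j) = \<beta> j ^ (n - r - 1) * \<beta> j * \<beta> j ^ (r - j)"
    proof -
      have "n - j = (n - r - 1) + 1 + (r - j)" using j n by simp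
      then show ?thesis by (metis power_add power_one_right)
    qed
    have set_eq: "{..<r} = {..<j} \<union> {j..<r}" using j by auto
    have "(\<Prod>i<r. C / \<beta> i) = (\<Prod>i<j. C / \<beta> i) * (\<Prod>i\<in>{j..<r}. C / \<beta> i)"
      unfolding set_eq by (rule prod.union_disjoint) auto
    then have "(\<Prod>l<j. \<beta> l) * \<beta> j ^ (n - j) * (\<Prod>i<r. C / \<beta> i)
        = ((\<Prod>l<j. \<beta> l) * (\<Prod>i<j. C / \<beta> i)) * \<beta> j ^ (n - j) * (\<Prod>i\<in>{j..<r}. C / \<beta> i)"
      by (simp only: mult_ac)
    also have "(\<Prod>l<j. \<beta> l) * (\<Prod>i<j. C / \<beta> i) = (\<Prod>i<j. C)"
      unfolding prod.distrib[symmetric] using pos by (intro prod.cong) (auto simp: less_imp_neq[symmetric])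
    also have "(\<Prod>i<j. C) * \<beta> j ^ (n - j) * (\<Prod>i\<in>{j..<r}. C / \<beta> i)
       \<le> (\<Prod>i<j. C) * \<beta> j ^ (n - j) * (\<Prod>i\<in>{j..<r}. C * C / \<beta> j)"
    proof (intro mult_left_mono prod_mono conjI)
      fix i assume "i \<in> {j..<r}"
      then have "C * \<beta> j \<le> C * (C * \<beta> i)" using mono[of j i] C by (intro mult_left_mono) auto
      then show "C / \<beta> i \<le> C * C / \<beta> j" using pos[of i] pos[of j] by (simp add: field_simps)
    qed (use pos C in \<open>auto simp: less_imp_le\<close>)
    also have "\<dots> = C ^ j * \<beta> j ^ (n - j) * ((C * C) ^ (r - j) / \<beta> j ^ (r - j))" by (simp add: power_divide)
    also have "\<dots> = C ^ j * (C * C) ^ (r - j) * \<beta> j ^ (n - r - 1) * \<beta> j"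
      unfolding pw using pos[of j] by simp
    also have "\<dots> \<le> C ^ j * (C * C) ^ (r - j) * C ^ (n - r - 1) * \<beta> j"
      using top[OF j] pos[of j] C by (intro mult_right_mono mult_left_mono power_mono) auto
    also have "C ^ j * (C * C) ^ (r - j) * C ^ (n - r - 1) = C ^ (j + 2 * (r - j) + (n - r - 1))"
      by (simp add: power_add power_mult power2_eq_square)
    also have "\<dots> * \<beta> j \<le> C ^ (2 * r + n) * \<beta> j"
      using C j pos[of j] by (intro mult_right_mono power_increasing) auto
    finally show ?thesis .
  qed
  define c where "c = log 2 C"
  have c: "C = 2 powr c" "0 \<le> c" using C by (auto simp: c_def)
  define d where "d = log 2 \<delta>"
  have d: "\<delta> = 2 powr d" "d \<le> 0" using \<delta> by (auto simp: d_def)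
  have "sqrt \<delta> = (2 powr d) powr (1/2)" using d(1) \<delta>(1) powr_half_sqrt[of \<delta>] by simp
  then have sd: "sqrt \<delta> = 2 powr (d / 2)" by (simp add: powr_powr)
  have C2: "C ^ 2 = 2 powr (2 * c)" by (simp add: c(1) powr_power mult.commute)
  have b: "\<beta> j \<le> C ^ 2 * ((if j = i0 then sqrt \<delta> else 1) * dyad_wt (k j))" if j: "j < r" for j
  proof (cases "j = i0")
    case True
    have "2 powr real_of_int (k j) \<le> 2 powr d" using i0(2) True d(1) by (simp add: \<beta>)
    then have "real_of_int (k j) \<le> d" by simp
    then have "real_of_int (k j) \<le> 2 * c + (d / 2 + - \<bar>real_of_int (k j)\<bar> / 2)" using d(2) c(2) by simp
    then have "2 powr real_of_int (k j) \<le> 2 powr (2 * c + (d / 2 + - \<bar>real_of_int (k j)\<bar> / 2))" by simp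
    then show ?thesis using True by (simp only: \<beta> powr_add C2 sd dyad_wt_def) simp
  next
    case False
    have "2 powr real_of_int (k j) \<le> 2 powr c" using top[OF j] c(1) by (simp add: \<beta>)
    then have "real_of_int (k j) \<le> c" by simp
    then have "real_of_int (k j) \<le> 2 * c + - \<bar>real_of_int (k j)\<bar> / 2" using c(2) by linarith
    then have "2 powr real_of_int (k j) \<le> 2 powr (2 * c + - \<bar>real_of_int (k j)\<bar> / 2)" by simp
    then show ?thesis using False by (simp only: \<beta> powr_add C2 dyad_wt_def) simp
  qed
  have "(\<Prod>j<r. (\<Prod>l<j. \<beta> l) * \<beta> j ^ (n - j) * (\<Prod>i<r. C / \<beta> i))
     \<le> (\<Prod>j<r. C ^ (2 * r + n) * (C ^ 2 * ((if j = i0 then sqrt \<delta> else 1) * dyad_wt (k j))))"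
  proof (intro prod_mono conjI)
    fix j assume j: "j \<in> {..<r}"
    show "0 \<le> (\<Prod>l<j. \<beta> l) * \<beta> j ^ (n - j) * (\<Prod>i<r. C / \<beta> i)"
      using pos C by (intro mult_nonneg_nonneg prod_nonneg) (auto simp: less_imp_le)
    have "(\<Prod>l<j. \<beta> l) * \<beta> j ^ (n - j) * (\<Prod>i<r. C / \<beta> i) \<le> C ^ (2 * r + n) * \<beta> j" using step j by simp
    also have "\<dots> \<le> C ^ (2 * r + n) * (C ^ 2 * ((if j = i0 then sqrt \<delta> else 1) * dyad_wt (k j)))"
      using C j by (intro mult_left_mono b) auto
    finally show "(\<Prod>l<j. \<beta> l) * \<beta> j ^ (n - j) * (\<Prod>i<r. C / \<beta> i) \<le> \<dots>" .
  qed
  also have "\<dots> = (\<Prod>j<r. C ^ (2 * r + n) * C ^ 2) * ((\<Prod>j<r. if j = i0 then sqrt \<delta> else 1) * (\<Prod>j<r. dyad_wt (k j)))"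
    unfolding prod.distrib by (simp only: mult_ac)
  also have "(\<Prod>j<r. if j = i0 then sqrt \<delta> else 1) = sqrt \<delta>" using i0(1) by (subst prod.delta) auto
  finally show ?thesis by (simp add: mult_ac)
qed

subsection \<open>Lattices of integer points in rational subspaces\<close>

text \<open>Chosen once for each \<open>V\<close>, so it depends on the subspace alone; the fibre
  counts rest on this.\<close>

definition lattice_basis :: "(real ^ 'n) set \<Rightarrow> nat \<Rightarrow> real ^ 'n" where
  "lattice_basis V = (SOME v. hkz (V \<inter> int_vec) (dim V) v)"

definition gso_norm :: "(real ^ 'n) set \<Rightarrow> nat \<Rightarrow> real" where
  "gso_norm V i = norm (gso (lattice_basis V) i)"

text \<open>The dyadic size of a Gram--Schmidt norm relative to a scale \<open>H\<close>, which is
  \<open>sqrt T\<close> for matrices and a bound on the vectors for frames.\<close>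

definition gso_exponent :: "real \<Rightarrow> (real ^ 'n) set \<Rightarrow> nat \<Rightarrow> int" where
  "gso_exponent H V i = \<lfloor>log 2 (gso_norm V i / H)\<rfloor>"

text \<open>Pairing a linear relation with \<open>y i\<close> isolates its \<open>i\<close>-th
  coefficient.\<close>

lemma biorthogonal_independent:
  fixes x y :: "'b \<Rightarrow> 'a::euclidean_space"
  assumes fin: "finite I" and d: "\<And>i j. i \<in> I \<Longrightarrow> j \<in> I \<Longrightarrow> y i \<bullet> x j = (if i = j then 1 else 0)"
  shows "inj_on x I" "independent (x ` I)"
proof -
  show inj: "inj_on x I"
  proof (rule inj_onI)
    fix i j assume "i \<in> I" "j \<in> I" "x i = x j"
    then show "i = j" using d[of i i] d[of i j] by (auto split: if_splits)
  qed
  show "independent (x ` I)"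
  proof (rule independent_if_scalars_zero)
    show "finite (x ` I)" using fin by simp
    fix f z assume s: "(\<Sum>z\<in>x ` I. f z *\<^sub>R z) = 0" and "z \<in> x ` I"
    then obtain i where i: "i \<in> I" "z = x i" by blast
    have "(\<Sum>j\<in>I. f (x j) *\<^sub>R x j) = 0" using s by (simp add: sum.reindex[OF inj])
    then have "y i \<bullet> (\<Sum>j\<in>I. f (x j) *\<^sub>R x j) = 0" by simp
    then have "(\<Sum>j\<in>I. f (x j) * (if i = j then 1 else 0)) = 0"
      using i d by (simp add: inner_sum_right)
    also have "(\<Sum>j\<in>I. f (x j) * (if i = j then 1 else 0)) = f (x i)"
      using fin i by (simp add: if_distrib cong: if_cong)
    finally show "f z = 0" using i by simp
  qed
qed

text \<open>The integer points of such a \<open>V\<close> form a lattice of full rank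
  \<open>r\<close>, so that reduced bases exist.\<close>

locale rational_subspace =
  fixes V :: "(real ^ 'n) set" and r :: nat
  assumes subspace: "subspace V" and spanned: "V \<subseteq> span (V \<inter> int_vec)" and dim: "dim V = r"
begin

abbreviation v :: "nat \<Rightarrow> real ^ 'n" where "v \<equiv> lattice_basis V"
abbreviation a :: "nat \<Rightarrow> real" where "a \<equiv> gso_norm V"

lemma hkz_v: "hkz (V \<inter> int_vec) r v"
  unfolding lattice_basis_def dim using someI_ex[OF hkz_exists[OF subspace spanned dim]] .

lemma v_in: "i < r \<Longrightarrow> v i \<in> V \<inter> int_vec"
  using hkz_v unfolding hkz_def by blast

lemma a_pos: "i < r \<Longrightarrow> 0 < a i"
  using hkz_v unfolding hkz_def gso_norm_def by auto

lemma a_mono: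
  assumes "i \<le> j" "j < r" shows "a i \<le> 2 ^ r * a j"
proof -
  have "a i \<le> 2 ^ (j - i) * a j" using hkz_gso_mono[OF hkz_v assms] by (simp add: gso_norm_def)
  also have "\<dots> \<le> 2 ^ r * a j"
    using assms a_pos[of j] by (intro mult_right_mono power_increasing) auto
  finally show ?thesis .
qed

lemma a_lower:
  assumes "i < r" shows "1 \<le> 2 ^ r * a i"
proof -
  have "1 \<le> 2 ^ i * a i" using hkz_gso_lower[OF hkz_v assms] by (simp add: gso_norm_def)
  also have "\<dots> \<le> 2 ^ r * a i"
    using assms a_pos[of i] by (intro mult_right_mono power_increasing) auto
  finally show ?thesis .
qed

text \<open>The dual basis: \<open>w i\<close> reads off the \<open>i\<close>-th coordinate in
  \<open>v\<close>, and its norm, of order at most \<open>1 / a i\<close>, bounds that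
  coordinate.\<close>

definition w :: "nat \<Rightarrow> real ^ 'n" where
  "w = (SOME w. (\<forall>i<r. \<forall>j<r. w i \<bullet> v j = (if i = j then 1 else 0)) \<and>
     (\<forall>i<r. norm (w i) * norm (gso v i) \<le> (2 ^ r + 1) ^ r))"

lemma w_dual: "i < r \<Longrightarrow> j < r \<Longrightarrow> w i \<bullet> v j = (if i = j then 1 else 0)"
  and w_norm': "i < r \<Longrightarrow> norm (w i) * a i \<le> (2 ^ r + 1) ^ r"
  using someI_ex[OF hkz_dual[OF hkz_v]] unfolding w_def[symmetric] gso_norm_def by auto

lemma w_norm:
  assumes "i < r" shows "norm (w i) \<le> (2 ^ r + 1) ^ r / a i"
  using w_norm'[OF assms] a_pos[OF assms] by (simp add: field_simps)

lemma v_inj: "inj_on v {..<r}" and v_independent: "independent (v ` {..<r})"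
  using biorthogonal_independent[of "{..<r}" w v] w_dual by auto

lemma span_v: "span (v ` {..<r}) = V"
proof
  show "span (v ` {..<r}) \<subseteq> V" using v_in by (intro span_minimal subspace) auto
  have "card (v ` {..<r}) = r" using card_image[OF v_inj] by simp
  then show "V \<subseteq> span (v ` {..<r})"
    using v_independent dim v_in by (intro card_ge_dim_independent) auto
qed

lemma expand:
  assumes "x \<in> V" shows "x = (\<Sum>i<r. (w i \<bullet> x) *\<^sub>R v i)"
proof -
  have "x \<in> span (v ` {..<r})" using assms span_v by simp
  then obtain u where "(\<Sum>z\<in>v ` {..<r}. u z *\<^sub>R z) = x"
    by (auto simp: span_finite)
  then have u: "x = (\<Sum>j<r. u (v j) *\<^sub>R v j)" by (simp add: sum.reindex[OF v_inj])
  have "w i \<bullet> x = u (v i)" if i: "i < r" for i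
  proof -
    have "w i \<bullet> x = (\<Sum>j<r. u (v j) * (if i = j then 1 else 0))"
      using i by (simp add: u inner_sum_right w_dual)
    also have "\<dots> = u (v i)" using i by (simp add: if_distrib cong: if_cong)
    finally show ?thesis .
  qed
  then show ?thesis using u by simp
qed

text \<open>By \<open>hkz_basis\<close> the reduced basis generates the lattice over the
  integers.\<close>

lemma coeff_Ints:
  assumes x: "x \<in> V \<inter> int_vec" and i: "i < r" shows "w i \<bullet> x \<in> \<int>"
proof -
  obtain m :: "nat \<Rightarrow> int" where m: "x = (\<Sum>i<r. of_int (m i) *\<^sub>R v i)"
    using hkz_basis[OF subspace dim hkz_v x] by blast
  have "w i \<bullet> x = (\<Sum>j<r. of_int (m j) * (if i = j then 1 else 0))"
    using i by (simp add: m inner_sum_right w_dual)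
  also have "\<dots> = of_int (m i)" using i by (simp add: if_distrib cong: if_cong)
  finally show ?thesis by simp
qed

lemma coeff_bound:
  assumes "i < r" shows "\<bar>w i \<bullet> x\<bar> \<le> (2 ^ r + 1) ^ r * norm x / a i"
proof -
  have "\<bar>w i \<bullet> x\<bar> \<le> norm (w i) * norm x" by (rule Cauchy_Schwarz_ineq2)
  also have "\<dots> \<le> (2 ^ r + 1) ^ r / a i * norm x" by (intro mult_right_mono w_norm assms) simp
  finally show ?thesis by simp
qed

context
  fixes H :: real
  assumes H: "0 < H"
begin

lemma exponent_bounds:
  assumes "i < r"
  shows "H * 2 powr real_of_int (gso_exponent H V i) \<le> a i"
    and "a i < 2 * (H * 2 powr real_of_int (gso_exponent H V i))"
proof -
  let ?k = "gso_exponent H V i"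
  have p: "0 < a i / H" using a_pos[OF assms] H by simp
  have "2 powr real_of_int ?k \<le> 2 powr log 2 (a i / H)" unfolding gso_exponent_def by simp
  then have 1: "2 powr real_of_int ?k \<le> a i / H" using p by simp
  then show "H * 2 powr real_of_int ?k \<le> a i" using H by (simp add: field_simps)
  have "2 powr log 2 (a i / H) < 2 powr (real_of_int ?k + 1)" unfolding gso_exponent_def by (simp add: powr_less_cancel_iff)
  then have "a i / H < 2 powr real_of_int ?k * 2" using p by (simp add: powr_add)
  then show "a i < 2 * (H * 2 powr real_of_int ?k)" using H by (simp add: field_simps)
qed

text \<open>Provides the uniform lower bound on the scales that the count of reduced bases
  requires.\<close>

lemma scale_lower:
  assumes "i < r" shows "1 / 2 ^ Suc r \<le> H * 2 powr real_of_int (gso_exponent H V i)"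
proof -
  have "1 \<le> 2 ^ r * a i" using a_lower[OF assms] .
  also have "\<dots> \<le> 2 ^ r * (2 * (H * 2 powr real_of_int (gso_exponent H V i)))"
    using exponent_bounds(2)[OF assms] by (intro mult_left_mono) auto
  finally show ?thesis by (simp add: field_simps)
qed

text \<open>The factor \<open>2 ^ r\<close> comes from \<open>a_mono\<close>, the additional 2 from
  rounding to a power of 2.\<close>

lemma scale_mono:
  assumes "i \<le> j" "j < r"
  shows "2 powr real_of_int (gso_exponent H V i) \<le> 2 ^ Suc r * 2 powr real_of_int (gso_exponent H V j)"
proof -
  have "H * 2 powr real_of_int (gso_exponent H V i) \<le> a i" using exponent_bounds assms by auto
  also have "\<dots> \<le> 2 ^ r * a j" using a_mono[OF assms] .
  also have "\<dots> \<le> 2 ^ r * (2 * (H * 2 powr real_of_int (gso_exponent H V j)))"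
    using exponent_bounds(2)[OF assms(2)] by (intro mult_left_mono) auto
  also have "\<dots> = H * (2 ^ Suc r * 2 powr real_of_int (gso_exponent H V j))" by simp
  finally show ?thesis using H by (simp only: mult_le_cancel_left_pos)
qed

lemma basis_in_red_seqs:
  assumes "\<And>i. i < r \<Longrightarrow> \<alpha> i = H * 2 powr real_of_int (gso_exponent H V i)"
  shows "restrict v {..<r} \<in> red_seqs \<alpha> r"
proof -
  have g: "gso (restrict v {..<r}) i = gso v i" if "i < r" for i using that by (intro gso_cong) auto
  have "\<alpha> i \<le> norm (gso v i)" "norm (gso v i) < 2 * \<alpha> i" if "i < r" for i
    using exponent_bounds[OF that] assms[OF that] by (auto simp: gso_norm_def)
  then show ?thesis using hkz_v unfolding red_seqs_def hkz_def by (auto simp: g)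
qed

end

end

text \<open>The \<open>j\<close>-th factor in \<open>card_red_seqs\<close> has degree
  \<open>j + (n - j) = n\<close> in the scales, so \<open>H ^ n\<close> comes out of each.\<close>

lemma card_red_seqs_scaled:
  assumes "r \<le> CARD('n)"
  shows "\<exists>K>0. \<forall>H>0. \<forall>\<beta> :: nat \<Rightarrow> real. (\<forall>i<r. 1 / 2 ^ Suc r \<le> H * \<beta> i) \<longrightarrow>
     finite (red_seqs (\<lambda>i. H * \<beta> i) r :: (nat \<Rightarrow> real ^ 'n) set) \<and>
     real (card (red_seqs (\<lambda>i. H * \<beta> i) r :: (nat \<Rightarrow> real ^ 'n) set))
       \<le> (K * H ^ CARD('n)) ^ r * (\<Prod>j<r. (\<Prod>l<j. \<beta> l) * \<beta> j ^ (CARD('n) - j))"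
proof -
  let ?n = "CARD('n)"
  define K where "K = (2 * (2 * real ?n + 2 / (1 / 2 ^ Suc r))) ^ ?n"
  have "0 < 2 * (2 * real ?n + 2 / (1 / 2 ^ Suc r))" by (simp add: add_pos_pos)
  then have K: "K > 0" unfolding K_def by (rule zero_less_power)
  have "(\<Prod>i<r. K * (\<Prod>l<i. H * \<beta> l) * (H * \<beta> i) ^ (?n - i))
      = (K * H ^ ?n) ^ r * (\<Prod>j<r. (\<Prod>l<j. \<beta> l) * \<beta> j ^ (?n - j))" for H and \<beta> :: "nat \<Rightarrow> real"
  proof -
    have "(\<Prod>i<r. K * (\<Prod>l<i. H * \<beta> l) * (H * \<beta> i) ^ (?n - i))
       = (\<Prod>i<r. (K * H ^ ?n) * ((\<Prod>l<i. \<beta> l) * \<beta> i ^ (?n - i)))"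
    proof (rule prod.cong)
      fix i assume "i \<in> {..<r}"
      then have "?n = i + (?n - i)" using assms by simp
      then have "H ^ ?n = H ^ i * H ^ (?n - i)" by (metis power_add)
      then show "K * (\<Prod>l<i. H * \<beta> l) * (H * \<beta> i) ^ (?n - i) = (K * H ^ ?n) * ((\<Prod>l<i. \<beta> l) * \<beta> i ^ (?n - i))"
        by (simp add: prod.distrib power_mult_distrib)
    qed simp
    then show ?thesis by (simp add: prod.distrib)
  qed
  moreover have "finite (red_seqs (\<lambda>i. H * \<beta> i) r :: (nat \<Rightarrow> real ^ 'n) set) \<and>
     real (card (red_seqs (\<lambda>i. H * \<beta> i) r :: (nat \<Rightarrow> real ^ 'n) set))
       \<le> (\<Prod>i<r. K * (\<Prod>l<i. H * \<beta> l) * (H * \<beta> i) ^ (?n - i))"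
    if "\<forall>i<r. 1 / 2 ^ Suc r \<le> H * \<beta> i" for H and \<beta> :: "nat \<Rightarrow> real"
    unfolding K_def using that by (intro card_red_seqs assms) auto
  ultimately show ?thesis using K by (intro exI[of _ K]) auto
qed

subsection \<open>Alternating integer matrices\<close>

text \<open>Cauchy--Schwarz in each row; \<open>norm M\<close> is the Frobenius norm.\<close>

lemma norm_matrix_vector_mult_le:
  fixes M :: "real ^ 'n ^ 'm" shows "norm (M *v x) \<le> norm M * norm x"
proof -
  have "norm (M *v x) = L2_set (\<lambda>i. norm ((M *v x) $ i)) UNIV" by (simp add: norm_vec_def)
  also have "\<dots> \<le> L2_set (\<lambda>i. norm (M $ i) * norm x) UNIV"
  proof (rule L2_set_mono)
    fix i
    have "(M *v x) $ i = M $ i \<bullet> x" by (simp add: matrix_vector_mult_def inner_vec_def)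
    then show "norm ((M *v x) $ i) \<le> norm (M $ i) * norm x" using Cauchy_Schwarz_ineq2 by simp
  qed simp
  also have "\<dots> = norm M * norm x"
    by (simp add: norm_vec_def[of M] L2_set_left_distrib)
  finally show ?thesis .
qed

lemma skew_inner:
  fixes M :: "real ^ 'n ^ 'n"
  assumes "transpose M = - M" shows "x \<bullet> (M *v y) = - ((M *v x) \<bullet> y)"
proof -
  have "x \<bullet> (M *v y) = (x v* M) \<bullet> y" by (simp add: dot_lmul_matrix)
  also have "\<dots> = (transpose M *v x) \<bullet> y" by (simp add: transpose_matrix_vector)
  also have "\<dots> = - ((M *v x) \<bullet> y)"
    unfolding assms by (simp add: matrix_vector_mult_def inner_vec_def sum_negf)
  finally show ?thesis .
qed

text \<open>Integer matrices are carried as real ones, so that rank, norm and column space are those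
  of real linear algebra.\<close>

locale alt_matrix =
  fixes M :: "real ^ 'n ^ 'n" and r :: nat
  assumes skew: "transpose M = - M" and int_entries: "\<And>i. M $ i \<in> int_vec" and rank: "rank M = r"

text \<open>The columns of \<open>M\<close> are integer points and span the column space.\<close>

sublocale alt_matrix \<subseteq> rational_subspace "range ((*v) M)" r
proof
  let ?V = "range ((*v) M)"
  show "subspace ?V" using linear_subspace_image[OF matrix_vector_mul_linear subspace_UNIV] by simp
  show "dim ?V = r" using rank by (simp add: rank_dim_range)
  show "?V \<subseteq> span (?V \<inter> int_vec)"
  proof
    fix y assume "y \<in> ?V"
    then obtain x where x: "y = M *v x" by blast
    have "column l M \<in> ?V \<inter> int_vec" for l
    proof -
      have "column l M = M *v axis l 1" by (simp add: matrix_vector_mult_basis)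
      moreover have "column l M \<in> int_vec" using int_entries by (auto simp: column_def int_vec_def)
      ultimately show ?thesis by auto
    qed
    then have "(\<Sum>l\<in>UNIV. x $ l *\<^sub>R column l M) \<in> span (?V \<inter> int_vec)"
      by (intro span_sum span_scale span_base)
    moreover have "y = (\<Sum>l\<in>UNIV. x $ l *\<^sub>R column l M)"
      unfolding x matrix_mult_sum by (simp add: scalar_mult_eq_scaleR)
    ultimately show "y \<in> span (?V \<inter> int_vec)" by simp
  qed
qed

context alt_matrix
begin

text \<open>The coefficients of \<open>M\<close> with respect to the products
  \<open>v i \<otimes> v j\<close>; see \<open>M_expand\<close>.\<close>

definition c :: "nat \<Rightarrow> nat \<Rightarrow> real" where "c i j = w i \<bullet> (M *v w j)"

lemma c_antisym: "c i j = - c j i"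
  unfolding c_def using skew_inner[OF skew, of "w i" "w j"] by (simp add: inner_commute)

text \<open>Skewness moves \<open>M\<close> onto \<open>w i\<close>, and \<open>M *v w i\<close>
  lies in the column space, where it can be expanded in \<open>v\<close>.\<close>

lemma inner_w_M:
  assumes "i < r" shows "w i \<bullet> (M *v x) = (\<Sum>j<r. c i j *\<^sub>R v j) \<bullet> x"
proof -
  have "M *v w i = (\<Sum>j<r. c j i *\<^sub>R v j)" unfolding c_def by (rule expand) simp
  then have "w i \<bullet> (M *v x) = - ((\<Sum>j<r. c j i *\<^sub>R v j) \<bullet> x)" using skew_inner[OF skew] by simp
  also have "\<dots> = (\<Sum>j<r. c i j *\<^sub>R v j) \<bullet> x"
    using c_antisym[of _ i] by (simp add: inner_sum_left sum_negf)
  finally show ?thesis .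
qed

lemma M_expand: "M *v x = (\<Sum>i<r. (\<Sum>j<r. c i j * (v j \<bullet> x)) *\<^sub>R v i)"
proof -
  have "M *v x = (\<Sum>i<r. (w i \<bullet> (M *v x)) *\<^sub>R v i)" by (rule expand) simp
  also have "\<dots> = (\<Sum>i<r. (\<Sum>j<r. c i j * (v j \<bullet> x)) *\<^sub>R v i)"
    by (intro sum.cong) (auto simp: inner_w_M inner_sum_left)
  finally show ?thesis .
qed

text \<open>Pairing the integer columns of \<open>M\<close> with \<open>w i\<close> gives integers,
  and these are the entries of \<open>?u\<close>. So \<open>?u\<close> is an integer point of the
  column space, and its coordinates \<open>c i j\<close> are integers as well.\<close>

lemma c_Ints:
  assumes i: "i < r" and j: "j < r" shows "c i j \<in> \<int>"
proof -
  let ?u = "\<Sum>j<r. c i j *\<^sub>R v j"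
  have "?u $ l \<in> \<int>" for l
  proof -
    have "M *v axis l 1 \<in> int_vec"
      using int_entries by (auto simp: matrix_vector_mult_basis column_def int_vec_def)
    then have col: "M *v axis l 1 \<in> range ((*v) M) \<inter> int_vec" by blast
    have "?u $ l = ?u \<bullet> axis l 1" by (simp add: inner_axis)
    also have "\<dots> = w i \<bullet> (M *v axis l 1)" using inner_w_M[OF i] by simp
    also have "\<dots> \<in> \<int>" using coeff_Ints[OF col i] .
    finally show ?thesis .
  qed
  moreover have "?u \<in> range ((*v) M)"
    using v_in by (intro subspace_sum[OF subspace] subspace_scale[OF subspace]) auto
  ultimately have "w j \<bullet> ?u \<in> \<int>" using j by (intro coeff_Ints) (auto simp: int_vec_def)
  also have "w j \<bullet> ?u = (\<Sum>k<r. c i k * (if j = k then 1 else 0))"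
    using j by (simp add: inner_sum_right w_dual)
  also have "\<dots> = c i j" using j by (simp add: if_distrib cong: if_cong)
  finally show ?thesis .
qed

lemma c_bound:
  assumes i: "i < r" and j: "j < r"
  shows "\<bar>c i j\<bar> \<le> ((2 ^ r + 1) ^ r)\<^sup>2 * norm M / (a i * a j)"
proof -
  let ?D = "(2 ^ r + 1) ^ r :: real"
  have "\<bar>c i j\<bar> \<le> ?D * norm (M *v w j) / a i" unfolding c_def by (rule coeff_bound[OF i])
  also have "\<dots> \<le> ?D * (norm M * (?D / a j)) / a i"
  proof (intro divide_right_mono mult_left_mono)
    have "norm (M *v w j) \<le> norm M * norm (w j)" by (rule norm_matrix_vector_mult_le)
    also have "\<dots> \<le> norm M * (?D / a j)" by (intro mult_left_mono w_norm j) simp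
    finally show "norm (M *v w j) \<le> norm M * (?D / a j)" .
  qed (use a_pos[OF i] in auto)
  finally show ?thesis by (simp add: power2_eq_square mult_ac)
qed

text \<open>Otherwise the \<open>p + 1\<close> vectors \<open>M *v w j\<close> with
  \<open>j \<ge> r - 1 - p\<close> would lie in the span of the first \<open>p\<close> basis
  vectors, although they are independent.\<close>

lemma c_nonzero_corner:
  assumes p: "p < r"
  shows "\<exists>i j. p \<le> i \<and> i < r \<and> r - 1 - p \<le> j \<and> j < r \<and> c i j \<noteq> 0"
proof (rule ccontr)
  assume neg: "\<not> ?thesis"
  let ?I = "{r - 1 - p..<r}"
  \<comment> \<open>By skewness a preimage \<open>y i\<close> of \<open>- v i\<close> pairs with
    \<open>M *v w j\<close> to \<open>w j \<bullet> v i\<close>, so these preimages witness the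
    independence of the vectors \<open>M *v w j\<close>.\<close>
  have "\<exists>y. M *v y = - v k" if "k < r" for k
  proof -
    have "- v k \<in> range ((*v) M)" using v_in[OF that] subspace_neg[OF subspace] by blast
    then show ?thesis by (metis rangeE)
  qed
  then obtain y where y: "\<And>k. k < r \<Longrightarrow> M *v y k = - v k" by metis
  have d: "y i \<bullet> (M *v w j) = (if i = j then 1 else 0)" if "i \<in> ?I" "j \<in> ?I" for i j
    using that skew_inner[OF skew, of "y i" "w j"] y[of i] w_dual[of j i] by (auto simp: inner_commute)
  let ?X = "(\<lambda>j. M *v w j) ` ?I"
  have inj: "inj_on (\<lambda>j. M *v w j) ?I" and ind: "independent ?X"
    by (rule biorthogonal_independent[OF finite_atLeastLessThan]; erule (1) d)+
  have "?X \<subseteq> span (v ` {..<p})"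
  proof (rule image_subsetI)
    fix j assume j: "j \<in> ?I"
    have "M *v w j = (\<Sum>i<r. c i j *\<^sub>R v i)" unfolding c_def by (rule expand) simp
    also have "\<dots> \<in> span (v ` {..<p})"
    proof (rule span_sum)
      fix i assume i: "i \<in> {..<r}"
      show "c i j *\<^sub>R v i \<in> span (v ` {..<p})"
      proof (cases "i < p")
        case True
        then show ?thesis by (intro span_scale span_base) auto
      next
        case False
        then have "c i j = 0" using neg i j by auto
        then show ?thesis by (simp add: span_zero)
      qed
    qed
    finally show "M *v w j \<in> span (v ` {..<p})" .
  qed
  then have "card ?X \<le> card (v ` {..<p})" using independent_span_bound[OF _ ind, of "v ` {..<p}"] by auto
  also have "\<dots> \<le> p" using card_image_le[of "{..<p}" v] by simp
  also have "card ?X = Suc p" using card_image[OF inj] p by simp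
  finally show False by simp
qed

text \<open>The entry from \<open>c_nonzero_corner\<close> is a nonzero integer, so
  \<open>c_bound\<close> forces \<open>a i * a j\<close> to be of order at most
  \<open>norm M\<close>; almost-monotonicity passes to the smaller indices \<open>p\<close> and
  \<open>r - 1 - p\<close>.\<close>

lemma a_ends:
  assumes p: "p < r"
  shows "a p * a (r - 1 - p) \<le> (2 ^ r)\<^sup>2 * ((2 ^ r + 1) ^ r)\<^sup>2 * norm M"
proof -
  obtain i j where ij: "p \<le> i" "i < r" "r - 1 - p \<le> j" "j < r" "c i j \<noteq> 0"
    using c_nonzero_corner[OF p] by blast
  have "1 \<le> \<bar>c i j\<bar>" using c_Ints[OF ij(2,4)] ij(5) Ints_nonzero_abs_ge1 by blast
  then have "1 \<le> ((2 ^ r + 1) ^ r)\<^sup>2 * norm M / (a i * a j)" using c_bound[OF ij(2,4)] by linarith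
  then have 1: "a i * a j \<le> ((2 ^ r + 1) ^ r)\<^sup>2 * norm M"
    using a_pos[OF ij(2)] a_pos[OF ij(4)] by (simp add: le_divide_eq)
  have "a p * a (r - 1 - p) \<le> (2 ^ r * a i) * (2 ^ r * a j)"
    using ij a_mono a_pos p by (intro mult_mono) (auto simp: less_imp_le)
  also have "\<dots> = (2 ^ r)\<^sup>2 * (a i * a j)" by (simp add: power2_eq_square)
  also have "\<dots> \<le> (2 ^ r)\<^sup>2 * (((2 ^ r + 1) ^ r)\<^sup>2 * norm M)" using 1 by (intro mult_left_mono) auto
  finally show ?thesis by simp
qed

end

text \<open>By \<open>M_expand\<close> a matrix is determined by its basis and \<open>c\<close>;
  antisymmetry supplies the coefficients with \<open>i \<ge> j\<close>.\<close>

lemma alt_matrix_eqI: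
  assumes M: "alt_matrix M r" and M': "alt_matrix M' r"
    and v: "\<And>i. i < r \<Longrightarrow> lattice_basis (range ((*v) M)) i = lattice_basis (range ((*v) M')) i"
    and c: "\<And>i j. i < j \<Longrightarrow> j < r \<Longrightarrow> alt_matrix.c M r i j = alt_matrix.c M' r i j"
  shows "M = M'"
proof -
  interpret A: alt_matrix M r by fact
  interpret B: alt_matrix M' r by fact
  have "A.c i j = B.c i j" if "i < r" "j < r" for i j
  proof (cases i j rule: linorder_cases)
    case less
    then show ?thesis using c that by simp
  next
    case equal
    then show ?thesis using A.c_antisym[of i i] B.c_antisym[of i i] by simp
  next
    case greater
    then show ?thesis using c[of j i] that A.c_antisym[of i j] B.c_antisym[of i j] by simp
  qed
  then have "M *v x = M' *v x" for x
    unfolding A.M_expand[of x] B.M_expand[of x] using v by simp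
  then show ?thesis by (simp add: matrix_eq)
qed

lemma finite_alt_matrix: "finite {M :: real ^ 'n ^ 'n. alt_matrix M r \<and> norm M < T}"
proof -
  let ?F = "{x \<in> (int_vec :: (real ^ 'n) set). norm x \<le> T}"
  have "{M :: real ^ 'n ^ 'n. alt_matrix M r \<and> norm M < T} \<subseteq> {M. \<forall>i. M $ i \<in> ?F}"
  proof
    fix M :: "real ^ 'n ^ 'n" assume "M \<in> {M. alt_matrix M r \<and> norm M < T}"
    then have "M $ i \<in> ?F" for i
      using Finite_Cartesian_Product.norm_nth_le[of M i] unfolding alt_matrix_def by auto
    then show "M \<in> {M. \<forall>i. M $ i \<in> ?F}" by blast
  qed
  then show ?thesis using finite_vec_components[OF finite_int_vec_norm_le] by (rule finite_subset)
qed

subsection \<open>The upper bound\<close>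

lemma card_int_interval_le:
  assumes "0 \<le> (b::real)" shows "real (card {- \<lfloor>b\<rfloor>..\<lfloor>b\<rfloor>}) \<le> 1 + 2 * b"
proof -
  have "0 \<le> \<lfloor>b\<rfloor>" using assms by simp
  then have "real (card {- \<lfloor>b\<rfloor>..\<lfloor>b\<rfloor>}) = 2 * of_int \<lfloor>b\<rfloor> + 1" by simp
  also have "\<dots> \<le> 1 + 2 * b" by simp
  finally show ?thesis .
qed

lemma Ints_floor_in_interval:
  assumes "x \<in> \<int>" "\<bar>x\<bar> \<le> (b::real)" shows "\<lfloor>x\<rfloor> \<in> {- \<lfloor>b\<rfloor>..\<lfloor>b\<rfloor>}"
proof -
  obtain k where k: "x = of_int k" using assms(1) by (auto elim: Ints_cases)
  have "k \<le> \<lfloor>b\<rfloor>" "- k \<le> \<lfloor>b\<rfloor>" using assms(2) by (auto simp: k le_floor_iff)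
  then show ?thesis by (simp add: k)
qed

text \<open>A matrix is encoded by its reduced basis and the integers \<open>c i j\<close> for
  \<open>i < j\<close>. Since \<open>norm M < T = H\<^sup>2\<close> and
  \<open>a i \<ge> H * \<beta> i\<close>, \<open>c_bound\<close> becomes a bound in terms of
  \<open>\<beta>\<close> and \<open>r\<close> alone.\<close>

lemma card_alt_matrix_fibre:
  fixes H T :: real and M0 :: "real ^ 'n ^ 'n"
  defines "\<beta> \<equiv> \<lambda>i. 2 powr real_of_int (gso_exponent H (range ((*v) M0)) i)"
  assumes H: "0 < H" "H\<^sup>2 = T" and M0: "alt_matrix M0 r"
    and fin: "finite (red_seqs (\<lambda>i. H * \<beta> i) r :: (nat \<Rightarrow> real ^ 'n) set)"
  shows "real (card {M :: real ^ 'n ^ 'n. (alt_matrix M r \<and> norm M < T) \<and>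
      (\<forall>j<r. gso_exponent H (range ((*v) M)) j = gso_exponent H (range ((*v) M0)) j)})
    \<le> real (card (red_seqs (\<lambda>i. H * \<beta> i) r :: (nat \<Rightarrow> real ^ 'n) set)) *
      (\<Prod>j<r. \<Prod>i<j. 1 + 2 * ((2 ^ r + 1) ^ r)\<^sup>2 / (\<beta> i * \<beta> j))" (is "real (card ?S) \<le> _")
proof -
  let ?D = "((2 ^ r + 1) ^ r)\<^sup>2 :: real"
  let ?P = "SIGMA j:{..<r}. {..<j}"
  let ?b = "\<lambda>(j, i). ?D / (\<beta> i * \<beta> j)"
  let ?I = "\<lambda>p. {- \<lfloor>?b p\<rfloor>..\<lfloor>?b p\<rfloor>}"
  have \<beta>0: "0 < \<beta> i" for i by (simp add: \<beta>_def)
  have T0: "0 < T" using H by auto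
  define g where "g M = (restrict (lattice_basis (range ((*v) M))) {..<r},
      restrict (\<lambda>(j, i). \<lfloor>alt_matrix.c M r i j\<rfloor>) ?P)" for M :: "real ^ 'n ^ 'n"
  have c: "alt_matrix.c M r i j \<in> \<int>" "\<bar>alt_matrix.c M r i j\<bar> \<le> ?D / (\<beta> i * \<beta> j)"
    if M: "M \<in> ?S" and ij: "i < j" "j < r" for M i j
  proof -
    interpret alt_matrix M r using M by auto
    show "c i j \<in> \<int>" using ij by (intro c_Ints) auto
    have lo: "H * \<beta> k \<le> a k" if "k < r" for k
      using exponent_bounds(1)[OF H(1) that] M that by (simp add: \<beta>_def)
    have "\<bar>c i j\<bar> \<le> ?D * norm M / (a i * a j)" using ij by (intro c_bound) auto
    also have "\<dots> \<le> ?D * T / ((H * \<beta> i) * (H * \<beta> j))"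
      using M lo[of i] lo[of j] ij H(1) T0 \<beta>0 a_pos[of i]
      by (intro frac_le mult_mono mult_left_mono mult_pos_pos) (auto simp: less_imp_le)
    also have "(H * \<beta> i) * (H * \<beta> j) = T * (\<beta> i * \<beta> j)" using H(2) by (simp add: power2_eq_square)
    also have "?D * T / (T * (\<beta> i * \<beta> j)) = ?D / (\<beta> i * \<beta> j)" using H by auto
    finally show "\<bar>c i j\<bar> \<le> ?D / (\<beta> i * \<beta> j)" .
  qed
  have inj: "inj_on g ?S"
  proof (rule inj_onI)
    fix M M' assume M: "M \<in> ?S" "M' \<in> ?S" and eq: "g M = g M'"
    have e1: "restrict (lattice_basis (range ((*v) M))) {..<r} = restrict (lattice_basis (range ((*v) M'))) {..<r}"
      using arg_cong[OF eq, of fst] by (simp only: g_def fst_conv)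
    have e2: "restrict (\<lambda>(j, i). \<lfloor>alt_matrix.c M r i j\<rfloor>) ?P = restrict (\<lambda>(j, i). \<lfloor>alt_matrix.c M' r i j\<rfloor>) ?P"
      using arg_cong[OF eq, of snd] by (simp only: g_def snd_conv)
    show "M = M'"
    proof (rule alt_matrix_eqI[of _ r])
      show "alt_matrix M r" "alt_matrix M' r" using M by auto
      show "lattice_basis (range ((*v) M)) i = lattice_basis (range ((*v) M')) i" if "i < r" for i
        using fun_cong[OF e1, of i] that by simp
      show "alt_matrix.c M r i j = alt_matrix.c M' r i j" if "i < j" "j < r" for i j
        using fun_cong[OF e2, of "(j, i)"] that c(1)[OF M(1) that] c(1)[OF M(2) that] by (auto elim!: Ints_cases)
    qed
  qed
  have sub: "g ` ?S \<subseteq> red_seqs (\<lambda>i. H * \<beta> i) r \<times> PiE ?P ?I"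
  proof (rule image_subsetI)
    fix M assume M: "M \<in> ?S"
    interpret alt_matrix M r using M by auto
    have "restrict v {..<r} \<in> red_seqs (\<lambda>i. H * \<beta> i) r"
      using M by (intro basis_in_red_seqs[OF H(1)]) (simp add: \<beta>_def)
    moreover have "\<lfloor>alt_matrix.c M r i j\<rfloor> \<in> ?I (j, i)" if "(j, i) \<in> ?P" for i j
      unfolding case_prod_conv using that by (intro Ints_floor_in_interval c M) auto
    then have "restrict (\<lambda>(j, i). \<lfloor>alt_matrix.c M r i j\<rfloor>) ?P \<in> PiE ?P ?I"
      unfolding restrict_PiE_iff by force
    ultimately show "g M \<in> red_seqs (\<lambda>i. H * \<beta> i) r \<times> PiE ?P ?I" unfolding g_def by blast
  qed
  have finI: "finite (PiE ?P ?I)" by (intro finite_PiE) auto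
  have "card ?S = card (g ` ?S)" using card_image[OF inj] by simp
  also have "\<dots> \<le> card ((red_seqs (\<lambda>i. H * \<beta> i) r :: (nat \<Rightarrow> real ^ 'n) set) \<times> PiE ?P ?I)"
    by (rule card_mono[OF finite_cartesian_product[OF fin finI] sub])
  also have "\<dots> = card (red_seqs (\<lambda>i. H * \<beta> i) r :: (nat \<Rightarrow> real ^ 'n) set) * card (PiE ?P ?I)"
    by (rule card_cartesian_product)
  finally have "real (card ?S) \<le> real (card (red_seqs (\<lambda>i. H * \<beta> i) r :: (nat \<Rightarrow> real ^ 'n) set)) * real (card (PiE ?P ?I))"
    unfolding of_nat_mult[symmetric] of_nat_le_iff .
  also have "real (card (PiE ?P ?I)) \<le> (\<Prod>j<r. \<Prod>i<j. 1 + 2 * ?D / (\<beta> i * \<beta> j))"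
  proof -
    have "card (PiE ?P ?I) = (\<Prod>p\<in>?P. card (?I p))" by (rule card_PiE) auto
    then have "real (card (PiE ?P ?I)) = (\<Prod>p\<in>?P. real (card (?I p)))" by simp
    also have "\<dots> \<le> (\<Prod>p\<in>?P. 1 + 2 * ?b p)"
    proof (intro prod_mono conjI)
      fix p assume "p \<in> ?P"
      have "0 \<le> ?b p" using \<beta>0 by (auto simp: less_imp_le split: prod.split)
      then show "real (card (?I p)) \<le> 1 + 2 * ?b p" by (rule card_int_interval_le)
    qed auto
    also have "\<dots> = (\<Prod>(j, i)\<in>?P. 1 + 2 * ?D / (\<beta> i * \<beta> j))"
      by (intro prod.cong) auto
    also have "\<dots> = (\<Prod>j<r. \<Prod>i<j. 1 + 2 * ?D / (\<beta> i * \<beta> j))"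
      by (rule prod.Sigma[symmetric]) auto
    finally show ?thesis .
  qed
  finally show ?thesis by (simp add: mult_left_mono)
qed

text \<open>Matrices are sorted by the dyadic sizes of their Gram--Schmidt norms relative to
  \<open>sqrt T\<close>. Each class has at most as many elements as there are reduced bases times
  coefficient choices, and \<open>dyadic_weight_le\<close> turns this into summable weights.\<close>

lemma card_alt_matrix_le:
  assumes r: "even r" "r < CARD('n)"
  shows "\<exists>C>0. \<forall>T>0. real (card {M :: real ^ 'n ^ 'n. alt_matrix M r \<and> norm M < T})
     \<le> C * sqrt T ^ (CARD('n) * r)"
proof -
  let ?n = "CARD('n)"
  let ?D = "((2 ^ r + 1) ^ r)\<^sup>2 :: real"
  obtain s where s: "r = 2 * s" using r(1) by blast
  obtain K where K: "K > 0" and cnt: "\<And>H \<beta>. H > 0 \<Longrightarrow> (\<forall>i<r. 1 / 2 ^ Suc r \<le> H * \<beta> i) \<Longrightarrow>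
     finite (red_seqs (\<lambda>i. H * \<beta> i) r :: (nat \<Rightarrow> real ^ 'n) set) \<and>
     real (card (red_seqs (\<lambda>i. H * \<beta> i) r :: (nat \<Rightarrow> real ^ 'n) set))
       \<le> (K * H ^ ?n) ^ r * (\<Prod>j<r. (\<Prod>l<j. \<beta> l) * \<beta> j ^ (?n - j))"
    using card_red_seqs_scaled[where 'n = 'n, of r] r(2) by (meson less_imp_le)
  obtain Z where Z: "Z > 0" and dy: "\<And>(S :: (real ^ 'n ^ 'n) set) k B. finite S \<Longrightarrow> 0 \<le> B \<Longrightarrow>
     (\<forall>A0\<in>S. real (card {A\<in>S. \<forall>j<r. k A j = k A0 j}) \<le> B * (\<Prod>j<r. dyad_wt (k A0 j))) \<Longrightarrow>
     real (card S) \<le> B * Z"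
    using card_le_dyadic[where 'a = "real ^ 'n ^ 'n", of r] by blast
  \<comment> \<open>Large enough for two hypotheses of \<open>dyadic_weight_le\<close>: the first
    term serves \<open>mono\<close>, the second \<open>ends\<close>.\<close>
  define C where "C = 2 ^ Suc r + (2 ^ r)\<^sup>2 * ?D"
  have "1 \<le> (2::real) ^ Suc r" by (rule one_le_power) simp
  moreover have "0 \<le> (2 ^ r)\<^sup>2 * ?D" by (intro mult_nonneg_nonneg zero_le_power2)
  ultimately have C: "1 \<le> C" unfolding C_def by linarith
  define W where "W = ((C * C + 2 * ?D * C) ^ (r - 1) * C ^ ?n * C ^ 4) ^ s"
  have W: "0 < W" unfolding W_def using C by (intro zero_less_power mult_pos_pos add_pos_nonneg) auto
  have "real (card {M :: real ^ 'n ^ 'n. alt_matrix M r \<and> norm M < T}) \<le> (K ^ r * W * Z) * sqrt T ^ (?n * r)"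
    if T: "T > 0" for T
  proof -
    define H where "H = sqrt T"
    have H: "0 < H" "H\<^sup>2 = T" using T by (auto simp: H_def)
    let ?S = "{M :: real ^ 'n ^ 'n. alt_matrix M r \<and> norm M < T}"
    let ?k = "\<lambda>M :: real ^ 'n ^ 'n. gso_exponent H (range ((*v) M))"
    have "real (card ?S) \<le> ((K * H ^ ?n) ^ r * W) * Z"
    proof (rule dy[of _ _ ?k])
      show "finite ?S" by (rule finite_alt_matrix)
      show "0 \<le> (K * H ^ ?n) ^ r * W" using K H W by simp
      show "\<forall>M0\<in>?S. real (card {M\<in>?S. \<forall>j<r. ?k M j = ?k M0 j})
         \<le> (K * H ^ ?n) ^ r * W * (\<Prod>j<r. dyad_wt (?k M0 j))"
      proof
        fix M0 assume M0: "M0 \<in> ?S"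
        interpret alt_matrix M0 r using M0 by auto
        define \<beta> where "\<beta> i = 2 powr real_of_int (?k M0 i)" for i
        have \<beta>0: "0 < \<beta> i" for i by (simp add: \<beta>_def)
        have lo: "H * \<beta> k \<le> a k" if "k < r" for k
          using exponent_bounds(1)[OF H(1) that] by (simp add: \<beta>_def)
        have "\<forall>i<r. 1 / 2 ^ Suc r \<le> H * \<beta> i" unfolding \<beta>_def using scale_lower[OF H(1)] by blast
        note cnt' = cnt[OF H(1) this]
        have mono: "\<beta> i \<le> C * \<beta> j" if "i \<le> j" "j < r" for i j
        proof -
          have "\<beta> i \<le> 2 ^ Suc r * \<beta> j" unfolding \<beta>_def by (rule scale_mono[OF H(1) that])
          also have "\<dots> \<le> C * \<beta> j" using \<beta>0[of j] by (intro mult_right_mono) (auto simp: C_def)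
          finally show ?thesis .
        qed
        have ends: "\<beta> p * \<beta> (r - 1 - p) \<le> C" if "p < s" for p
        proof -
          have p: "p < r" "r - 1 - p < r" using that s by auto
          have "T * (\<beta> p * \<beta> (r - 1 - p)) = (H * \<beta> p) * (H * \<beta> (r - 1 - p))"
            using H(2) by (simp add: power2_eq_square)
          also have "\<dots> \<le> a p * a (r - 1 - p)"
            using lo p H(1) \<beta>0 a_pos by (intro mult_mono) (auto simp: less_imp_le)
          also have "\<dots> \<le> (2 ^ r)\<^sup>2 * ?D * norm M0" by (rule a_ends[OF p(1)])
          also have "\<dots> \<le> (2 ^ r)\<^sup>2 * ?D * T" using M0 by (intro mult_left_mono) auto
          finally have "T * (\<beta> p * \<beta> (r - 1 - p)) \<le> T * ((2 ^ r)\<^sup>2 * ?D)" by (simp only: mult_ac)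
          then have "\<beta> p * \<beta> (r - 1 - p) \<le> (2 ^ r)\<^sup>2 * ?D" using T by (simp only: mult_le_cancel_left_pos)
          moreover have "0 \<le> (2::real) ^ Suc r" by simp
          ultimately show ?thesis unfolding C_def by linarith
        qed
        have set_eq: "{M\<in>?S. \<forall>j<r. ?k M j = ?k M0 j} = {M :: real ^ 'n ^ 'n. (alt_matrix M r \<and> norm M < T) \<and>
            (\<forall>j<r. ?k M j = ?k M0 j)}" by blast
        have fin': "finite (red_seqs (\<lambda>i. H * 2 powr real_of_int (?k M0 i)) r :: (nat \<Rightarrow> real ^ 'n) set)"
          using cnt' by (simp add: \<beta>_def)
        have "real (card {M\<in>?S. \<forall>j<r. ?k M j = ?k M0 j})
            \<le> real (card (red_seqs (\<lambda>i. H * \<beta> i) r :: (nat \<Rightarrow> real ^ 'n) set)) *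
              (\<Prod>j<r. \<Prod>i<j. 1 + 2 * ?D / (\<beta> i * \<beta> j))"
          unfolding set_eq \<beta>_def by (rule card_alt_matrix_fibre[OF H alt_matrix_axioms fin'])
        also have "\<dots> \<le> ((K * H ^ ?n) ^ r * (\<Prod>j<r. (\<Prod>l<j. \<beta> l) * \<beta> j ^ (?n - j))) *
              (\<Prod>j<r. \<Prod>i<j. 1 + 2 * ?D / (\<beta> i * \<beta> j))"
          using cnt' \<beta>0 by (intro mult_right_mono prod_nonneg) (auto simp: less_imp_le)
        also have "\<dots> = (K * H ^ ?n) ^ r * (\<Prod>j<r. (\<Prod>l<j. \<beta> l) * \<beta> j ^ (?n - j) * (\<Prod>i<j. 1 + 2 * ?D / (\<beta> i * \<beta> j)))"
          by (simp only: prod.distrib mult.assoc)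
        also have "\<dots> \<le> (K * H ^ ?n) ^ r * (W * (\<Prod>j<r. dyad_wt (?k M0 j)))"
          unfolding W_def
          by (intro mult_left_mono dyadic_weight_le s r(2) C mono ends) (use K H in \<open>auto simp: \<beta>_def\<close>)
        finally show "real (card {M\<in>?S. \<forall>j<r. ?k M j = ?k M0 j})
         \<le> (K * H ^ ?n) ^ r * W * (\<Prod>j<r. dyad_wt (?k M0 j))" by (simp only: mult.assoc)
      qed
    qed
    also have "\<dots> = (K ^ r * W * Z) * sqrt T ^ (?n * r)"
      by (simp add: H_def power_mult_distrib power_mult)
    finally show ?thesis .
  qed
  moreover have "0 < K ^ r * W * Z" using K W Z by simp
  ultimately show ?thesis by blast
qed

subsection \<open>Frames of integer vectors\<close>

text \<open>Independence is stated for the indexed family, which excludes repetitions;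
  \<open>extensional\<close> makes equality of frames depend on the \<open>b i\<close> with
  \<open>i < r\<close> only.\<close>

locale int_frame =
  fixes b :: "nat \<Rightarrow> real ^ 'n" and r :: nat
  assumes ext: "b \<in> extensional {..<r}" and int: "\<And>i. i < r \<Longrightarrow> b i \<in> int_vec"
    and indep: "\<And>g i. (\<Sum>i<r. g i *\<^sub>R b i) = 0 \<Longrightarrow> i < r \<Longrightarrow> g i = 0"
begin

lemma b_inj: "inj_on b {..<r}"
proof (rule inj_onI)
  fix i j assume i: "i \<in> {..<r}" and j: "j \<in> {..<r}" and e: "b i = b j"
  show "i = j"
  proof (rule ccontr)
    assume ne: "i \<noteq> j"
    let ?g = "\<lambda>k. if k = i then 1 else if k = j then - 1 else 0 :: real"
    have "(\<Sum>k<r. ?g k *\<^sub>R b k) = (\<Sum>k\<in>{i, j}. ?g k *\<^sub>R b k)"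
      using i j by (intro sum.mono_neutral_right) auto
    also have "\<dots> = 0" using ne e by simp
    finally show False using indep[of ?g i] i by simp
  qed
qed

lemma b_independent: "independent (b ` {..<r})"
proof (rule independent_if_scalars_zero)
  fix f z assume "(\<Sum>z\<in>b ` {..<r}. f z *\<^sub>R z) = 0" and z: "z \<in> b ` {..<r}"
  then have "(\<Sum>i<r. f (b i) *\<^sub>R b i) = 0" by (simp add: sum.reindex[OF b_inj])
  then show "f z = 0" using indep[of "\<lambda>i. f (b i)"] z by auto
qed simp

end

text \<open>The lattice in question consists of all integer points of the span and may be larger
  than the one generated by \<open>b\<close>.\<close>

sublocale int_frame \<subseteq> rational_subspace "span (b ` {..<r})" r
proof
  show "dim (span (b ` {..<r})) = r"
    using b_independent card_image[OF b_inj] by (simp add: dim_eq_card_independent)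
  have "b ` {..<r} \<subseteq> span (b ` {..<r}) \<inter> int_vec" using int by (auto intro: span_base)
  then show "span (b ` {..<r}) \<subseteq> span (span (b ` {..<r}) \<inter> int_vec)" by (rule span_mono)
qed simp

context int_frame
begin

definition m :: "nat \<Rightarrow> nat \<Rightarrow> real" where "m l i = w i \<bullet> b l"

lemma b_in: "l < r \<Longrightarrow> b l \<in> span (b ` {..<r}) \<inter> int_vec"
  using int by (auto intro: span_base)

lemma b_expand: "l < r \<Longrightarrow> b l = (\<Sum>i<r. m l i *\<^sub>R v i)"
  unfolding m_def using b_in by (intro expand) auto

lemma m_Ints: "l < r \<Longrightarrow> i < r \<Longrightarrow> m l i \<in> \<int>"
  unfolding m_def using b_in by (intro coeff_Ints) auto

lemma m_bound:
  assumes "i < r" "norm (b l) \<le> H" "0 < e" "e \<le> a i"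
  shows "\<bar>m l i\<bar> \<le> (2 ^ r + 1) ^ r * H / e"
proof -
  have "\<bar>m l i\<bar> \<le> (2 ^ r + 1) ^ r * norm (b l) / a i" unfolding m_def by (rule coeff_bound[OF assms(1)])
  also have "\<dots> \<le> (2 ^ r + 1) ^ r * H / e"
    using assms order_trans[OF norm_ge_zero assms(2)] by (intro frac_le mult_left_mono mult_nonneg_nonneg) auto
  finally show ?thesis .
qed

text \<open>Some \<open>b l\<close> must involve the last basis vector, since the \<open>b l\<close>
  span it. The coefficient is a nonzero integer, so \<open>m_bound\<close> settles
  \<open>i = r - 1\<close>, and almost-monotonicity the rest.\<close>

lemma a_le:
  assumes H: "\<And>l. l < r \<Longrightarrow> norm (b l) \<le> H" and i: "i < r"
  shows "a i \<le> 2 ^ r * (2 ^ r + 1) ^ r * H"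
proof -
  let ?t = "r - 1"
  have t: "?t < r" using i by simp
  have "\<exists>l<r. w ?t \<bullet> b l \<noteq> 0"
  proof (rule ccontr)
    assume neg: "\<not> ?thesis"
    have "v ?t \<in> span (b ` {..<r})" using v_in[OF t] by blast
    then have "orthogonal (w ?t) (v ?t)"
      by (rule orthogonal_to_span) (use neg in \<open>auto simp: orthogonal_def\<close>)
    then show False using w_dual[OF t t] by (simp add: orthogonal_def)
  qed
  then obtain l where l: "l < r" "m l ?t \<noteq> 0" unfolding m_def by blast
  have "1 \<le> \<bar>m l ?t\<bar>" using m_Ints[OF l(1) t] l(2) Ints_nonzero_abs_ge1 by blast
  also have "\<dots> \<le> (2 ^ r + 1) ^ r * H / a ?t" using m_bound[OF t H[OF l(1)] a_pos[OF t]] by simp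
  finally have "a ?t \<le> (2 ^ r + 1) ^ r * H" using a_pos[OF t] by (simp add: le_divide_eq)
  then have "2 ^ r * a ?t \<le> 2 ^ r * ((2 ^ r + 1) ^ r * H)" by (intro mult_left_mono) auto
  moreover have "a i \<le> 2 ^ r * a ?t" using i by (intro a_mono) auto
  ultimately show ?thesis by (simp only: mult.assoc)
qed

end

lemma int_frame_eqI:
  assumes b: "int_frame b r" and b': "int_frame b' r"
    and v: "\<And>i. i < r \<Longrightarrow> lattice_basis (span (b ` {..<r})) i = lattice_basis (span (b' ` {..<r})) i"
    and m: "\<And>l i. l < r \<Longrightarrow> i < r \<Longrightarrow> \<lfloor>int_frame.m b r l i\<rfloor> = \<lfloor>int_frame.m b' r l i\<rfloor>"
  shows "b = b'"
proof (rule extensionalityI)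
  interpret A: int_frame b r by fact
  interpret B: int_frame b' r by fact
  show "b \<in> extensional {..<r}" "b' \<in> extensional {..<r}" using A.ext B.ext by auto
  fix l assume "l \<in> {..<r}"
  then have l: "l < r" by simp
  have "A.m l i = B.m l i" if "i < r" for i
    using m[OF l that] A.m_Ints[OF l that] B.m_Ints[OF l that] by (auto elim!: Ints_cases)
  then show "b l = b' l" using A.b_expand[OF l] B.b_expand[OF l] v by simp
qed

section \<open>Alternating matrices built from frames\<close>

definition wedge_sum :: "nat \<Rightarrow> (nat \<Rightarrow> real ^ 'n) \<Rightarrow> real ^ 'n ^ 'n" where
  "wedge_sum s b = (\<chi> i j. \<Sum>p<s. b p $ i * b (s + p) $ j - b (s + p) $ i * b p $ j)"

text \<open>As a bivector \<open>wedge_sum s b\<close> is the sum of the wedge products of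
  \<open>b p\<close> and \<open>b (s + p)\<close>; from its action on vectors the column space and
  the kernel are read off.\<close>

lemma wedge_sum_mult:
  "wedge_sum s b *v x = (\<Sum>p<s. (b (s + p) \<bullet> x) *\<^sub>R b p - (b p \<bullet> x) *\<^sub>R b (s + p))"
proof (subst vec_eq_iff, rule allI)
  fix i
  have "(wedge_sum s b *v x) $ i = (\<Sum>j\<in>UNIV. \<Sum>p<s. (b p $ i * b (s + p) $ j - b (s + p) $ i * b p $ j) * x $ j)"
    by (simp add: wedge_sum_def matrix_vector_mult_def sum_distrib_right)
  also have "\<dots> = (\<Sum>p<s. \<Sum>j\<in>UNIV. (b p $ i * b (s + p) $ j - b (s + p) $ i * b p $ j) * x $ j)"
    by (rule sum.swap)
  also have "\<dots> = (\<Sum>p<s. (b (s + p) \<bullet> x) * b p $ i - (b p \<bullet> x) * b (s + p) $ i)"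
    by (intro sum.cong) (auto simp: inner_vec_def sum_distrib_left sum_distrib_right sum_subtractf algebra_simps)
  finally show "(wedge_sum s b *v x) $ i = (\<Sum>p<s. (b (s + p) \<bullet> x) *\<^sub>R b p - (b p \<bullet> x) *\<^sub>R b (s + p)) $ i"
    by simp
qed

lemma wedge_sum_skew: "transpose (wedge_sum s b) = - wedge_sum s b"
  by (simp add: vec_eq_iff transpose_def wedge_sum_def sum_negf[symmetric] mult.commute)

lemma sum_split_halves:
  fixes f :: "nat \<Rightarrow> 'a::comm_monoid_add"
  shows "(\<Sum>i<2 * s. f i) = (\<Sum>p<s. f p) + (\<Sum>p<s. f (s + p))"
proof -
  have "{..<2 * s} = {..<s} \<union> {s..<2 * s}" by auto
  then have "(\<Sum>i<2 * s. f i) = (\<Sum>p<s. f p) + (\<Sum>p\<in>{s..<2 * s}. f p)"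
    by (metis finite_lessThan finite_atLeastLessThan ivl_disj_int_one(2) sum.union_disjoint)
  also have "(\<Sum>p\<in>{s..<2 * s}. f p) = (\<Sum>p<s. f (s + p))"
    by (rule sum.reindex_bij_witness[of _ "\<lambda>p. s + p" "\<lambda>p. p - s"]) auto
  finally show ?thesis .
qed

text \<open>For the harder inclusion split off from \<open>y\<close> the part \<open>z\<close>
  orthogonal to the range. By skewness \<open>z\<close> lies in the kernel, and independence of the
  \<open>b i\<close> makes the kernel orthogonal to all of them; so \<open>z\<close> is orthogonal
  to \<open>y\<close> and hence zero.\<close>

lemma wedge_sum_range:
  assumes b: "int_frame b r" and r: "r = 2 * s"
  shows "range ((*v) (wedge_sum s b)) = span (b ` {..<r})"
proof
  interpret int_frame b r by fact
  let ?M = "wedge_sum s b" and ?V = "span (b ` {..<r})"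
  have bV: "b i \<in> ?V" if "i < r" for i using that by (auto intro: span_base)
  show "range ((*v) ?M) \<subseteq> ?V"
  proof (rule image_subsetI)
    fix x
    have "p < r" "s + p < r" if "p \<in> {..<s}" for p using that r by auto
    then show "?M *v x \<in> ?V"
      unfolding wedge_sum_mult by (intro span_sum span_diff span_scale bV)
  qed
  have sub: "Real_Vector_Spaces.subspace (range ((*v) ?M))"
    using linear_subspace_image[OF matrix_vector_mul_linear subspace_UNIV] by simp
  have ker: "b i \<bullet> z = 0" if z: "?M *v z = 0" and i: "i < r" for z i
  proof -
    \<comment> \<open>These are the coefficients of \<open>?M *v z\<close> with respect to
      \<open>b\<close>, so independence forces them to vanish.\<close>
    define g where "g i = (if i < s then b (s + i) \<bullet> z else - (b (i - s) \<bullet> z))" for i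
    have "(\<Sum>i<r. g i *\<^sub>R b i) = (\<Sum>p<s. (b (s + p) \<bullet> z) *\<^sub>R b p) + (\<Sum>p<s. - ((b p \<bullet> z) *\<^sub>R b (s + p)))"
      unfolding r sum_split_halves by (simp add: g_def)
    also have "\<dots> = ?M *v z" by (simp add: wedge_sum_mult sum_subtractf sum_negf)
    finally have g0: "\<And>i. i < r \<Longrightarrow> g i = 0" using z indep by auto
    show ?thesis
    proof (cases "i < s")
      case True
      then show ?thesis using g0[of "s + i"] r by (simp add: g_def)
    next
      case False
      then have "g (i - s) = b i \<bullet> z" "i - s < r" using i r by (auto simp: g_def)
      then show ?thesis using g0 by metis
    qed
  qed
  show "?V \<subseteq> range ((*v) ?M)"
  proof
    fix y assume y: "y \<in> ?V"
    obtain y1 z where yz: "y1 \<in> span (range ((*v) ?M))" "\<And>x. x \<in> span (range ((*v) ?M)) \<Longrightarrow> orthogonal z x" "y = y1 + z"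
      by (rule orthogonal_subspace_decomp_exists[of "range ((*v) ?M)" y]) blast
    have sp: "span (range ((*v) ?M)) = range ((*v) ?M)" using sub by (simp add: span_eq_iff)
    have "z \<bullet> (?M *v x) = 0" for x using yz(2)[of "?M *v x"] by (simp add: sp orthogonal_def)
    then have "(?M *v z) \<bullet> x = 0" for x using skew_inner[OF wedge_sum_skew, of z s b x] by simp
    then have "?M *v z = 0" by (metis inner_eq_zero_iff)
    then have "z \<bullet> b i = 0" if "i < r" for i using ker that by (simp add: inner_commute)
    then have "orthogonal z y" by (intro orthogonal_to_span[OF y]) (auto simp: orthogonal_def)
    moreover have "orthogonal z y1" using yz by blast
    ultimately have "z \<bullet> z = 0" unfolding orthogonal_def yz(3) by (simp add: inner_add_right)
    then show "y \<in> range ((*v) ?M)" using yz(1,3) sp by simp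
  qed
qed

lemma alt_matrix_wedge_sum:
  assumes b: "int_frame b r" and r: "r = 2 * s"
  shows "alt_matrix (wedge_sum s b) r"
proof
  interpret int_frame b r by fact
  show "transpose (wedge_sum s b) = - wedge_sum s b" by (rule wedge_sum_skew)
  show "rank (wedge_sum s b) = r" using wedge_sum_range[OF b r] dim by (simp add: rank_dim_range)
  have "b p $ i \<in> \<int>" if "p < r" for p i using int[OF that] by (simp add: int_vec_def)
  then show "wedge_sum s b $ i \<in> int_vec" for i
    unfolding int_vec_def wedge_sum_def using r by (auto intro!: Ints_sum Ints_diff Ints_mult)
qed

lemma norm_wedge_sum_le:
  fixes b :: "nat \<Rightarrow> real ^ 'n"
  assumes "\<And>i. i < 2 * s \<Longrightarrow> norm (b i) \<le> H"
  shows "norm (wedge_sum s b) \<le> (real CARD('n))\<^sup>2 * real (2 * s) * H\<^sup>2"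
proof -
  have c: "\<bar>b p $ i\<bar> \<le> H" if "p < 2 * s" for p i
    using component_le_norm_cart[of "b p" i] assms[OF that] by linarith
  have prod_le: "\<bar>b p $ i * b q $ j\<bar> \<le> H * H" if "p < 2 * s" "q < 2 * s" for p q i j
    unfolding abs_mult using c[OF that(1), of i] c[OF that(2), of j] by (intro mult_mono) auto
  have e: "\<bar>wedge_sum s b $ i $ j\<bar> \<le> real (2 * s) * H\<^sup>2" for i j
  proof -
    have "\<bar>wedge_sum s b $ i $ j\<bar> \<le> (\<Sum>p<s. \<bar>b p $ i * b (s + p) $ j - b (s + p) $ i * b p $ j\<bar>)"
      by (simp add: wedge_sum_def sum_abs)
    also have "\<dots> \<le> (\<Sum>p<s. 2 * H\<^sup>2)"
    proof (rule sum_mono)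
      fix p assume "p \<in> {..<s}"
      then have "\<bar>b p $ i * b (s + p) $ j\<bar> \<le> H * H" "\<bar>b (s + p) $ i * b p $ j\<bar> \<le> H * H"
        by (auto intro!: prod_le)
      then show "\<bar>b p $ i * b (s + p) $ j - b (s + p) $ i * b p $ j\<bar> \<le> 2 * H\<^sup>2"
        unfolding power2_eq_square by linarith
    qed
    finally show ?thesis by simp
  qed
  have "norm (wedge_sum s b) \<le> (\<Sum>i\<in>UNIV. norm (wedge_sum s b $ i))"
    unfolding norm_vec_def[of "wedge_sum s b"] by (intro L2_set_le_sum) auto
  also have "\<dots> \<le> (\<Sum>i\<in>UNIV. \<Sum>j\<in>UNIV. \<bar>wedge_sum s b $ i $ j\<bar>)"
    by (intro sum_mono norm_le_l1_cart)
  also have "\<dots> \<le> (\<Sum>i\<in>(UNIV :: 'n set). \<Sum>j\<in>(UNIV :: 'n set). real (2 * s) * H\<^sup>2)"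
    by (intro sum_mono e)
  finally show ?thesis by (simp add: power2_eq_square)
qed

subsection \<open>Skewed frames are rare\<close>

text \<open>The offset \<open>2nN\<close> makes tuples of such vectors along distinct axes diagonally dominant, hence
  independent.\<close>

definition near_axis :: "'n::finite \<Rightarrow> nat \<Rightarrow> (real ^ 'n) set" where
  "near_axis k N = {x \<in> int_vec. \<forall>l. \<bar>x $ l - (if l = k then 2 * real CARD('n) * real N else 0)\<bar> \<le> real N}"

lemma near_axisD:
  fixes x :: "real ^ 'n"
  assumes "x \<in> near_axis k N"
  shows "\<bar>x $ l - (if l = k then 2 * real CARD('n) * real N else 0)\<bar> \<le> real N"
  using assms unfolding near_axis_def by blast

lemma near_axis_norm:
  fixes x :: "real ^ 'n"
  assumes "x \<in> near_axis k N" shows "norm x \<le> 3 * (real CARD('n))\<^sup>2 * real N"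
proof -
  have n1: "1 \<le> real CARD('n)" by (simp add: Suc_leI)
  have "\<bar>x $ l\<bar> \<le> 3 * real CARD('n) * real N" for l
  proof -
    have "\<bar>x $ l - (if l = k then 2 * real CARD('n) * real N else 0)\<bar> \<le> real N"
      using assms by (rule near_axisD)
    moreover have "0 \<le> real CARD('n) * real N" by simp
    moreover have "real N \<le> real CARD('n) * real N" using mult_right_mono[OF n1, of "real N"] by simp
    ultimately show ?thesis by (auto split: if_splits)
  qed
  then have "(\<Sum>l\<in>UNIV. \<bar>x $ l\<bar>) \<le> (\<Sum>l\<in>(UNIV :: 'n set). 3 * real CARD('n) * real N)" by (intro sum_mono)
  then show ?thesis using norm_le_l1_cart[of x] by (simp add: power2_eq_square algebra_simps)
qed

lemma finite_near_axis: "finite (near_axis k N)"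
  by (rule finite_subset[OF _ finite_int_vec_norm_le[of "3 * (real CARD('a))\<^sup>2 * real N"]])
    (auto simp: near_axis_norm, simp add: near_axis_def)

text \<open>Adding vectors with entries from 1 to \<open>N\<close> to the integral offset gives
  \<open>N ^ n\<close> distinct points.\<close>

lemma card_near_axis: "N ^ CARD('n) \<le> card (near_axis (k :: 'n::finite) N)"
proof -
  let ?o = "\<lambda>l. if l = k then 2 * real CARD('n) * real N else 0"
  let ?P = "PiE (UNIV :: 'n set) (\<lambda>_. {1..int N})"
  let ?f = "\<lambda>f :: 'n \<Rightarrow> int. (\<chi> l. ?o l + of_int (f l)) :: real ^ 'n"
  have inj: "inj_on ?f ?P" by (auto simp: inj_on_def vec_eq_iff)
  have sub: "?f ` ?P \<subseteq> near_axis k N"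
  proof (rule image_subsetI)
    fix f assume f: "f \<in> ?P"
    have "1 \<le> f l" "f l \<le> int N" for l using f by (auto simp: PiE_iff)
    then have "\<bar>real_of_int (f l)\<bar> \<le> real N" for l
      by (metis abs_of_nonneg dual_order.trans of_int_0_le_iff of_int_le_iff of_int_of_nat_eq zero_le_one)
    moreover have "?o l \<in> \<int>" for l by (auto intro!: Ints_mult)
    ultimately show "?f f \<in> near_axis k N" by (auto simp: near_axis_def int_vec_def)
  qed
  have "N ^ CARD('n) = card ?P" by (simp add: card_PiE)
  also have "\<dots> = card (?f ` ?P)" using card_image[OF inj] by simp
  also have "\<dots> \<le> card (near_axis k N)" by (rule card_mono[OF finite_near_axis sub])
  finally show ?thesis .
qed

text \<open>In a linear relation take \<open>t\<close> with \<open>\<bar>g t\<bar>\<close> maximal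
  and look at coordinate \<open>\<iota> t\<close>. The entry of \<open>b t\<close> there is at least
  \<open>(2 n - 1) N\<close>, while the other \<open>r - 1\<close> vectors together contribute at
  most \<open>(r - 1) N\<close> times \<open>\<bar>g t\<bar>\<close>.\<close>

lemma int_frame_near_axis:
  fixes \<iota> :: "nat \<Rightarrow> 'n::finite"
  assumes inj: "inj_on \<iota> {..<r}" and r: "r < CARD('n)" and N: "0 < N"
    and b: "b \<in> PiE {..<r} (\<lambda>i. near_axis (\<iota> i) N)"
  shows "int_frame b r"
proof
  show "b \<in> extensional {..<r}" using b unfolding PiE_def by blast
  have bi: "b i \<in> near_axis (\<iota> i) N" if "i < r" for i using PiE_mem[OF b] that by simp
  then show "b i \<in> int_vec" if "i < r" for i using that unfolding near_axis_def by blast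
  fix g i assume s: "(\<Sum>i<r. g i *\<^sub>R b i) = 0" and i: "i < r"
  have "finite ((\<lambda>i. \<bar>g i\<bar>) ` {..<r})" "(\<lambda>i. \<bar>g i\<bar>) ` {..<r} \<noteq> {}" using i by auto
  from Max_in[OF this] obtain t where t: "t < r" "\<bar>g t\<bar> = Max ((\<lambda>i. \<bar>g i\<bar>) ` {..<r})" by auto
  have le: "\<bar>g j\<bar> \<le> \<bar>g t\<bar>" if "j < r" for j unfolding t(2) using that by (intro Max_ge) auto
  have "\<bar>b t $ \<iota> t - 2 * real CARD('n) * real N\<bar> \<le> real N"
    using near_axisD[OF bi[OF t(1)], of "\<iota> t"] by simp
  then have bt: "(2 * real CARD('n) - 1) * real N \<le> \<bar>b t $ \<iota> t\<bar>" by (simp add: algebra_simps)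
  have bo: "\<bar>b j $ \<iota> t\<bar> \<le> real N" if "j < r" "j \<noteq> t" for j
  proof -
    have "\<iota> t \<noteq> \<iota> j" using inj_onD[OF inj, of t j] t(1) that by auto
    then show ?thesis using near_axisD[OF bi[OF that(1)], of "\<iota> t"] by simp
  qed
  have "(\<Sum>j<r. g j * b j $ \<iota> t) = 0" using arg_cong[OF s, of "\<lambda>x. x $ \<iota> t"] by simp
  also have "(\<Sum>j<r. g j * b j $ \<iota> t) = g t * b t $ \<iota> t + (\<Sum>j\<in>{..<r} - {t}. g j * b j $ \<iota> t)"
    using t(1) by (intro sum.remove) auto
  finally have "\<bar>g t * b t $ \<iota> t\<bar> = \<bar>\<Sum>j\<in>{..<r} - {t}. g j * b j $ \<iota> t\<bar>" by linarith
  also have "\<dots> \<le> (\<Sum>j\<in>{..<r} - {t}. \<bar>g j * b j $ \<iota> t\<bar>)" by (rule sum_abs)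
  also have "\<dots> \<le> (\<Sum>j\<in>{..<r} - {t}. \<bar>g t\<bar> * real N)"
    unfolding abs_mult using le bo by (intro sum_mono mult_mono) auto
  also have "\<dots> = \<bar>g t\<bar> * (real (r - 1) * real N)" using t(1) by simp
  finally have "\<bar>g t\<bar> * \<bar>b t $ \<iota> t\<bar> \<le> \<bar>g t\<bar> * (real (r - 1) * real N)" by (simp only: abs_mult)
  moreover have "\<bar>g t\<bar> * ((2 * real CARD('n) - 1) * real N) \<le> \<bar>g t\<bar> * \<bar>b t $ \<iota> t\<bar>"
    using bt by (intro mult_left_mono) auto
  ultimately have *: "\<bar>g t\<bar> * ((2 * real CARD('n) - 1) * real N) \<le> \<bar>g t\<bar> * (real (r - 1) * real N)" by linarith
  have "real (r - 1) < 2 * real CARD('n) - 1" using r t(1) by (simp add: of_nat_diff)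
  then have "real (r - 1) * real N < (2 * real CARD('n) - 1) * real N" using N by simp
  then have "\<not> 0 < \<bar>g t\<bar>" using * mult_strict_left_mono not_less by blast
  then show "g i = 0" using le[OF i] by simp
qed

text \<open>A frame is recovered from its reduced basis and its integer coefficients
  \<open>m l i\<close>. This serves twice: with \<open>R\<close> a set of reduced sequences for
  skewed frames, and with \<open>R\<close> a single basis for the fibres of
  \<open>wedge_sum\<close>.\<close>

lemma card_frames_coeff_le:
  fixes S :: "(nat \<Rightarrow> real ^ 'n) set"
  assumes frame: "\<And>b. b \<in> S \<Longrightarrow> int_frame b r"
    and bnd: "\<And>b l i. b \<in> S \<Longrightarrow> l < r \<Longrightarrow> i < r \<Longrightarrow> \<bar>int_frame.m b r l i\<bar> \<le> B i"
    and B: "\<And>i. i < r \<Longrightarrow> 0 \<le> B i"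
    and R: "finite R" "\<And>b. b \<in> S \<Longrightarrow> restrict (lattice_basis (span (b ` {..<r}))) {..<r} \<in> R"
  shows "finite S" "real (card S) \<le> real (card R) * (\<Prod>l<r. \<Prod>i<r. 1 + 2 * B i)"
proof -
  let ?P = "{..<r} \<times> {..<r}"
  let ?I = "\<lambda>(l, i). {- \<lfloor>B i\<rfloor>..\<lfloor>B i\<rfloor>}"
  define g where "g b = (restrict (lattice_basis (span (b ` {..<r}))) {..<r},
      restrict (\<lambda>(l, i). \<lfloor>int_frame.m b r l i\<rfloor>) ?P)" for b :: "nat \<Rightarrow> real ^ 'n"
  have inj: "inj_on g S"
  proof (rule inj_onI)
    fix b b' assume S: "b \<in> S" "b' \<in> S" and eq: "g b = g b'"
    have e1: "restrict (lattice_basis (span (b ` {..<r}))) {..<r} = restrict (lattice_basis (span (b' ` {..<r}))) {..<r}"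
      using arg_cong[OF eq, of fst] by (simp only: g_def fst_conv)
    have e2: "restrict (\<lambda>(l, i). \<lfloor>int_frame.m b r l i\<rfloor>) ?P = restrict (\<lambda>(l, i). \<lfloor>int_frame.m b' r l i\<rfloor>) ?P"
      using arg_cong[OF eq, of snd] by (simp only: g_def snd_conv)
    show "b = b'"
    proof (rule int_frame_eqI[OF frame[OF S(1)] frame[OF S(2)]])
      show "lattice_basis (span (b ` {..<r})) i = lattice_basis (span (b' ` {..<r})) i" if "i < r" for i
        using fun_cong[OF e1, of i] that by simp
      show "\<lfloor>int_frame.m b r l i\<rfloor> = \<lfloor>int_frame.m b' r l i\<rfloor>" if "l < r" "i < r" for l i
        using fun_cong[OF e2, of "(l, i)"] that by simp
    qed
  qed
  have sub: "g ` S \<subseteq> R \<times> PiE ?P ?I"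
  proof (rule image_subsetI)
    fix b assume b: "b \<in> S"
    interpret int_frame b r using frame[OF b] .
    have "\<lfloor>m l i\<rfloor> \<in> ?I (l, i)" if "(l, i) \<in> ?P" for l i
      unfolding case_prod_conv using that by (intro Ints_floor_in_interval m_Ints bnd b) auto
    then have "restrict (\<lambda>(l, i). \<lfloor>m l i\<rfloor>) ?P \<in> PiE ?P ?I"
      unfolding restrict_PiE_iff by force
    then show "g b \<in> R \<times> PiE ?P ?I" unfolding g_def using R(2)[OF b] by blast
  qed
  have finI: "finite (PiE ?P ?I)" by (intro finite_PiE) auto
  have finRI: "finite (R \<times> PiE ?P ?I)" using R(1) finI by (rule finite_cartesian_product)
  show "finite S" using finite_subset[OF sub finRI] inj by (rule finite_imageD)
  have "card S = card (g ` S)" using card_image[OF inj] by simp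
  also have "\<dots> \<le> card (R \<times> PiE ?P ?I)" by (rule card_mono[OF finRI sub])
  also have "\<dots> = card R * card (PiE ?P ?I)" by (rule card_cartesian_product)
  finally have "real (card S) \<le> real (card R) * real (card (PiE ?P ?I))"
    unfolding of_nat_mult[symmetric] of_nat_le_iff .
  also have "real (card (PiE ?P ?I)) \<le> (\<Prod>l<r. \<Prod>i<r. 1 + 2 * B i)"
  proof -
    have "card (PiE ?P ?I) = (\<Prod>p\<in>?P. card (?I p))" by (rule card_PiE) auto
    then have "real (card (PiE ?P ?I)) = (\<Prod>p\<in>?P. real (card (?I p)))" by simp
    also have "\<dots> \<le> (\<Prod>(l, i)\<in>?P. 1 + 2 * B i)"
      using B by (intro prod_mono) (auto intro!: card_int_interval_le)
    also have "\<dots> = (\<Prod>l<r. \<Prod>i<r. 1 + 2 * B i)" by (rule prod.Sigma[symmetric]) auto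
    finally show ?thesis .
  qed
  finally show "real (card S) \<le> real (card R) * (\<Prod>l<r. \<Prod>i<r. 1 + 2 * B i)" by (simp add: mult_left_mono)
qed

text \<open>The dyadic sorting of the upper bound, now at the scale \<open>H\<close> of the frame
  vectors. Every \<open>a i\<close> is of order at most \<open>H\<close> by \<open>a_le\<close>, and
  having one of them below \<open>\<delta> * H\<close> is worth a factor
  \<open>sqrt \<delta>\<close>.\<close>

lemma card_skewed_frames_le:
  assumes r: "r < CARD('n)"
  shows "\<exists>C>0. \<forall>\<delta> H. \<forall>S :: (nat \<Rightarrow> real ^ 'n) set. 0 < \<delta> \<longrightarrow> \<delta> \<le> 1 \<longrightarrow> 0 < H \<longrightarrow> finite S \<longrightarrow>
    (\<forall>b\<in>S. int_frame b r \<and> (\<forall>l<r. norm (b l) \<le> H) \<and> (\<exists>i<r. gso_norm (span (b ` {..<r})) i < \<delta> * H)) \<longrightarrow>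
    real (card S) \<le> C * sqrt \<delta> * H ^ (CARD('n) * r)"
proof -
  let ?n = "CARD('n)"
  let ?D = "(2 ^ r + 1) ^ r :: real"
  obtain K where K: "K > 0" and cnt: "\<And>H \<beta>. H > 0 \<Longrightarrow> (\<forall>i<r. 1 / 2 ^ Suc r \<le> H * \<beta> i) \<Longrightarrow>
     finite (red_seqs (\<lambda>i. H * \<beta> i) r :: (nat \<Rightarrow> real ^ 'n) set) \<and>
     real (card (red_seqs (\<lambda>i. H * \<beta> i) r :: (nat \<Rightarrow> real ^ 'n) set))
       \<le> (K * H ^ ?n) ^ r * (\<Prod>j<r. (\<Prod>l<j. \<beta> l) * \<beta> j ^ (?n - j))"
    using card_red_seqs_scaled[where 'n = 'n, of r] r by (meson less_imp_le)
  obtain Z where Z: "Z > 0" and dy: "\<And>(S :: (nat \<Rightarrow> real ^ 'n) set) k B. finite S \<Longrightarrow> 0 \<le> B \<Longrightarrow>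
     (\<forall>A0\<in>S. real (card {A\<in>S. \<forall>j<r. k A j = k A0 j}) \<le> B * (\<Prod>j<r. dyad_wt (k A0 j))) \<Longrightarrow>
     real (card S) \<le> B * Z"
    using card_le_dyadic[where 'a = "nat \<Rightarrow> real ^ 'n", of r] by blast
  \<comment> \<open>Covers almost-monotonicity and the upper bound on \<open>\<beta>\<close>, and
    lets \<open>1 + 2 * (?D / \<beta> i)\<close> be absorbed into
    \<open>C / \<beta> i\<close>.\<close>
  define C where "C = 2 ^ Suc r + 2 ^ r * ?D + 2 * ?D"
  have D1: "1 \<le> ?D" by (intro one_le_power) simp
  have two: "1 \<le> (2::real) ^ Suc r" by (rule one_le_power) simp
  have D2: "0 \<le> 2 ^ r * ?D" by simp
  have C: "1 \<le> C" "2 ^ Suc r \<le> C" "2 ^ r * ?D + 2 * ?D \<le> C" unfolding C_def using D1 D2 two by linarith+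
  define W where "W = (C ^ (2 * r + ?n) * C ^ 2) ^ r"
  have W: "0 < W" unfolding W_def using C by (intro zero_less_power mult_pos_pos) auto
  have "real (card S) \<le> (K ^ r * W * Z) * sqrt \<delta> * H ^ (?n * r)"
    if \<delta>: "0 < \<delta>" "\<delta> \<le> 1" and H: "0 < H" and fin: "finite S"
      and S: "\<forall>b\<in>S. int_frame b r \<and> (\<forall>l<r. norm (b l) \<le> H) \<and> (\<exists>i<r. gso_norm (span (b ` {..<r})) i < \<delta> * H)"
    for \<delta> H and S :: "(nat \<Rightarrow> real ^ 'n) set"
  proof -
    let ?k = "\<lambda>b :: nat \<Rightarrow> real ^ 'n. gso_exponent H (span (b ` {..<r}))"
    have "real (card S) \<le> ((K * H ^ ?n) ^ r * W * sqrt \<delta>) * Z"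
    proof (rule dy[of _ _ ?k])
      show "finite S" by fact
      show "0 \<le> (K * H ^ ?n) ^ r * W * sqrt \<delta>" using K H W \<delta> by simp
      show "\<forall>b0\<in>S. real (card {b\<in>S. \<forall>j<r. ?k b j = ?k b0 j})
         \<le> (K * H ^ ?n) ^ r * W * sqrt \<delta> * (\<Prod>j<r. dyad_wt (?k b0 j))"
      proof
        fix b0 assume b0: "b0 \<in> S"
        interpret int_frame b0 r using b0 S by auto
        define \<beta> where "\<beta> i = 2 powr real_of_int (?k b0 i)" for i
        have \<beta>0: "0 < \<beta> i" for i by (simp add: \<beta>_def)
        have lo: "H * \<beta> i \<le> a i" if "i < r" for i
          using exponent_bounds(1)[OF H that] by (simp add: \<beta>_def)
        have "\<forall>i<r. 1 / 2 ^ Suc r \<le> H * \<beta> i" unfolding \<beta>_def using scale_lower[OF H] by blast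
        note cnt' = cnt[OF H this]
        have mono: "\<beta> i \<le> C * \<beta> j" if "i \<le> j" "j < r" for i j
        proof -
          have "\<beta> i \<le> 2 ^ Suc r * \<beta> j" unfolding \<beta>_def by (rule scale_mono[OF H that])
          also have "\<dots> \<le> C * \<beta> j" using \<beta>0[of j] C by (intro mult_right_mono) auto
          finally show ?thesis .
        qed
        have top': "\<beta> j \<le> 2 ^ r * ?D" if "j < r" for j
        proof -
          have "H * \<beta> j \<le> a j" using lo that by simp
          also have "\<dots> \<le> 2 ^ r * ?D * H" using S b0 that by (intro a_le) auto
          finally have "H * \<beta> j \<le> H * (2 ^ r * ?D)" by (simp only: mult_ac)
          then show ?thesis using H by (simp only: mult_le_cancel_left_pos)
        qed
        have top: "\<beta> j \<le> C" if "j < r" for j using top'[OF that] C(3) D1 by linarith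
        obtain i0 where i0: "i0 < r" "a i0 < \<delta> * H" using S b0 by blast
        have "H * \<beta> i0 \<le> H * \<delta>" using lo[OF i0(1)] i0(2) by (simp add: mult.commute)
        then have small: "\<beta> i0 \<le> \<delta>" using H by (simp only: mult_le_cancel_left_pos)
        let ?R = "red_seqs (\<lambda>i. H * \<beta> i) r :: (nat \<Rightarrow> real ^ 'n) set"
        have "real (card {b\<in>S. \<forall>j<r. ?k b j = ?k b0 j}) \<le> real (card ?R) * (\<Prod>l<r. \<Prod>i<r. 1 + 2 * (?D / \<beta> i))"
        proof (rule card_frames_coeff_le(2))
          show "finite ?R" using cnt' by blast
          fix b assume b: "b \<in> {b\<in>S. \<forall>j<r. ?k b j = ?k b0 j}"
          then interpret B: int_frame b r using S by auto
          show "int_frame b r" by (rule B.int_frame_axioms)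
          show "restrict B.v {..<r} \<in> ?R" using b by (intro B.basis_in_red_seqs[OF H]) (simp add: \<beta>_def)
          fix l i assume li: "l < r" "i < r"
          have "\<bar>B.m l i\<bar> \<le> ?D * H / (H * \<beta> i)"
          proof (rule B.m_bound[OF li(2)])
            show "norm (b l) \<le> H" using b S li by auto
            show "0 < H * \<beta> i" using H \<beta>0 by simp
            show "H * \<beta> i \<le> B.a i" using B.exponent_bounds(1)[OF H li(2)] b li by (simp add: \<beta>_def)
          qed
          then show "\<bar>B.m l i\<bar> \<le> ?D / \<beta> i" using H by simp
        qed (use \<beta>0 in \<open>auto simp: less_imp_le\<close>)
        also have "\<dots> \<le> ((K * H ^ ?n) ^ r * (\<Prod>j<r. (\<Prod>l<j. \<beta> l) * \<beta> j ^ (?n - j))) *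
              (\<Prod>l<r. \<Prod>i<r. C / \<beta> i)"
        proof (intro mult_mono prod_mono conjI)
          show "real (card ?R) \<le> (K * H ^ ?n) ^ r * (\<Prod>j<r. (\<Prod>l<j. \<beta> l) * \<beta> j ^ (?n - j))" using cnt' by blast
          fix i assume i: "i \<in> {..<r}"
          have "\<beta> i + 2 * ?D \<le> C" using top'[of i] i C(3) by auto
          then have "(\<beta> i + 2 * ?D) / \<beta> i \<le> C / \<beta> i" using \<beta>0[of i] by (intro divide_right_mono) auto
          then show "1 + 2 * (?D / \<beta> i) \<le> C / \<beta> i" using \<beta>0[of i] by (simp add: add_divide_distrib)
        qed (use \<beta>0 K H in \<open>auto intro!: prod_nonneg mult_nonneg_nonneg zero_le_power simp: less_imp_le\<close>)
        also have "\<dots> = (K * H ^ ?n) ^ r * (\<Prod>j<r. (\<Prod>l<j. \<beta> l) * \<beta> j ^ (?n - j) * (\<Prod>i<r. C / \<beta> i))"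
          by (simp only: prod.distrib mult.assoc)
        also have "\<dots> \<le> (K * H ^ ?n) ^ r * (W * sqrt \<delta> * (\<Prod>j<r. dyad_wt (?k b0 j)))"
          unfolding W_def
          by (intro mult_left_mono dyadic_weight_le_small[where ?i0.0 = i0] r C(1) mono top \<delta> i0(1) small)
            (use K H in \<open>auto simp: \<beta>_def\<close>)
        finally show "real (card {b\<in>S. \<forall>j<r. ?k b j = ?k b0 j})
           \<le> (K * H ^ ?n) ^ r * W * sqrt \<delta> * (\<Prod>j<r. dyad_wt (?k b0 j))" by (simp only: mult.assoc)
      qed
    qed
    also have "\<dots> = (K ^ r * W * Z) * sqrt \<delta> * H ^ (?n * r)"
      by (simp add: power_mult_distrib power_mult)
    finally show ?thesis .
  qed
  moreover have "0 < K ^ r * W * Z" using K W Z by simp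
  ultimately show ?thesis by blast
qed

subsection \<open>The lower bound\<close>

text \<open>Frames are drawn from boxes near distinct axes. At least half of them are not skewed,
  \<open>wedge_sum\<close> maps these into the matrices to be counted, and its fibres have bounded
  size.\<close>

lemma card_alt_matrix_ge:
  assumes r: "even r" "r < CARD('n::finite)"
  shows "\<exists>c>0. \<exists>T0>0. \<forall>T\<ge>T0. c * sqrt T ^ (CARD('n) * r)
     \<le> real (card {M :: real ^ 'n ^ 'n. alt_matrix M r \<and> norm M < T})"
proof -
  let ?n = "CARD('n)"
  let ?D = "(2 ^ r + 1) ^ r :: real"
  obtain s where s: "r = 2 * s" using r(1) by blast
  obtain \<iota>0 :: "nat \<Rightarrow> 'n" where "bij_betw \<iota>0 {0..<?n} UNIV"
    using ex_bij_betw_nat_finite[of "UNIV :: 'n set"] by auto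
  then have "inj_on \<iota>0 {0..<?n}" by (rule bij_betw_imp_inj_on)
  then have inj: "inj_on \<iota>0 {..<r}" by (rule inj_on_subset) (use r in auto)
  obtain C where C: "C > 0" and skewed: "\<And>\<delta> H (S :: (nat \<Rightarrow> real ^ 'n) set). 0 < \<delta> \<Longrightarrow> \<delta> \<le> 1 \<Longrightarrow> 0 < H \<Longrightarrow> finite S \<Longrightarrow>
    (\<forall>b\<in>S. int_frame b r \<and> (\<forall>l<r. norm (b l) \<le> H) \<and> (\<exists>i<r. gso_norm (span (b ` {..<r})) i < \<delta> * H)) \<Longrightarrow>
    real (card S) \<le> C * sqrt \<delta> * H ^ (?n * r)"
    using card_skewed_frames_le[OF r(2)] by blast
  \<comment> \<open>The constant of \<open>near_axis_norm\<close>, so that the frame vectors have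
    norm at most \<open>H = q * N\<close>.\<close>
  define q where "q = 3 * (real ?n)\<^sup>2"
  have n1: "1 \<le> real ?n" by (simp add: Suc_leI)
  have q: "0 < q" unfolding q_def by simp
  \<comment> \<open>Chosen so that the skewed frames number at most half of
    \<open>N ^ (n * r)\<close>; \<open>\<delta>\<close> is then a square because the bound involves
    \<open>sqrt \<delta>\<close>.\<close>
  define x where "x = 1 / (2 * C * q ^ (?n * r))"
  have x: "0 < x" unfolding x_def using C q by simp
  define \<delta> where "\<delta> = (min 1 x)\<^sup>2"
  have \<delta>: "0 < \<delta>" "\<delta> \<le> 1" unfolding \<delta>_def using x by (auto simp: abs_square_le_1)
  have "sqrt \<delta> = min 1 x" unfolding \<delta>_def using x by simp
  then have "C * sqrt \<delta> * q ^ (?n * r) \<le> C * x * q ^ (?n * r)"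
    using C q by (intro mult_right_mono mult_left_mono) auto
  also have "\<dots> = 1 / 2" unfolding x_def using C q by (simp add: field_simps)
  finally have half: "C * sqrt \<delta> * q ^ (?n * r) \<le> 1 / 2" .
  \<comment> \<open>Bounds the number of integer \<open>r\<close> by \<open>r\<close> matrices with
    entries at most \<open>?D / \<delta>\<close> in absolute value, and hence the fibres of
    \<open>wedge_sum\<close>.\<close>
  define M0 where "M0 = (\<Prod>l<r. \<Prod>i<r. 1 + 2 * (?D / \<delta>))"
  have M0: "0 < M0" unfolding M0_def using \<delta> by (intro prod_pos) (auto intro!: add_pos_nonneg)
  \<comment> \<open>For \<open>N \<le> sqrt T / E\<close>, \<open>norm_wedge_sum_le\<close> puts the
    matrices below norm \<open>T\<close>; the \<open>+ 1\<close> gives strict inequality, also for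
    \<open>r = 0\<close>.\<close>
  define E where "E = real ?n * q * real (r + 1)"
  have E: "0 < E" unfolding E_def using q n1 by simp
  \<comment> \<open>Collects the half of the frames that is kept, the factor 2 lost in rounding
    \<open>N\<close>, and the fibre size.\<close>
  define c where "c = 1 / (2 * M0 * (2 * E) ^ (?n * r))"
  have c: "0 < c" unfolding c_def using M0 E by simp
  have "c * sqrt T ^ (?n * r) \<le> real (card {M :: real ^ 'n ^ 'n. alt_matrix M r \<and> norm M < T})" if T: "E\<^sup>2 \<le> T" for T
  proof -
    have T0: "0 < T" using T E by (meson less_le_trans zero_less_power)
    have sT: "E \<le> sqrt T" using T E by (simp add: real_le_rsqrt)
    define N where "N = nat \<lfloor>sqrt T / E\<rfloor>"
    have y1: "1 \<le> sqrt T / E" using sT E by (simp add: field_simps)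
    have N1: "0 < N" unfolding N_def using y1 by simp
    have Nle: "real N \<le> sqrt T / E" unfolding N_def using y1 by simp
    have "sqrt T / E < real N + 1" unfolding N_def using y1 by simp
    then have "sqrt T / E \<le> 2 * real N" using N1 by linarith
    then have Nge: "sqrt T / (2 * E) \<le> real N" by (simp add: field_simps)
    define H where "H = q * real N"
    have H: "0 < H" unfolding H_def using q N1 by simp
    let ?B = "PiE {..<r} (\<lambda>i. near_axis (\<iota>0 i) N)"
    let ?skew = "\<lambda>b. \<exists>i<r. gso_norm (span (b ` {..<r})) i < \<delta> * H"
    let ?bad = "{b\<in>?B. ?skew b}" and ?good = "{b\<in>?B. \<not> ?skew b}"
    have finB: "finite ?B" using finite_near_axis by (intro finite_PiE) auto
    have frame: "int_frame b r" if "b \<in> ?B" for b by (rule int_frame_near_axis[OF inj r(2) N1 that])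
    have norm: "norm (b l) \<le> H" if "b \<in> ?B" "l < r" for b l
      using near_axis_norm[of "b l" "\<iota>0 l" N] PiE_mem[OF that(1), of l] that(2) by (simp add: H_def q_def)
    have "real N ^ (?n * r) = (\<Prod>i<r. real N ^ ?n)" by (simp add: power_mult)
    also have "\<dots> \<le> (\<Prod>i<r. real (card (near_axis (\<iota>0 i) N)))"
    proof (intro prod_mono conjI)
      fix i
      show "real N ^ ?n \<le> real (card (near_axis (\<iota>0 i) N))"
        unfolding of_nat_power[symmetric] of_nat_le_iff by (rule card_near_axis)
    qed simp
    also have "\<dots> = real (card ?B)" by (simp add: card_PiE)
    finally have cB: "real N ^ (?n * r) \<le> real (card ?B)" .
    have "card ?B = card ?bad + card ?good"
      using finB by (subst card_Un_disjoint[symmetric]) (auto intro!: arg_cong[of _ _ card])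
    moreover have "real (card ?bad) \<le> 1 / 2 * real N ^ (?n * r)"
    proof -
      have "real (card ?bad) \<le> C * sqrt \<delta> * H ^ (?n * r)"
        by (rule skewed[OF \<delta> H]) (use finB frame norm in auto)
      also have "\<dots> = (C * sqrt \<delta> * q ^ (?n * r)) * real N ^ (?n * r)"
        by (simp add: H_def power_mult_distrib)
      also have "\<dots> \<le> 1 / 2 * real N ^ (?n * r)" using half by (intro mult_right_mono) auto
      finally show ?thesis .
    qed
    ultimately have good: "1 / 2 * real N ^ (?n * r) \<le> real (card ?good)" using cB by simp
    let ?S = "{M :: real ^ 'n ^ 'n. alt_matrix M r \<and> norm M < T}"
    have finS: "finite ?S" by (rule finite_alt_matrix)
    have sub: "wedge_sum s ` ?good \<subseteq> ?S"
    proof (rule image_subsetI)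
      fix b assume "b \<in> ?good"
      then have b: "b \<in> ?B" by blast
      have "norm (wedge_sum s b) \<le> (real ?n)\<^sup>2 * real (2 * s) * H\<^sup>2"
        using norm[OF b] s by (intro norm_wedge_sum_le) auto
      also have "\<dots> = (real ?n * q * real N)\<^sup>2 * real r" by (simp add: H_def s power_mult_distrib)
      also have "\<dots> < (real ?n * q * real N)\<^sup>2 * (real (r + 1))\<^sup>2"
      proof (rule mult_strict_left_mono)
        have "real r < real (r + 1) * 1" by simp
        also have "\<dots> \<le> real (r + 1) * real (r + 1)" by (intro mult_left_mono) auto
        finally show "real r < (real (r + 1))\<^sup>2" by (simp only: power2_eq_square)
        show "0 < (real ?n * q * real N)\<^sup>2" using n1 q N1 by simp
      qed
      also have "\<dots> = (real N * E)\<^sup>2" by (simp add: E_def power_mult_distrib)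
      also have "\<dots> \<le> (sqrt T)\<^sup>2"
        using Nle E N1 by (intro power_mono) (auto simp: field_simps)
      also have "\<dots> = T" using T0 by simp
      finally show "wedge_sum s b \<in> ?S" using alt_matrix_wedge_sum[OF frame[OF b] s] by blast
    qed
    \<comment> \<open>The column space of \<open>A\<close> is the span of every frame in its fibre,
      so these frames share one reduced basis, and not being skewed bounds their coefficients in
      it.\<close>
    have fibre: "real (card {b\<in>?good. wedge_sum s b = A}) \<le> M0" if A: "A \<in> ?S" for A
    proof -
      let ?F = "{b\<in>?good. wedge_sum s b = A}"
      let ?R = "{restrict (lattice_basis (range ((*v) A))) {..<r}}"
      have "real (card ?F) \<le> real (card ?R) * (\<Prod>l<r. \<Prod>i<r. 1 + 2 * (?D / \<delta>))"
      proof (rule card_frames_coeff_le(2))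
        fix b assume "b \<in> ?F"
        then have b: "b \<in> ?B" "\<not> ?skew b" "wedge_sum s b = A" by auto
        interpret int_frame b r by (rule frame[OF b(1)])
        show "int_frame b r" by (rule int_frame_axioms)
        show "restrict v {..<r} \<in> ?R" using wedge_sum_range[OF int_frame_axioms s] b(3) by simp
        fix l i assume li: "l < r" "i < r"
        have "\<delta> * H \<le> a i" using b(2) li(2) not_less by blast
        then have "\<bar>m l i\<bar> \<le> ?D * H / (\<delta> * H)"
          using li \<delta> H by (intro m_bound norm[OF b(1)]) auto
        then show "\<bar>m l i\<bar> \<le> ?D / \<delta>" using H by simp
      qed (use \<delta> in auto)
      then show ?thesis by (simp add: M0_def)
    qed
    have "card ?good = (\<Sum>A\<in>?S. card {b\<in>?good. wedge_sum s b = A})"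
      using sum.group[OF _ finS sub, of "\<lambda>_. 1::nat"] finB by simp
    then have "real (card ?good) = (\<Sum>A\<in>?S. real (card {b\<in>?good. wedge_sum s b = A}))" by simp
    also have "\<dots> \<le> real (card ?S) * M0" using fibre by (intro sum_bounded_above)
    finally have "1 / 2 * real N ^ (?n * r) \<le> real (card ?S) * M0" using good by linarith
    moreover have "(sqrt T / (2 * E)) ^ (?n * r) \<le> real N ^ (?n * r)"
      using Nge E T0 by (intro power_mono) auto
    ultimately have "1 / 2 * (sqrt T / (2 * E)) ^ (?n * r) \<le> real (card ?S) * M0" by linarith
    then have "1 / 2 * (sqrt T / (2 * E)) ^ (?n * r) / M0 \<le> real (card ?S)"
      using M0 by (simp add: divide_le_eq)
    then show ?thesis by (simp add: c_def power_divide power_mult_distrib field_simps)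
  qed
  then show ?thesis using c E by (intro exI[of _ c] conjI exI[of _ "E\<^sup>2"]) auto
qed

section \<open>From integer matrices to real matrices\<close>

lemma int_matrix_norm_eq: "int_matrix_norm A = norm (\<chi> i j. real_of_int (A $ i $ j))"
  by (simp add: int_matrix_norm_def norm_vec_def L2_set_def sum_nonneg)

text \<open>The entrywise embedding into the reals is a bijection, inverted by taking floors. It
  preserves rank by definition and the norm by \<open>int_matrix_norm_eq\<close>.\<close>

lemma alt_rank_count_eq:
  "alt_rank_count TYPE('n::finite) r T = card {M :: real ^ 'n ^ 'n. alt_matrix M r \<and> norm M < T}"
proof -
  let ?R = "\<lambda>A :: int ^ 'n ^ 'n. (\<chi> i j. real_of_int (A $ i $ j)) :: real ^ 'n ^ 'n"
  let ?X = "{A :: int ^ 'n ^ 'n. A \<in> alt_int_matrices \<and> int_matrix_rank A = r \<and> int_matrix_norm A < T}"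
  let ?Y = "{M :: real ^ 'n ^ 'n. alt_matrix M r \<and> norm M < T}"
  have alt: "alt_matrix (?R A) r \<longleftrightarrow> A \<in> alt_int_matrices \<and> int_matrix_rank A = r" for A
  proof -
    have "transpose (?R A) = - ?R A \<longleftrightarrow> (\<forall>i j. A $ j $ i = - A $ i $ j)"
      by (simp add: vec_eq_iff transpose_def of_int_minus[symmetric] del: of_int_minus)
    also have "\<dots> \<longleftrightarrow> A \<in> alt_int_matrices"
    proof
      assume h: "\<forall>i j. A $ j $ i = - A $ i $ j"
      have "A $ i $ i = 0" for i using h[rule_format, of i i] by linarith
      moreover have "transpose A = - A"
        by (simp add: vec_eq_iff transpose_def) (use h in blast)
      ultimately show "A \<in> alt_int_matrices" unfolding alt_int_matrices_def by blast
    next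
      assume "A \<in> alt_int_matrices"
      then have t: "transpose A = - A" unfolding alt_int_matrices_def by blast
      show "\<forall>i j. A $ j $ i = - A $ i $ j"
      proof (intro allI)
        fix i j
        have "A $ j $ i = transpose A $ i $ j" by (simp add: transpose_def)
        also have "\<dots> = - A $ i $ j" by (simp add: t)
        finally show "A $ j $ i = - A $ i $ j" .
      qed
    qed
    finally have "transpose (?R A) = - ?R A \<longleftrightarrow> A \<in> alt_int_matrices" .
    moreover have "?R A $ i \<in> int_vec" for i by (simp add: int_vec_def)
    ultimately show ?thesis unfolding alt_matrix_def int_matrix_rank_def by blast
  qed
  have "bij_betw ?R ?X ?Y"
  proof (rule bij_betw_imageI)
    show "inj_on ?R ?X" by (simp add: inj_on_def vec_eq_iff)
    show "?R ` ?X = ?Y"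
    proof
      show "?R ` ?X \<subseteq> ?Y" unfolding int_matrix_norm_eq using alt by blast
      show "?Y \<subseteq> ?R ` ?X"
      proof
        fix M assume M: "M \<in> ?Y"
        let ?A = "\<chi> i j. \<lfloor>M $ i $ j\<rfloor>"
        have "M $ i $ j \<in> \<int>" for i j using M by (auto simp: alt_matrix_def int_vec_def)
        then have e: "M = ?R ?A" by (simp add: vec_eq_iff)
        then have "alt_matrix (?R ?A) r" "norm (?R ?A) < T" using M by simp_all
        then have "?A \<in> ?X" unfolding int_matrix_norm_eq using alt by blast
        then show "M \<in> ?R ` ?X" using e by (rule rev_image_eqI)
      qed
    qed
  qed
  then show ?thesis unfolding alt_rank_count_def by (rule bij_betw_same_card)
qed

lemma powr_half_eq_sqrt_power:
  assumes "0 < T" shows "T powr (real n * real r / 2) = sqrt T ^ (n * r)"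
proof -
  have "sqrt T ^ (n * r) = (T powr (1 / 2)) ^ (n * r)" using assms by (simp add: powr_half_sqrt)
  also have "\<dots> = T powr (real n * real r / 2)" using assms by (subst powr_power) auto
  finally show ?thesis by simp
qed

theorem theorem9p1p2:
  shows "\<exists>c > 0. \<exists>C > 0. \<forall>r :: nat. even r \<and> r \<le> CARD('n::finite) - 1 \<longrightarrow>
    (\<forall>\<^sub>F T :: real in at_top.
       c * T powr (real CARD('n) * real r / 2) \<le> real (alt_rank_count TYPE('n) r T) \<and>
       real (alt_rank_count TYPE('n) r T) \<le> C * T powr (real CARD('n) * real r / 2))"
proof -
  let ?n = "CARD('n)"
  let ?P = "\<lambda>r T c C. c * T powr (real ?n * real r / 2) \<le> real (alt_rank_count TYPE('n) r T) \<and>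
       real (alt_rank_count TYPE('n) r T) \<le> C * T powr (real ?n * real r / 2)"
  let ?I = "{r. even r \<and> r < ?n}"
  have "\<forall>r\<in>?I. \<exists>p. 0 < fst p \<and> 0 < snd p \<and> (\<forall>\<^sub>F T in at_top. ?P r T (fst p) (snd p))"
  proof
    fix r assume r: "r \<in> ?I"
    obtain C where C: "C > 0" "\<forall>T>0. real (card {M :: real ^ 'n ^ 'n. alt_matrix M r \<and> norm M < T})
       \<le> C * sqrt T ^ (?n * r)"
      using card_alt_matrix_le[of r, where 'n = 'n] r by blast
    obtain c T0 where c: "c > 0" "T0 > 0" "\<forall>T\<ge>T0. c * sqrt T ^ (?n * r)
       \<le> real (card {M :: real ^ 'n ^ 'n. alt_matrix M r \<and> norm M < T})"
      using card_alt_matrix_ge[of r, where 'n = 'n] r by blast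
    have "?P r T c C" if "T0 \<le> T" for T
      using C(2) c(2,3) that by (simp add: alt_rank_count_eq powr_half_eq_sqrt_power)
    then have "\<forall>\<^sub>F T in at_top. ?P r T c C" by (auto simp: eventually_at_top_linorder)
    then show "\<exists>p. 0 < fst p \<and> 0 < snd p \<and> (\<forall>\<^sub>F T in at_top. ?P r T (fst p) (snd p))"
      using C(1) c(1) by (intro exI[of _ "(c, C)"]) simp
  qed
  from bchoice[OF this] obtain p where
    p: "\<forall>r\<in>?I. 0 < fst (p r) \<and> 0 < snd (p r) \<and> (\<forall>\<^sub>F T in at_top. ?P r T (fst (p r)) (snd (p r)))" by blast
  define cf Cf where "cf r = fst (p r)" and "Cf r = snd (p r)" for r
  have f: "0 < cf r" "0 < Cf r" "\<forall>\<^sub>F T in at_top. ?P r T (cf r) (Cf r)" if "r \<in> ?I" for r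
    using p that unfolding cf_def Cf_def by blast+
  have fin: "finite ?I" by simp
  have ne: "?I \<noteq> {}" by (auto intro!: exI[of _ 0])
  \<comment> \<open>Only finitely many \<open>r\<close> occur for given \<open>n\<close>, so the
    extreme constants work for all of them at once; the threshold for \<open>T\<close> may still
    vary with \<open>r\<close>.\<close>
  define c where "c = Min (cf ` ?I)"
  define C where "C = Max (Cf ` ?I)"
  have c: "0 < c" unfolding c_def using fin ne f(1) by (subst Min_gr_iff) auto
  have C: "0 < C" unfolding C_def using fin ne f(2) by (subst Max_gr_iff) auto
  have "\<forall>\<^sub>F T in at_top. ?P r T c C" if "even r \<and> r \<le> ?n - 1" for r
  proof -
    have "0 < ?n" by simp
    then have "r < ?n" using that by linarith
    then have r: "r \<in> ?I" using that by blast
    have le: "c \<le> cf r" "Cf r \<le> C" unfolding c_def C_def using r fin by (auto intro!: Min_le Max_ge)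
    have "\<forall>\<^sub>F T in at_top. ?P r T (cf r) (Cf r)" by (rule f(3)[OF r])
    then show ?thesis
    proof (rule eventually_mono)
      fix T assume P: "?P r T (cf r) (Cf r)"
      have "0 \<le> T powr (real ?n * real r / 2)" by simp
      then have "c * T powr (real ?n * real r / 2) \<le> cf r * T powr (real ?n * real r / 2)"
        "Cf r * T powr (real ?n * real r / 2) \<le> C * T powr (real ?n * real r / 2)"
        using le by (auto intro!: mult_right_mono)
      then show "?P r T c C" using P by linarith
    qed
  qed
  then show ?thesis using c C by blast
qed

end
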